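(* Let $d=4$ and let $h\in\mathcal{A}(\mathbb{T}^4_\theta)$ be positive with bounded inverse. The naive generalization $$\Delta_h=\sum_{a=1}^4h^{-2}\,\delta_a\,h^2\,\delta_a\,h^{-2}$$ to the noncommutative case of the Laplace–Beltrami operator for the conformally rescaled metric is not a minimal operator: it does not minimize the Wodzicki residue of $\Delta^{-1}$, with $h$ fixed, among the Laplace-type operators $$\Delta=\Delta_h+\sum_{a=1}^4\Big(T_a\delta_a+\tfrac12\delta_a(T_a)\Big),\qquad T_1,\dots,T_4\in\mathcal{A}(\mathbb{T}^4_\theta)\ \text{selfadjoint}.$$
   Context: Noncommutative torus. $\mathcal{A}(\mathbb{T}^4_\theta)$ is the $*$-algebra of elements $a=\sum_{\beta\in\mathbb{Z}^4}a_\beta U^\beta$ with $(a_\beta)$ rapidly decreasing, $U^\beta=U_1^{\beta_1}\cdots U_4^{\beta_4}$, where $U_1,\dots,U_4$ are unitaries with $U_jU_k=e^{2\pi i\theta_{jk}}U_kU_j$ for real $\theta_{jk}$ ($0<\theta_{jk}<1$ for $j<k$, $\theta_{kj}=-\theta_{jk}$). The derivations $\delta_1,\dots,\delta_4$ are determined by $\delta_k(U_j)=\delta_{jk}U_j$ (Kronecker delta), and $\mathfrak{t}(a)=a_{\mathbf 0}$ is the canonical trace. Positivity and bounded inverse refer to the $C^*$-completion acting on the GNS Hilbert space of $\mathfrak{t}$; elements of the algebra act by left multiplication and operators are composed. Symbols. The symbol of a differential operator $\sum a_\beta\delta^\beta$ is $\sum a_\beta\xi^\beta$, and symbols multiply by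 $\rho(PQ)=\sum_{\gamma}\frac1{\gamma!}\partial_\xi^\gamma(\rho(P))\,\delta^\gamma(\rho(Q))$. The symbol of $\Delta$ is $a_2+a_1+a_0$ with $$a_2=h^{-2}|\xi|^2,\quad a_1=\sum_a\big(\delta_a(h^{-2})+T_a\big)\xi_a,\quad a_0=\sum_a\Big(\delta_a^2(h^{-2})+h^{-2}\delta_a(h^2)\,\delta_a(h^{-2})+\tfrac12\delta_a(T_a)\Big);$$ the case in which all $T_a=0$ is $\Delta_h$. The symbol of the parametrix $\Delta^{-1}$ is $b_0+b_1+b_2+\cdots$, $b_k$ homogeneous of degree $-2-k$ in $\xi$, determined by $$b_0a_2=1,\qquad b_1a_2+b_0a_1+\sum_k\partial_{\xi_k}(b_0)\,\delta_k(a_2)=0,$$ $$b_2a_2+b_1a_1+b_0a_0+\sum_k\partial_{\xi_k}(b_0)\,\delta_k(a_1)+\sum_k\partial_{\xi_k}(b_1)\,\delta_k(a_2)+\tfrac12\sum_{j,k}\partial_{\xi_k}\partial_{\xi_j}(b_0)\,\delta_k\delta_j(a_2)=0.$$ The Wodzicki residue is $\mathrm{Wres}(\Delta^{-1})=\int_{S^3}\mathfrak{t}(b_2(\xi))\,d\xi$, with the standard surface measure on the unit sphere $S^3$. Minimal operators are those Laplace-type operators in the family which, at a fixed metric (that is, at fixed $h$), minimize $\mathrm{Wres}(\Delta^{-1})$.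
   Formalization: As stated the claim fails for h = 1 (then Δ_h is minimal); it is proved for every positive h with bounded inverse that does not commute with some δ_a(h), and such h are shown to exist; when h commutes with all δ_a(h), Δ_h is minimal. *)

theory Defs
  imports "HOL-Analysis.Analysis" "HOL-Library.Function_Algebras"
begin

text \<open>
  An element \<open>a = (\<Sum>\<beta>. a\<^sub>\<beta> U\<^sup>\<beta>)\<close> is represented by its coefficient family, and so is a vector
  of the GNS space. The four directions are the elements \<open>0 < 1 < 2 < 3\<close> of the type \<open>4\<close>; note
  that the numeral \<open>4\<close> of that type is \<open>0\<close>. Addition, negation, subtraction, zero and finite sums
  of coefficient families are the pointwise ones; the pointwise product of
  \<open>HOL-Library.Function_Algebras\<close> is never used.
\<close>

type_synonym coeffs = "int^4 \<Rightarrow> complex"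

definition smooth_torus :: "coeffs set" where
  "smooth_torus = {a. \<forall>k::nat. \<exists>C. \<forall>\<beta>. (1 + real_of_int (\<Sum>j\<in>UNIV. \<bar>\<beta> $ j\<bar>)) ^ k * cmod (a \<beta>) \<le> C}"

definition cscale :: "complex \<Rightarrow> coeffs \<Rightarrow> coeffs" (infixr "*\<^sub>C" 75) where
  "z *\<^sub>C a = (\<lambda>\<beta>. z * a \<beta>)"

definition monomial :: "int^4 \<Rightarrow> coeffs" where
  "monomial \<beta> = (\<lambda>\<gamma>. if \<gamma> = \<beta> then 1 else 0)"

abbreviation unit :: coeffs where
  "unit \<equiv> monomial 0"

abbreviation gen :: "4 \<Rightarrow> coeffs" where
  "gen j \<equiv> monomial (axis j 1)"

definition canonical_trace :: "coeffs \<Rightarrow> complex" where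
  "canonical_trace a = a 0"

definition delta :: "4 \<Rightarrow> coeffs \<Rightarrow> coeffs" where
  "delta k a = (\<lambda>\<beta>. of_int (\<beta> $ k) * a \<beta>)"

definition delta_pow :: "nat^4 \<Rightarrow> coeffs \<Rightarrow> coeffs" where
  "delta_pow \<beta> = (delta 0 ^^ (\<beta> $ 0)) \<circ> (delta 1 ^^ (\<beta> $ 1)) \<circ> (delta 2 ^^ (\<beta> $ 2)) \<circ> (delta 3 ^^ (\<beta> $ 3))"

text \<open>
  The GNS Hilbert space of the canonical trace: the family \<open>U\<^sup>\<beta>\<close> is an orthonormal basis, which
  identifies the space with the square summable families (see \<open>gns_inner_eq_trace\<close> below).
\<close>

definition gns_space :: "coeffs set" where
  "gns_space = {x. (\<lambda>\<beta>. (cmod (x \<beta>))\<^sup>2) summable_on UNIV}"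

definition gns_inner :: "coeffs \<Rightarrow> coeffs \<Rightarrow> complex" where
  "gns_inner x y = (\<Sum>\<^sub>\<infinity>\<beta>. cnj (x \<beta>) * y \<beta>)"

definition gns_norm :: "coeffs \<Rightarrow> real" where
  "gns_norm x = sqrt (\<Sum>\<^sub>\<infinity>\<beta>. (cmod (x \<beta>))\<^sup>2)"

definition gns_bounded_operator :: "(coeffs \<Rightarrow> coeffs) \<Rightarrow> bool" where
  "gns_bounded_operator B \<longleftrightarrow>
     (\<forall>x\<in>gns_space. B x \<in> gns_space) \<and>
     (\<forall>x\<in>gns_space. \<forall>y\<in>gns_space. B (x + y) = B x + B y) \<and>
     (\<forall>z. \<forall>x\<in>gns_space. B (z *\<^sub>C x) = z *\<^sub>C B x) \<and>
     (\<exists>C. \<forall>x\<in>gns_space. gns_norm (B x) \<le> C * gns_norm x)"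

text \<open>
  Surface measure on the unit sphere through polar coordinates: the measure of \<open>E\<close> is the dimension
  times the Lebesgue measure of the cone \<open>{t x | x \<in> E, 0 < t \<le> 1}\<close>.
\<close>

definition sphere_measure :: "'a::euclidean_space measure" where
  "sphere_measure = scale_measure (of_nat DIM('a))
     (distr (restrict_space lborel (cball 0 1 - {0})) (restrict_space borel (sphere 0 1))
        (\<lambda>x. x /\<^sub>R norm x))"

text \<open>
  Partial derivatives in \<open>\<xi>\<close> of functions with values in the algebra, taken coefficientwise.
\<close>

definition pderiv_xi :: "4 \<Rightarrow> (real^4 \<Rightarrow> coeffs) \<Rightarrow> real^4 \<Rightarrow> coeffs" where
  "pderiv_xi k f \<xi> = (\<lambda>\<beta>. vector_derivative (\<lambda>t. f (\<xi> + t *\<^sub>R axis k 1) \<beta>) (at 0))"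

locale nc_torus =
  fixes \<theta> :: "real^4^4"
  assumes theta_antisym: "\<theta> $ k $ j = - \<theta> $ j $ k"
    and theta_pos: "j < k \<Longrightarrow> 0 < \<theta> $ j $ k"
    and theta_less_one: "j < k \<Longrightarrow> \<theta> $ j $ k < 1"
begin

text \<open>
  Reordering with \<open>U\<^sub>k U\<^sub>j = exp (2 \<pi> \<i> \<theta>\<^sub>k\<^sub>j) U\<^sub>j U\<^sub>k\<close> gives
  \<open>U\<^sup>\<beta> U\<^sup>\<gamma> = cocycle \<beta> \<gamma> U\<^sup>\<beta>\<^sup>+\<^sup>\<gamma>\<close>, hence \<open>(U\<^sup>\<beta>)\<^sup>* = cnj (cocycle \<beta> (- \<beta>)) U\<^sup>-\<^sup>\<beta>\<close>.
\<close>

definition cocycle :: "int^4 \<Rightarrow> int^4 \<Rightarrow> complex" where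
  "cocycle \<beta> \<gamma> = exp (2 * pi * \<i> *
     (\<Sum>(j, k)\<in>{(j, k). j < k}. complex_of_real (\<theta> $ k $ j * real_of_int (\<beta> $ k) * real_of_int (\<gamma> $ j))))"

text \<open>
  With \<open>x\<close> in the GNS space, \<open>a \<star> x\<close> is the left action of \<open>a\<close> on \<open>x\<close>.
\<close>

definition mult :: "coeffs \<Rightarrow> coeffs \<Rightarrow> coeffs" (infixl "\<star>" 70) where
  "a \<star> b = (\<lambda>\<beta>. \<Sum>\<^sub>\<infinity>\<gamma>. a \<gamma> * b (\<beta> - \<gamma>) * cocycle \<gamma> (\<beta> - \<gamma>))"

definition adj :: "coeffs \<Rightarrow> coeffs" where
  "adj a = (\<lambda>\<beta>. cnj (a (- \<beta>) * cocycle (- \<beta>) \<beta>))"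

definition inverse_el :: "coeffs \<Rightarrow> coeffs" where
  "inverse_el a = (THE b. b \<in> smooth_torus \<and> a \<star> b = unit \<and> b \<star> a = unit)"

definition positive_el :: "coeffs \<Rightarrow> bool" where
  "positive_el a \<longleftrightarrow>
     (\<forall>x\<in>gns_space. gns_inner x (a \<star> x) \<in> \<real> \<and> 0 \<le> Re (gns_inner x (a \<star> x)))"

definition has_bounded_inverse :: "coeffs \<Rightarrow> bool" where
  "has_bounded_inverse a \<longleftrightarrow>
     (\<exists>B. gns_bounded_operator B \<and> (\<forall>x\<in>gns_space. B (a \<star> x) = x \<and> a \<star> B x = x))"

definition conformal_factors :: "coeffs set" where
  "conformal_factors = {h \<in> smooth_torus. positive_el h \<and> has_bounded_inverse h}"

definition naive_laplacian :: "coeffs \<Rightarrow> coeffs \<Rightarrow> coeffs" where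
  "naive_laplacian h x =
     (let h2 = h \<star> h; h2' = inverse_el (h \<star> h)
      in \<Sum>a\<in>UNIV. h2' \<star> delta a (h2 \<star> delta a (h2' \<star> x)))"

definition laplace_type :: "coeffs \<Rightarrow> (4 \<Rightarrow> coeffs) \<Rightarrow> coeffs \<Rightarrow> coeffs" where
  "laplace_type h T x =
     naive_laplacian h x + (\<Sum>a\<in>UNIV. T a \<star> delta a x + (1/2) *\<^sub>C delta a (T a) \<star> x)"

definition laplace_family :: "coeffs \<Rightarrow> (coeffs \<Rightarrow> coeffs) set" where
  "laplace_family h = {laplace_type h T | T. \<forall>a. T a \<in> smooth_torus \<and> adj (T a) = T a}"

text \<open>
  The coefficients of a differential operator \<open>P = (\<Sum>\<beta>. c\<^sub>\<beta> \<delta>\<^sup>\<beta>)\<close>; they are unique, since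
  \<open>P U\<^sup>\<gamma> = (\<Sum>\<beta>. \<gamma>\<^sup>\<beta> c\<^sub>\<beta>) U\<^sup>\<gamma>\<close> for all \<open>\<gamma>\<close>.
\<close>

definition op_coeffs :: "(coeffs \<Rightarrow> coeffs) \<Rightarrow> nat^4 \<Rightarrow> coeffs" where
  "op_coeffs P = (THE c. (\<forall>\<beta>. c \<beta> \<in> smooth_torus) \<and> finite {\<beta>. c \<beta> \<noteq> 0} \<and>
     (\<forall>x\<in>smooth_torus. P x = (\<Sum>\<beta>\<in>{\<beta>. c \<beta> \<noteq> 0}. c \<beta> \<star> delta_pow \<beta> x)))"

definition symbol_part :: "(coeffs \<Rightarrow> coeffs) \<Rightarrow> nat \<Rightarrow> real^4 \<Rightarrow> coeffs" where
  "symbol_part P n \<xi> =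
     (\<Sum>\<beta>\<in>{\<beta>. (\<Sum>j\<in>UNIV. \<beta> $ j) = n}. complex_of_real (\<Prod>j\<in>UNIV. (\<xi> $ j) ^ (\<beta> $ j)) *\<^sub>C op_coeffs P \<beta>)"

text \<open>
  The leading three homogeneous parts of the symbol of a parametrix of an operator of order two.
  Since the \<open>b k\<close> are constrained only away from \<open>\<xi> = 0\<close>, they are determined there and arbitrary
  at \<open>\<xi> = 0\<close>.
\<close>

definition is_parametrix_symbol :: "(coeffs \<Rightarrow> coeffs) \<Rightarrow> (nat \<Rightarrow> real^4 \<Rightarrow> coeffs) \<Rightarrow> bool" where
  "is_parametrix_symbol P b \<longleftrightarrow>
     (let a2 = symbol_part P 2; a1 = symbol_part P 1; a0 = symbol_part P 0 in
      (\<forall>n\<in>{0, 1, 2}. \<forall>\<xi>. \<xi> \<noteq> 0 \<longrightarrow> b n \<xi> \<in> smooth_torus \<and>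
         (\<forall>t>0. b n (t *\<^sub>R \<xi>) = complex_of_real (t powi (- 2 - int n)) *\<^sub>C b n \<xi>)) \<and>
      (\<forall>\<xi>. \<xi> \<noteq> 0 \<longrightarrow>
         b 0 \<xi> \<star> a2 \<xi> = unit \<and>
         b 1 \<xi> \<star> a2 \<xi> + b 0 \<xi> \<star> a1 \<xi>
           + (\<Sum>k\<in>UNIV. pderiv_xi k (b 0) \<xi> \<star> delta k (a2 \<xi>)) = 0 \<and>
         b 2 \<xi> \<star> a2 \<xi> + b 1 \<xi> \<star> a1 \<xi> + b 0 \<xi> \<star> a0 \<xi>
           + (\<Sum>k\<in>UNIV. pderiv_xi k (b 0) \<xi> \<star> delta k (a1 \<xi>))
           + (\<Sum>k\<in>UNIV. pderiv_xi k (b 1) \<xi> \<star> delta k (a2 \<xi>))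
           + (1/2) *\<^sub>C (\<Sum>j\<in>UNIV. \<Sum>k\<in>UNIV.
               pderiv_xi k (pderiv_xi j (b 0)) \<xi> \<star> delta k (delta j (a2 \<xi>))) = 0))"

definition wres_inverse :: "(coeffs \<Rightarrow> coeffs) \<Rightarrow> complex" where
  "wres_inverse P =
     (let b = (SOME b. is_parametrix_symbol P b)
      in \<integral>\<xi>. canonical_trace (b 2 \<xi>) \<partial>sphere_measure)"

text \<open>
  The residue of a member of the family is a real number, so comparing real parts is comparing
  residues.
\<close>

definition minimal_operators :: "coeffs \<Rightarrow> (coeffs \<Rightarrow> coeffs) set" where
  "minimal_operators h =
     {P \<in> laplace_family h. \<forall>Q\<in>laplace_family h. Re (wres_inverse P) \<le> Re (wres_inverse Q)}"

lemma cocycle_zero [simp]: "cocycle 0 \<gamma> = 1" "cocycle \<beta> 0 = 1"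
  by (simp_all add: cocycle_def case_prod_unfold)

lemma cocycle_unimodular [simp]: "cmod (cocycle \<beta> \<gamma>) = 1"
proof -
  have "cocycle \<beta> \<gamma> = cis (2 * pi *
     (\<Sum>(j, k)\<in>{(j, k). j < k}. \<theta> $ k $ j * real_of_int (\<beta> $ k) * real_of_int (\<gamma> $ j)))"
    by (simp add: cocycle_def cis_conv_exp case_prod_unfold mult_ac)
  then show ?thesis by simp
qed

lemma cocycle_mult_cnj: "cocycle \<beta> \<gamma> * cnj (cocycle \<beta> \<gamma>) = 1"
  using complex_norm_square[of "cocycle \<beta> \<gamma>"] by simp

lemma cocycle_uminus: "cocycle (- \<beta>) (- \<gamma>) = cocycle \<beta> \<gamma>"
  by (simp add: cocycle_def case_prod_unfold)

lemma monomial_mult: "monomial \<beta> \<star> monomial \<gamma> = cocycle \<beta> \<gamma> *\<^sub>C monomial (\<beta> + \<gamma>)"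
proof
  fix \<alpha>
  have "(monomial \<beta> \<star> monomial \<gamma>) \<alpha>
      = (\<Sum>\<^sub>\<infinity>\<eta>\<in>{\<beta>}. monomial \<beta> \<eta> * monomial \<gamma> (\<alpha> - \<eta>) * cocycle \<eta> (\<alpha> - \<eta>))"
    unfolding mult_def by (rule infsum_cong_neutral) (auto simp: monomial_def)
  also have "\<dots> = (cocycle \<beta> \<gamma> *\<^sub>C monomial (\<beta> + \<gamma>)) \<alpha>"
    by (auto simp: monomial_def cscale_def algebra_simps)
  finally show "(monomial \<beta> \<star> monomial \<gamma>) \<alpha> = (cocycle \<beta> \<gamma> *\<^sub>C monomial (\<beta> + \<gamma>)) \<alpha>" .
qed

lemma adj_monomial: "adj (monomial \<beta>) = cnj (cocycle \<beta> (- \<beta>)) *\<^sub>C monomial (- \<beta>)"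
  by (auto simp: adj_def monomial_def cscale_def fun_eq_iff)

lemma cocycle_axis:
  "cocycle (axis j m) (axis k n) =
     (if k < j then exp (2 * pi * \<i> * (\<theta> $ j $ k * m * n)) else 1)"
proof -
  have "(\<Sum>(i, l)\<in>{(i, l). i < l}. complex_of_real
          (\<theta> $ l $ i * real_of_int (axis j m $ l) * real_of_int (axis k n $ i)))
      = (\<Sum>p\<in>{(i, l). i < l}. if p = (k, j) then complex_of_real (\<theta> $ j $ k * m * n) else 0)"
    by (intro sum.cong) (auto simp: axis_def split: if_splits)
  also have "\<dots> = (if k < j then complex_of_real (\<theta> $ j $ k * m * n) else 0)"
    by (subst sum.delta) auto
  finally show ?thesis by (simp add: cocycle_def)
qed

lemma gen_commute:
  "gen j \<star> gen k = exp (2 * pi * \<i> * \<theta> $ j $ k) *\<^sub>C (gen k \<star> gen j)"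
proof (cases j k rule: linorder_cases)
  case equal
  with theta_antisym[of j j] show ?thesis
    by (simp add: monomial_mult cscale_def)
next
  case less
  have "exp (2 * pi * \<i> * \<theta> $ j $ k) * exp (2 * pi * \<i> * \<theta> $ k $ j) = 1"
    by (simp add: theta_antisym[of k j] flip: exp_add)
  with less show ?thesis
    by (simp add: monomial_mult cocycle_axis cscale_def add.commute fun_eq_iff not_less)
next
  case greater
  then show ?thesis
    by (simp add: monomial_mult cocycle_axis cscale_def add.commute fun_eq_iff not_less)
qed

lemma gen_unitary: "adj (gen j) \<star> gen j = unit" "gen j \<star> adj (gen j) = unit"
proof -
  have scale_left: "(z *\<^sub>C a) \<star> b = z *\<^sub>C (a \<star> b)" for z a b
    by (simp add: mult_def cscale_def fun_eq_iff mult.assoc infsum_cmult_right')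
  have scale_right: "a \<star> (z *\<^sub>C b) = z *\<^sub>C (a \<star> b)" for z a b
    by (simp add: mult_def cscale_def fun_eq_iff mult_ac flip: infsum_cmult_right')
  have eq: "cocycle (- axis j 1) (axis j 1) = cocycle (axis j 1) (- axis j 1)"
    using cocycle_uminus[of "axis j 1" "- axis j 1"] by simp
  show "adj (gen j) \<star> gen j = unit" "gen j \<star> adj (gen j) = unit"
    using cocycle_mult_cnj[of "axis j 1" "- axis j 1"]
    by (simp_all add: adj_monomial scale_left scale_right monomial_mult eq)
      (simp_all add: cscale_def mult.commute mult.left_commute)
qed

lemma monomial_axis_Suc:
  "monomial (axis j m) \<star> gen j = monomial (axis j (m + 1))"
proof -
  have "axis j m + axis j 1 = axis j (m + 1)"
    by (simp add: axis_def vec_eq_iff)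
  then show ?thesis
    by (simp add: monomial_mult cocycle_axis cscale_def)
qed

lemma monomial_ordered:
  "monomial \<beta> = monomial (axis 0 (\<beta> $ 0)) \<star> (monomial (axis 1 (\<beta> $ 1)) \<star>
     (monomial (axis 2 (\<beta> $ 2)) \<star> monomial (axis 3 (\<beta> $ 3))))"
proof -
  have *: "monomial \<beta> \<star> monomial \<gamma> = monomial (\<beta> + \<gamma>)"
    if "\<And>j k. j < k \<Longrightarrow> \<beta> $ k = 0 \<or> \<gamma> $ j = 0" for \<beta> \<gamma>
  proof -
    have "(\<Sum>(j, k)\<in>{(j, k). j < k}. complex_of_real
            (\<theta> $ k $ j * real_of_int (\<beta> $ k) * real_of_int (\<gamma> $ j))) = 0"
      using that by (intro sum.neutral) fastforce
    then have "cocycle \<beta> \<gamma> = 1" by (simp add: cocycle_def)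
    then show ?thesis by (simp add: monomial_mult cscale_def)
  qed
  have less: "\<not> (3::4) < 2" "\<not> (3::4) < 1" "\<not> (2::4) < 1" "\<not> (j::4) < 0" for j
    using Rep_bit0[of j] by (simp_all add: less_bit0_def bit0.Rep_numeral bit0.Rep_1 bit0.Rep_0)
  have distinct: "(0::4) \<noteq> 1" "(0::4) \<noteq> 2" "(0::4) \<noteq> 3" "(1::4) \<noteq> 2" "(1::4) \<noteq> 3" "(2::4) \<noteq> 3"
    by simp_all
  have cases4: "j = 0 \<or> j = 1 \<or> j = 2 \<or> j = 3" for j :: 4
    using exhaust_4[of j] by auto
  have "\<beta> = axis 0 (\<beta> $ 0) + (axis 1 (\<beta> $ 1) + (axis 2 (\<beta> $ 2) + axis 3 (\<beta> $ 3)))"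
    unfolding vec_eq_iff
  proof
    fix j show "\<beta> $ j = (axis 0 (\<beta> $ 0) + (axis 1 (\<beta> $ 1) + (axis 2 (\<beta> $ 2) + axis 3 (\<beta> $ 3)))) $ j"
      using cases4[of j] distinct by (auto simp: axis_def)
  qed
  moreover have "monomial (axis 2 (\<beta> $ 2)) \<star> monomial (axis 3 (\<beta> $ 3))
      = monomial (axis 2 (\<beta> $ 2) + axis 3 (\<beta> $ 3))"
    using less by (intro *) (auto simp: axis_def)
  moreover have "monomial (axis 1 (\<beta> $ 1)) \<star> monomial (axis 2 (\<beta> $ 2) + axis 3 (\<beta> $ 3))
      = monomial (axis 1 (\<beta> $ 1) + (axis 2 (\<beta> $ 2) + axis 3 (\<beta> $ 3)))"
    using less by (intro *) (auto simp: axis_def)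
  moreover have "monomial (axis 0 (\<beta> $ 0)) \<star> monomial (axis 1 (\<beta> $ 1) + (axis 2 (\<beta> $ 2) + axis 3 (\<beta> $ 3)))
      = monomial (axis 0 (\<beta> $ 0) + (axis 1 (\<beta> $ 1) + (axis 2 (\<beta> $ 2) + axis 3 (\<beta> $ 3))))"
    using less by (intro *) (auto simp: axis_def)
  ultimately show ?thesis by simp
qed

lemma delta_gen: "delta k (gen j) = (if k = j then 1 else 0) *\<^sub>C gen j"
  by (auto simp: delta_def monomial_def cscale_def axis_def fun_eq_iff)

lemma gns_inner_eq_trace: "gns_inner a b = canonical_trace (adj a \<star> b)"
proof -
  have "canonical_trace (adj a \<star> b)
      = (\<Sum>\<^sub>\<infinity>\<gamma>. cnj (a (- \<gamma>) * cocycle (- \<gamma>) \<gamma>) * b (- \<gamma>) * cocycle \<gamma> (- \<gamma>))"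
    by (simp add: canonical_trace_def mult_def adj_def)
  also have "\<dots> = (\<Sum>\<^sub>\<infinity>\<gamma>. cnj (a (- \<gamma>)) * b (- \<gamma>))"
  proof (rule infsum_cong)
    fix \<gamma>
    have "cocycle \<gamma> (- \<gamma>) * cnj (cocycle (- \<gamma>) \<gamma>) = 1"
      using cocycle_uminus[of \<gamma> "- \<gamma>"] cocycle_mult_cnj[of \<gamma> "- \<gamma>"] by simp
    then show "cnj (a (- \<gamma>) * cocycle (- \<gamma>) \<gamma>) * b (- \<gamma>) * cocycle \<gamma> (- \<gamma>) = cnj (a (- \<gamma>)) * b (- \<gamma>)"
      by (simp add: mult_ac)
  qed
  also have "\<dots> = gns_inner a b"
    unfolding gns_inner_def
    using infsum_reindex_bij_betw[of uminus UNIV UNIV "\<lambda>\<gamma>. cnj (a \<gamma>) * b \<gamma>"] bij_uminus by blast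
  finally show ?thesis by simp
qed

lemma naive_laplacian_in_family: "naive_laplacian h \<in> laplace_family h"
proof -
  have "naive_laplacian h = laplace_type h (\<lambda>_. 0)"
    by (simp add: laplace_type_def fun_eq_iff mult_def cscale_def delta_def)
  moreover have "0 \<in> smooth_torus" "adj 0 = 0"
    by (auto simp: smooth_torus_def adj_def fun_eq_iff)
  ultimately show ?thesis unfolding laplace_family_def by blast
qed

end

lemma emeasure_sphere_measure:
  "emeasure (sphere_measure :: (real^4) measure) (sphere 0 1) = ennreal (2 * pi\<^sup>2)"
proof -
  let ?B = "cball 0 1 - {0} :: (real^4) set"
  let ?D = "restrict_space lborel ?B"
  let ?S = "restrict_space borel (sphere 0 1) :: (real^4) measure"
  let ?f = "\<lambda>x :: real^4. x /\<^sub>R norm x"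
  have B: "?B \<in> sets borel" by simp
  have meas: "?f \<in> measurable ?D ?S"
  proof (rule measurable_restrict_space2)
    show "?f \<in> space ?D \<rightarrow> sphere 0 1" by (auto simp: space_restrict_space)
    show "?f \<in> borel_measurable ?D" by (intro measurable_restrict_space1) measurable
  qed
  have top: "sphere 0 1 \<in> sets ?S"
    using sets.top[of ?S] by (simp add: space_restrict_space)
  have "?f -` sphere 0 1 \<inter> space ?D = ?B"
    by (auto simp: space_restrict_space)
  then have "emeasure (distr ?D ?S ?f) (sphere 0 1) = emeasure ?D ?B"
    using meas top by (simp add: emeasure_distr)
  also have "\<dots> = emeasure lborel ?B"
    using B by (intro emeasure_restrict_space) simp_all
  also have "\<dots> = emeasure lborel (cball 0 1 :: (real^4) set) - emeasure lborel {0 :: real^4}"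
    by (intro emeasure_Diff) auto
  also have "\<dots> = ennreal (pi\<^sup>2 / 2)"
    by (simp add: emeasure_cball unit_ball_vol_4)
  finally show ?thesis
    by (simp add: sphere_measure_def flip: ennreal_numeral ennreal_mult')
qed

end

theory Submission
  imports Defs
begin

text \<open>
  Write \<open>p = h\<^sup>2\<close> and \<open>q = h\<^sup>-\<^sup>2\<close>. Expanding \<open>\<Delta>\<close> gives the symbol
  \<open>q |\<xi>|\<^sup>2 + \<Sum>\<^sub>a Y\<^sub>a \<xi>\<^sub>a + a\<^sub>0\<close> with \<open>Y\<^sub>a = T\<^sub>a + \<delta>\<^sub>a q\<close>. The parametrix equations are solved explicitly
  by right multiplication with \<open>p / |\<xi>|\<^sup>2\<close>, which gives \<open>b\<^sub>2 = |\<xi>|\<^sup>-\<^sup>4 E + |\<xi>|\<^sup>-\<^sup>6 \<Sum>\<^sub>j\<^sub>k \<xi>\<^sub>j \<xi>\<^sub>k F\<^sub>j\<^sub>k\<close>.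
  On the sphere the mean of \<open>\<xi>\<^sub>j \<xi>\<^sub>k\<close> is \<open>1/4\<close> for \<open>j = k\<close> and \<open>0\<close> otherwise; after this averaging all
  terms with \<open>\<delta>\<^sub>a T\<^sub>a\<close> cancel, and the trace property leaves (lemma \<open>wres_laplace_type\<close>)

    \<open>Wres (\<Delta>\<^sup>-\<^sup>1) = C + \<pi>\<^sup>2/2 \<Sum>\<^sub>k (t (p T\<^sub>k p T\<^sub>k p) + t (T\<^sub>k G\<^sub>k))\<close> with \<open>G\<^sub>k = [p, \<delta>\<^sub>k p]\<close>,

  where \<open>C\<close> depends on \<open>h\<close> alone. The linear term is the whole point: the \<open>G\<^sub>k\<close> are selfadjoint, so
  \<open>T\<^sub>k = - c G\<^sub>k\<close> is admissible for every real \<open>c\<close>, and for small \<open>c > 0\<close> the linear contribution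
  \<open>- c \<Sum>\<^sub>k t (G\<^sub>k\<^sup>* G\<^sub>k)\<close> outweighs the quadratic one. Hence \<open>T = 0\<close> is not a minimum as soon as some
  \<open>G\<^sub>k\<close> is nonzero (lemma \<open>naive_laplacian_not_minimal\<close>).

  That some \<open>G\<^sub>k\<close> is nonzero when \<open>h\<close> does not commute with \<open>\<delta>\<^sub>k h\<close> is the uniqueness of positive
  square roots in disguise: an element that commutes with \<open>h\<^sup>2\<close> commutes with \<open>h\<close>
  (lemma \<open>commute_square_imp_commute\<close>).

  Two analytic facts support the computation. The inverse of \<open>h\<close>, given only as a bounded operator,
  is multiplication by a rapidly decreasing family (lemma \<open>bounded_inverse_smooth\<close>); this uses
  commutators with truncated weights instead of the holomorphic functional calculus. And a
  differential operator determines its coefficients, because a polynomial that vanishes on the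
  integer lattice is zero (lemma \<open>op_coeffs_eqI\<close>).

  The statement is not vacuous: \<open>h = 1 - (U\<^sub>0 + U\<^sub>0\<^sup>* + U\<^sub>1 + U\<^sub>1\<^sup>*)/8\<close> is positive and invertible, and the
  commutator of \<open>h\<close> and \<open>\<delta>\<^sub>0 h\<close> has the coefficient
  \<open>(exp (2 \<pi> \<i> \<theta>\<^sub>1\<^sub>0) - 1)/64 \<noteq> 0\<close> at \<open>U\<^sub>0 U\<^sub>1\<close> (lemma \<open>exists_noncommuting_conformal_factor\<close>).
\<close>

section \<open>Weighted summability and convolution of families on the frequency lattice\<close>

lemma dominated_summable_on:
  fixes f :: "'a \<Rightarrow> 'b::banach"
  assumes "g summable_on A" "\<And>x. x \<in> A \<Longrightarrow> norm (f x) \<le> g x"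
  shows "f summable_on A"
  using Infinite_Sum.abs_summable_on_comparison_test'[OF assms] by (rule abs_summable_summable)

definition freq :: "int^4 \<Rightarrow> real" where
  "freq \<beta> = real_of_int (\<Sum>j\<in>UNIV. \<bar>\<beta> $ j\<bar>)"

lemma freq_nonneg [simp]: "0 \<le> freq \<beta>"
  by (simp add: freq_def sum_nonneg)

lemma freq_uminus [simp]: "freq (- \<beta>) = freq \<beta>"
  by (simp add: freq_def)

lemma freq_add: "freq (\<beta> + \<gamma>) \<le> freq \<beta> + freq \<gamma>"
proof -
  have "(\<Sum>j\<in>UNIV. \<bar>(\<beta> + \<gamma>) $ j\<bar>) \<le> (\<Sum>j\<in>UNIV. \<bar>\<beta> $ j\<bar> + \<bar>\<gamma> $ j\<bar>)"
    by (intro sum_mono) simp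
  then show ?thesis
    unfolding freq_def sum.distrib by linarith
qed

lemma component_le_freq: "real_of_int \<bar>\<beta> $ j\<bar> \<le> freq \<beta>"
proof -
  have "\<bar>\<beta> $ j\<bar> \<le> (\<Sum>j\<in>UNIV. \<bar>\<beta> $ j\<bar>)"
    by (rule member_le_sum) auto
  then show ?thesis unfolding freq_def by linarith
qed

text \<open>
  Submultiplicativity of the weight \<open>1 + |\<beta>|\<close> lets a weighted convolution be estimated by the
  convolution of the weighted factors.
\<close>

lemma weight_submult: "1 + freq \<beta> \<le> (1 + freq \<gamma>) * (1 + freq (\<beta> - \<gamma>))"
proof -
  have "freq \<beta> \<le> freq \<gamma> + freq (\<beta> - \<gamma>)"
    using freq_add[of \<gamma> "\<beta> - \<gamma>"] by simp
  moreover have "0 \<le> freq \<gamma> * freq (\<beta> - \<gamma>)" by simp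
  moreover have "(1 + freq \<gamma>) * (1 + freq (\<beta> - \<gamma>))
      = 1 + (freq \<gamma> + freq (\<beta> - \<gamma>)) + freq \<gamma> * freq (\<beta> - \<gamma>)"
    by (simp add: algebra_simps)
  ultimately show ?thesis by linarith
qed

lemma summable_inverse_square_int:
  "(\<lambda>n::int. 1 / (1 + \<bar>real_of_int n\<bar>)\<^sup>2) summable_on UNIV"
proof -
  have s: "summable (\<lambda>n::nat. 1 / (1 + real n)\<^sup>2)"
    using inverse_power_summable[of 2, where 'a=real]
      summable_Suc_iff[of "\<lambda>n. inverse (real n ^ 2)"] by (simp add: inverse_eq_divide)
  have "(\<lambda>n::nat. 1 / (1 + real n)\<^sup>2) summable_on UNIV"
    by (rule norm_summable_imp_summable_on) (use s in simp)
  then have "(\<lambda>n::int. 1 / (1 + \<bar>real_of_int n\<bar>)\<^sup>2) summable_on range int"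
    "(\<lambda>n::int. 1 / (1 + \<bar>real_of_int n\<bar>)\<^sup>2) summable_on range (\<lambda>n. - int n)"
    by (subst summable_on_reindex, simp add: inj_def, simp add: o_def)+
  then have "(\<lambda>n::int. 1 / (1 + \<bar>real_of_int n\<bar>)\<^sup>2) summable_on (range int \<union> range (\<lambda>n. - int n))"
    by (rule summable_on_union)
  moreover have "range int \<union> range (\<lambda>n. - int n) = UNIV"
    by (auto intro: int_cases2)
  ultimately show ?thesis by simp
qed

text \<open>
  The eighth power of \<open>1 + |\<beta>|\<close> dominates the product over the four coordinates of
  \<open>(1 + |\<beta>\<^sub>j|)\<^sup>2\<close>, so that sums over finite sets of frequencies are bounded by the fourth power of a
  convergent one-dimensional sum.
\<close>

lemma summable_weight: "(\<lambda>\<beta>. 1 / (1 + freq \<beta>) ^ 8) summable_on UNIV"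
proof (rule nonneg_bdd_above_summable_on)
  define f where "f n = 1 / (1 + \<bar>real_of_int n\<bar>)\<^sup>2" for n :: int
  have f0: "0 \<le> f n" for n by (simp add: f_def)
  have fs: "f summable_on UNIV" 
    using summable_inverse_square_int unfolding f_def .
  have le: "1 / (1 + freq \<beta>) ^ 8 \<le> (\<Prod>j\<in>UNIV. f (\<beta> $ j))" for \<beta>
  proof -
    have "(\<Prod>j\<in>UNIV. (1 + \<bar>real_of_int (\<beta> $ j)\<bar>)\<^sup>2) \<le> (\<Prod>j\<in>(UNIV::4 set). (1 + freq \<beta>)\<^sup>2)"
      using component_le_freq[of \<beta>] by (intro prod_mono) (auto intro!: power_mono)
    also have "\<dots> = (1 + freq \<beta>) ^ 8" by (simp flip: power_mult)
    finally have "1 / (1 + freq \<beta>) ^ 8 \<le> 1 / (\<Prod>j\<in>UNIV. (1 + \<bar>real_of_int (\<beta> $ j)\<bar>)\<^sup>2)"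
      by (intro divide_left_mono mult_pos_pos prod_pos zero_less_power add_pos_nonneg ballI) simp_all
    then show ?thesis by (simp add: f_def prod_dividef)
  qed
  show "bdd_above (sum (\<lambda>\<beta>. 1 / (1 + freq \<beta>) ^ 8) ` {F. F \<subseteq> UNIV \<and> finite F})"
  proof (rule bdd_aboveI2)
    fix F :: "(int^4) set" assume "F \<in> {F. F \<subseteq> UNIV \<and> finite F}"
    then have fin: "finite F" by simp
    define A where "A = (\<Union>\<beta>\<in>F. range (($) \<beta>))"
    have finA: "finite A" using fin by (simp add: A_def)
    have inj: "inj_on ($) F" by (auto simp: inj_on_def vec_eq_iff)
    have "(\<Sum>\<beta>\<in>F. 1 / (1 + freq \<beta>) ^ 8) \<le> (\<Sum>\<beta>\<in>F. \<Prod>j\<in>UNIV. f (\<beta> $ j))"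
      by (intro sum_mono le)
    also have "\<dots> = (\<Sum>g\<in>($) ` F. \<Prod>j\<in>UNIV. f (g j))"
      by (simp add: sum.reindex[OF inj])
    also have "\<dots> \<le> (\<Sum>g\<in>PiE (UNIV :: 4 set) (\<lambda>_. A). \<Prod>j\<in>UNIV. f (g j))"
    proof (rule sum_mono2)
      show "finite (PiE (UNIV :: 4 set) (\<lambda>_. A))" using finA by (intro finite_PiE) auto
      show "($) ` F \<subseteq> PiE UNIV (\<lambda>_. A)" by (auto simp: A_def)
    qed (auto intro!: prod_nonneg f0)
    also have "\<dots> = (\<Prod>j\<in>(UNIV::4 set). \<Sum>n\<in>A. f n)"
      by (rule prod_sum_PiE[symmetric]) (use finA in auto)
    also have "\<dots> \<le> (\<Prod>j\<in>(UNIV::4 set). infsum f UNIV)"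
      by (intro prod_mono conjI sum_nonneg f0 finite_sum_le_infsum fs finA) auto
    finally show "(\<Sum>\<beta>\<in>F. 1 / (1 + freq \<beta>) ^ 8) \<le> (\<Prod>j\<in>(UNIV::4 set). infsum f UNIV)" .
  qed
qed simp

lemma smooth_torus_iff:
  "a \<in> smooth_torus \<longleftrightarrow> (\<forall>k. \<exists>C. \<forall>\<beta>. (1 + freq \<beta>) ^ k * cmod (a \<beta>) \<le> C)"
  by (simp add: smooth_torus_def freq_def)

text \<open>
  Rapid decrease is a condition on suprema; spending eight more powers of the weight turns it into
  summability.
\<close>

lemma smooth_weighted_summable:
  assumes "a \<in> smooth_torus"
  shows "(\<lambda>\<beta>. (1 + freq \<beta>) ^ k * cmod (a \<beta>)) summable_on UNIV"
proof -
  obtain C where C: "\<And>\<beta>. (1 + freq \<beta>) ^ (k + 8) * cmod (a \<beta>) \<le> C"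
    using assms unfolding smooth_torus_iff by blast
  have "(\<lambda>\<beta>. C * (1 / (1 + freq \<beta>) ^ 8)) summable_on UNIV"
    by (rule summable_on_cmult_right[OF summable_weight])
  then show ?thesis
  proof (rule dominated_summable_on)
    fix \<beta>
    have p: "0 < (1 + freq \<beta>) ^ 8" by (intro zero_less_power add_pos_nonneg) auto
    show "norm ((1 + freq \<beta>) ^ k * cmod (a \<beta>)) \<le> C * (1 / (1 + freq \<beta>) ^ 8)"
      using C[of \<beta>] p by (simp add: abs_mult power_add field_simps)
  qed
qed

lemma smooth_summable:
  "a \<in> smooth_torus \<Longrightarrow> (\<lambda>\<beta>. cmod (a \<beta>)) summable_on UNIV"
  using smooth_weighted_summable[of a 0] by simp

lemma smooth_zero [simp]: "0 \<in> smooth_torus"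
  by (auto simp: smooth_torus_iff)

lemma smooth_add [simp]:
  assumes "a \<in> smooth_torus" "b \<in> smooth_torus" shows "a + b \<in> smooth_torus"
  unfolding smooth_torus_iff
proof
  fix k
  obtain C D where C: "\<And>\<beta>. (1 + freq \<beta>) ^ k * cmod (a \<beta>) \<le> C"
    and D: "\<And>\<beta>. (1 + freq \<beta>) ^ k * cmod (b \<beta>) \<le> D"
    using assms unfolding smooth_torus_iff by meson
  have "(1 + freq \<beta>) ^ k * cmod ((a + b) \<beta>) \<le> C + D" for \<beta>
  proof -
    have "(1 + freq \<beta>) ^ k * cmod ((a + b) \<beta>) \<le> (1 + freq \<beta>) ^ k * (cmod (a \<beta>) + cmod (b \<beta>))"
      by (intro mult_left_mono) (auto simp: norm_triangle_ineq)
    then show ?thesis using C[of \<beta>] D[of \<beta>] by (simp add: distrib_left)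
  qed
  then show "\<exists>C. \<forall>\<beta>. (1 + freq \<beta>) ^ k * cmod ((a + b) \<beta>) \<le> C" by blast
qed

lemma smooth_cscale [simp]:
  assumes "a \<in> smooth_torus" shows "z *\<^sub>C a \<in> smooth_torus"
  unfolding smooth_torus_iff
proof
  fix k
  obtain C where C: "\<And>\<beta>. (1 + freq \<beta>) ^ k * cmod (a \<beta>) \<le> C"
    using assms unfolding smooth_torus_iff by meson
  have "(1 + freq \<beta>) ^ k * cmod ((z *\<^sub>C a) \<beta>) \<le> cmod z * C" for \<beta>
    using mult_left_mono[OF C[of \<beta>], of "cmod z"] by (simp add: cscale_def norm_mult mult_ac)
  then show "\<exists>C. \<forall>\<beta>. (1 + freq \<beta>) ^ k * cmod ((z *\<^sub>C a) \<beta>) \<le> C" by blast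
qed

lemma uminus_eq_cscale: "- a = (-1) *\<^sub>C a"
  by (simp add: cscale_def fun_eq_iff)

lemma smooth_uminus [simp]: "a \<in> smooth_torus \<Longrightarrow> - a \<in> smooth_torus"
  by (subst uminus_eq_cscale) simp

lemma smooth_diff [simp]: "a \<in> smooth_torus \<Longrightarrow> b \<in> smooth_torus \<Longrightarrow> a - b \<in> smooth_torus"
  using smooth_add[of a "- b"] by simp

lemma smooth_sum [simp]: "(\<And>i. i \<in> I \<Longrightarrow> f i \<in> smooth_torus) \<Longrightarrow> sum f I \<in> smooth_torus"
  by (induction I rule: infinite_finite_induct) auto

lemma smooth_delta [simp]:
  assumes "a \<in> smooth_torus" shows "delta j a \<in> smooth_torus"
  unfolding smooth_torus_iff
proof
  fix k
  obtain C where C: "\<And>\<beta>. (1 + freq \<beta>) ^ Suc k * cmod (a \<beta>) \<le> C"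
    using assms unfolding smooth_torus_iff by meson
  have "(1 + freq \<beta>) ^ k * cmod (delta j a \<beta>) \<le> C" for \<beta>
  proof -
    have "\<bar>real_of_int (\<beta> $ j)\<bar> \<le> 1 + freq \<beta>" using component_le_freq[of \<beta> j] by simp
    then have "\<bar>real_of_int (\<beta> $ j)\<bar> * ((1 + freq \<beta>) ^ k * cmod (a \<beta>))
        \<le> (1 + freq \<beta>) * ((1 + freq \<beta>) ^ k * cmod (a \<beta>))"
      by (rule mult_right_mono) simp
    then show ?thesis using C[of \<beta>] by (simp add: delta_def norm_mult mult_ac)
  qed
  then show "\<exists>C. \<forall>\<beta>. (1 + freq \<beta>) ^ k * cmod (delta j a \<beta>) \<le> C" by blast
qed

lemma smooth_monomial [simp]: "monomial \<alpha> \<in> smooth_torus"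
  unfolding smooth_torus_iff
proof
  fix k
  have "\<forall>\<beta>. (1 + freq \<beta>) ^ k * cmod (monomial \<alpha> \<beta>) \<le> (1 + freq \<alpha>) ^ k"
    by (auto simp: monomial_def)
  then show "\<exists>C. \<forall>\<beta>. (1 + freq \<beta>) ^ k * cmod (monomial \<alpha> \<beta>) \<le> C" by blast
qed

lemma summable_convolution:
  fixes f g :: "'a::ab_group_add \<Rightarrow> real"
  assumes f: "f summable_on UNIV" "\<And>x. 0 \<le> f x" and g: "\<And>x. 0 \<le> g x" "\<And>x. g x \<le> C"
  shows "(\<lambda>y. f y * g (x - y)) summable_on UNIV"
proof (rule dominated_summable_on)
  show "(\<lambda>y. f y * C) summable_on UNIV" by (rule summable_on_cmult_left[OF f(1)])
  show "norm (f y * g (x - y)) \<le> f y * C" for y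
    using f(2)[of y] g[of "x - y"] by (simp add: abs_mult mult_left_mono)
qed

text \<open>
  The Cauchy-Schwarz inequality for the weight \<open>f\<close>, from the discriminant of the nonnegative
  quadratic polynomial \<open>t \<mapsto> \<Sum>\<^sub>x f x (t - g x)\<^sup>2\<close>.
\<close>

lemma infsum_weighted_square_le:
  fixes f g :: "'a \<Rightarrow> real"
  assumes f: "f summable_on UNIV" "\<And>x. 0 \<le> f x"
    and fg: "(\<lambda>x. f x * (g x)\<^sup>2) summable_on UNIV" 
  shows "(\<Sum>\<^sub>\<infinity>x. f x * g x)\<^sup>2 \<le> infsum f UNIV * (\<Sum>\<^sub>\<infinity>x. f x * (g x)\<^sup>2)"
proof -
  have s: "(\<lambda>x. f x * g x) summable_on UNIV"
  proof (rule dominated_summable_on)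
    show "(\<lambda>x. f x + f x * (g x)\<^sup>2) summable_on UNIV" by (rule summable_on_add[OF f(1) fg])
    fix x
    have "\<bar>g x\<bar> \<le> 1 + (g x)\<^sup>2"
      using zero_le_power2[of "\<bar>g x\<bar> - 1"] by (simp add: power2_diff)
    then show "norm (f x * g x) \<le> f x + f x * (g x)\<^sup>2"
      using mult_left_mono[of "\<bar>g x\<bar>" "1 + (g x)\<^sup>2" "f x"] f(2)[of x]
      by (simp add: abs_mult distrib_left)
  qed
  define W S Q where "W = infsum f UNIV" "S = (\<Sum>\<^sub>\<infinity>x. f x * g x)" "Q = (\<Sum>\<^sub>\<infinity>x. f x * (g x)\<^sup>2)"
  have key: "0 \<le> t\<^sup>2 * W - 2 * t * S + Q" for t
  proof -
    have "0 \<le> (\<Sum>\<^sub>\<infinity>x. f x * (t - g x)\<^sup>2)"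
      by (intro infsum_nonneg mult_nonneg_nonneg f) auto
    also have "(\<lambda>x. f x * (t - g x)\<^sup>2) = (\<lambda>x. t\<^sup>2 * f x + (- (2 * t) * (f x * g x) + f x * (g x)\<^sup>2))"
      by (simp add: fun_eq_iff power2_eq_square algebra_simps)
    also have "infsum \<dots> UNIV = t\<^sup>2 * W + (- (2 * t) * S + Q)"
      unfolding W_S_Q_def
      by (intro infsumI has_sum_add has_sum_cmult_right has_sum_infsum f s fg)
    finally show ?thesis by simp
  qed
  have W0: "0 \<le> W" unfolding W_S_Q_def by (intro infsum_nonneg f)
  show ?thesis unfolding W_S_Q_def[symmetric]
  proof (cases "W = 0")
    case True
    have "S = 0"
    proof (rule ccontr)
      assume "S \<noteq> 0"
      then show False using key[of "(Q + 1) / (2 * S)"] True by simp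
    qed
    then show "S\<^sup>2 \<le> W * Q" using True by simp
  next
    case False
    then have "0 < W" using W0 by simp
    then show "S\<^sup>2 \<le> W * Q"
      using mult_left_mono[OF key[of "S / W"], of W] by (simp add: field_simps power2_eq_square)
  qed
qed

lemma summable_convolution_product:
  fixes f g :: "'a::ab_group_add \<Rightarrow> real"
  assumes f: "f summable_on UNIV" "\<And>x. 0 \<le> f x" and g: "g summable_on UNIV" "\<And>x. 0 \<le> g x"
  shows "(\<lambda>(x, y). f y * g (x - y)) summable_on (UNIV \<times> UNIV)"
proof -
  have "(\<lambda>(y, x). f y * g x) summable_on (UNIV \<times> UNIV)"
  proof (rule summable_on_SigmaI)
    show "((\<lambda>x. case (y, x) of (y, x) \<Rightarrow> f y * g x) has_sum (f y * infsum g UNIV)) UNIV" for y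
      using has_sum_cmult_right[OF has_sum_infsum[OF g(1)], of "f y"] by simp
    show "(\<lambda>y. f y * infsum g UNIV) summable_on UNIV"
      by (rule summable_on_cmult_left[OF f(1)])
  qed (use f g in auto)
  also have "?this \<longleftrightarrow> ?thesis"
    by (rule summable_on_reindex_bij_witness[of _ "\<lambda>(x, y). (y, x - y)" "\<lambda>(y, x). (x + y, y)"]) auto
  finally show ?thesis .
qed

text \<open>
  Young's inequality: Cauchy-Schwarz for the weight \<open>f\<close> bounds the square of the convolution by
  \<open>\<parallel>f\<parallel>\<^sub>1\<close> times the convolution of \<open>f\<close> with \<open>g\<^sup>2\<close>, whose total sum Tonelli's theorem evaluates.
\<close>

lemma young_l1_l2:
  fixes f g :: "'a::ab_group_add \<Rightarrow> real"
  assumes f: "f summable_on UNIV" "\<And>x. 0 \<le> f x" and g: "(\<lambda>x. (g x)\<^sup>2) summable_on UNIV"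
  shows "(\<lambda>x. (\<Sum>\<^sub>\<infinity>y. f y * g (x - y))\<^sup>2) summable_on UNIV"
    and "(\<Sum>\<^sub>\<infinity>x. (\<Sum>\<^sub>\<infinity>y. f y * g (x - y))\<^sup>2) \<le> (infsum f UNIV)\<^sup>2 * (\<Sum>\<^sub>\<infinity>x. (g x)\<^sup>2)"
proof -
  let ?K = "\<lambda>(x, y). f y * (g (x - y))\<^sup>2"
  have K: "?K summable_on (UNIV \<times> UNIV)"
    by (rule summable_convolution_product) (use f g in auto)
  have Kx: "(\<lambda>y. f y * (g (x - y))\<^sup>2) summable_on UNIV" for x
    using summable_on_SigmaD1[OF K, of x] by simp
  have Ks: "(\<lambda>x. \<Sum>\<^sub>\<infinity>y. f y * (g (x - y))\<^sup>2) summable_on UNIV"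
    using summable_on_Sigma_banach[OF K] by simp
  have "(\<Sum>\<^sub>\<infinity>x. \<Sum>\<^sub>\<infinity>y. f y * (g (x - y))\<^sup>2) = (\<Sum>\<^sub>\<infinity>y. \<Sum>\<^sub>\<infinity>x. f y * (g (x - y))\<^sup>2)"
    by (rule infsum_swap_banach) (use K in simp)
  also have "\<dots> = (\<Sum>\<^sub>\<infinity>y. f y * (\<Sum>\<^sub>\<infinity>x. (g x)\<^sup>2))"
  proof (rule infsum_cong)
    fix y
    have "(\<Sum>\<^sub>\<infinity>x. (g (x - y))\<^sup>2) = (\<Sum>\<^sub>\<infinity>x. (g x)\<^sup>2)"
      by (rule infsum_reindex_bij_witness[of _ "\<lambda>x. x + y" "\<lambda>x. x - y"]) auto
    then show "(\<Sum>\<^sub>\<infinity>x. f y * (g (x - y))\<^sup>2) = f y * (\<Sum>\<^sub>\<infinity>x. (g x)\<^sup>2)"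
      by (simp add: infsum_cmult_right')
  qed
  also have "\<dots> = infsum f UNIV * (\<Sum>\<^sub>\<infinity>x. (g x)\<^sup>2)"
    by (simp add: infsum_cmult_left')
  finally have tot: "(\<Sum>\<^sub>\<infinity>x. \<Sum>\<^sub>\<infinity>y. f y * (g (x - y))\<^sup>2) = infsum f UNIV * (\<Sum>\<^sub>\<infinity>x. (g x)\<^sup>2)" .
  have pt: "(\<Sum>\<^sub>\<infinity>y. f y * g (x - y))\<^sup>2 \<le> infsum f UNIV * (\<Sum>\<^sub>\<infinity>y. f y * (g (x - y))\<^sup>2)" for x
    by (rule infsum_weighted_square_le[OF f Kx])
  have s2: "(\<lambda>x. infsum f UNIV * (\<Sum>\<^sub>\<infinity>y. f y * (g (x - y))\<^sup>2)) summable_on UNIV"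
    by (rule summable_on_cmult_right[OF Ks])
  show 1: "(\<lambda>x. (\<Sum>\<^sub>\<infinity>y. f y * g (x - y))\<^sup>2) summable_on UNIV"
    by (rule dominated_summable_on[OF s2]) (use pt in auto)
  have "(\<Sum>\<^sub>\<infinity>x. (\<Sum>\<^sub>\<infinity>y. f y * g (x - y))\<^sup>2)
      \<le> (\<Sum>\<^sub>\<infinity>x. infsum f UNIV * (\<Sum>\<^sub>\<infinity>y. f y * (g (x - y))\<^sup>2))"
    by (rule infsum_mono[OF 1 s2 pt])
  also have "\<dots> = (infsum f UNIV)\<^sup>2 * (\<Sum>\<^sub>\<infinity>x. (g x)\<^sup>2)"
    by (simp only: infsum_cmult_right' tot) (simp add: power2_eq_square)
  finally show "(\<Sum>\<^sub>\<infinity>x. (\<Sum>\<^sub>\<infinity>y. f y * g (x - y))\<^sup>2) \<le> (infsum f UNIV)\<^sup>2 * (\<Sum>\<^sub>\<infinity>x. (g x)\<^sup>2)" .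
qed

section \<open>The algebra of rapidly decreasing families and its action on the GNS space\<close>

text \<open>
  The product \<open>a \<star> x\<close> converges absolutely when \<open>a\<close> is summable and \<open>x\<close> is bounded. This covers
  at once the multiplication of the algebra and its action on the GNS space, so the algebraic laws
  are proved for this pair of classes.
\<close>

definition l1_space :: "coeffs set" where
  "l1_space = {a. (\<lambda>\<beta>. cmod (a \<beta>)) summable_on UNIV}"

definition bounded_space :: "coeffs set" where
  "bounded_space = {x. \<exists>C. \<forall>\<beta>. cmod (x \<beta>) \<le> C}"

lemma smooth_l1 [simp]: "a \<in> smooth_torus \<Longrightarrow> a \<in> l1_space"
  by (simp add: l1_space_def smooth_summable)

lemma l1_bounded [simp]: "a \<in> l1_space \<Longrightarrow> a \<in> bounded_space"
  unfolding l1_space_def bounded_space_def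
  using finite_sum_le_infsum[of "\<lambda>\<beta>. cmod (a \<beta>)" UNIV "{\<beta>}" for \<beta>] by auto

lemma gns_bounded [simp]:
  assumes "x \<in> gns_space" shows "x \<in> bounded_space"
proof -
  have "cmod (x \<beta>) \<le> sqrt (\<Sum>\<^sub>\<infinity>\<beta>. (cmod (x \<beta>))\<^sup>2)" for \<beta>
    using finite_sum_le_infsum[of "\<lambda>\<beta>. (cmod (x \<beta>))\<^sup>2" UNIV "{\<beta>}"] assms
    by (intro real_le_rsqrt) (auto simp: gns_space_def)
  then show ?thesis unfolding bounded_space_def by blast
qed

lemma l1_gns [simp]:
  assumes "a \<in> l1_space" shows "a \<in> gns_space"
proof -
  obtain C where C: "\<And>\<beta>. cmod (a \<beta>) \<le> C"
    using l1_bounded[OF assms] unfolding bounded_space_def by blast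
  have "(\<lambda>\<beta>. (cmod (a \<beta>))\<^sup>2) summable_on UNIV"
  proof (rule dominated_summable_on)
    show "(\<lambda>\<beta>. C * cmod (a \<beta>)) summable_on UNIV"
      using assms by (intro summable_on_cmult_right) (simp add: l1_space_def)
    show "norm ((cmod (a \<beta>))\<^sup>2) \<le> C * cmod (a \<beta>)" for \<beta>
      using C[of \<beta>] by (simp add: power2_eq_square mult_right_mono)
  qed
  then show ?thesis by (simp add: gns_space_def)
qed

lemma smooth_gns [simp]: "a \<in> smooth_torus \<Longrightarrow> a \<in> gns_space"
  by simp

lemma bounded_add [simp]: "x \<in> bounded_space \<Longrightarrow> y \<in> bounded_space \<Longrightarrow> x + y \<in> bounded_space"
  unfolding bounded_space_def mem_Collect_eq
proof (elim exE)
  fix C D assume "\<forall>\<beta>. cmod (x \<beta>) \<le> C" "\<forall>\<beta>. cmod (y \<beta>) \<le> D"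
  then have "\<forall>\<beta>. cmod ((x + y) \<beta>) \<le> C + D"
    by (auto intro: norm_triangle_le add_mono)
  then show "\<exists>C. \<forall>\<beta>. cmod ((x + y) \<beta>) \<le> C" ..
qed

lemma gns_cscale [simp]: "x \<in> gns_space \<Longrightarrow> z *\<^sub>C x \<in> gns_space"
  by (simp add: gns_space_def cscale_def norm_mult power_mult_distrib summable_on_cmult_right)

lemma square_add_le: "(cmod (x + y))\<^sup>2 \<le> 2 * (cmod x)\<^sup>2 + 2 * (cmod y)\<^sup>2"
proof -
  have "(cmod (x + y))\<^sup>2 \<le> (cmod x + cmod y)\<^sup>2" by (simp add: norm_triangle_ineq power_mono)
  also have "\<dots> \<le> 2 * (cmod x)\<^sup>2 + 2 * (cmod y)\<^sup>2"
    using zero_le_power2[of "cmod x - cmod y"] by (simp add: power2_sum power2_diff)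
  finally show ?thesis .
qed

lemma gns_add [simp]:
  assumes "x \<in> gns_space" "y \<in> gns_space" shows "x + y \<in> gns_space"
proof -
  have "(\<lambda>\<beta>. (cmod (x \<beta> + y \<beta>))\<^sup>2) summable_on UNIV"
  proof (rule dominated_summable_on)
    show "(\<lambda>\<beta>. 2 * (cmod (x \<beta>))\<^sup>2 + 2 * (cmod (y \<beta>))\<^sup>2) summable_on UNIV"
      using assms by (intro summable_on_add summable_on_cmult_right) (auto simp: gns_space_def)
  qed (simp add: square_add_le)
  then show ?thesis by (simp add: gns_space_def)
qed

lemma gns_norm_nonneg [simp]: "0 \<le> gns_norm x"
  by (simp add: gns_norm_def infsum_nonneg)

lemma gns_norm_square: "(gns_norm x)\<^sup>2 = (\<Sum>\<^sub>\<infinity>\<beta>. (cmod (x \<beta>))\<^sup>2)"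
  by (simp add: gns_norm_def infsum_nonneg)

lemma gns_norm_square_add_le:
  assumes "x \<in> gns_space" "y \<in> gns_space"
  shows "(gns_norm (x + y))\<^sup>2 \<le> 2 * (gns_norm x)\<^sup>2 + 2 * (gns_norm y)\<^sup>2"
proof -
  have s: "(\<lambda>\<beta>. (cmod (x \<beta>))\<^sup>2) summable_on UNIV" "(\<lambda>\<beta>. (cmod (y \<beta>))\<^sup>2) summable_on UNIV"
    "(\<lambda>\<beta>. (cmod ((x + y) \<beta>))\<^sup>2) summable_on UNIV"
    using assms gns_add[OF assms] unfolding gns_space_def by blast+
  note s' = s(3)[unfolded plus_fun_apply]
  have "(\<Sum>\<^sub>\<infinity>\<beta>. (cmod ((x + y) \<beta>))\<^sup>2) \<le> (\<Sum>\<^sub>\<infinity>\<beta>. 2 * (cmod (x \<beta>))\<^sup>2 + 2 * (cmod (y \<beta>))\<^sup>2)"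
    by (rule infsum_mono) (auto intro!: s s' summable_on_add summable_on_cmult_right simp: square_add_le)
  also have "\<dots> = 2 * (gns_norm x)\<^sup>2 + 2 * (gns_norm y)\<^sup>2"
    unfolding gns_norm_square
    by (intro infsumI has_sum_add has_sum_cmult_right has_sum_infsum s)
  finally show ?thesis by (simp add: gns_norm_square)
qed

lemma gns_inner_self:
  assumes "x \<in> gns_space" shows "gns_inner x x = complex_of_real ((gns_norm x)\<^sup>2)"
proof -
  have "((\<lambda>\<beta>. complex_of_real ((cmod (x \<beta>))\<^sup>2)) has_sum complex_of_real ((gns_norm x)\<^sup>2)) UNIV"
    unfolding gns_norm_square
    using assms by (intro has_sum_of_real has_sum_infsum) (simp add: gns_space_def)
  moreover have "cnj z * z = complex_of_real ((cmod z)\<^sup>2)" for z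
    by (simp only: complex_norm_square mult.commute)
  ultimately show ?thesis unfolding gns_inner_def by (simp only: infsumI)
qed

lemma gns_norm_eq_0:
  assumes "x \<in> gns_space" "gns_norm x = 0" shows "x = 0"
proof
  fix \<beta>
  have "(\<lambda>\<beta>. (cmod (x \<beta>))\<^sup>2) summable_on UNIV" "(\<Sum>\<^sub>\<infinity>\<beta>. (cmod (x \<beta>))\<^sup>2) \<le> 0"
    using assms gns_norm_square[of x] by (auto simp: gns_space_def)
  then have "(cmod (x \<beta>))\<^sup>2 = 0"
    by (intro nonneg_infsum_le_0D[where A = UNIV]) auto
  then show "x \<beta> = 0 \<beta>" by simp
qed

lemma cscale_simps [simp]:
  "1 *\<^sub>C a = a" "0 *\<^sub>C a = 0" "z *\<^sub>C (w *\<^sub>C a) = (z * w) *\<^sub>C a" "z *\<^sub>C 0 = 0"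
  by (auto simp: cscale_def fun_eq_iff)

lemma cscale_add_right: "z *\<^sub>C (a + b) = z *\<^sub>C a + z *\<^sub>C b"
  and cscale_diff_right: "z *\<^sub>C (a - b) = z *\<^sub>C a - z *\<^sub>C b"
  and cscale_minus_right: "z *\<^sub>C (- a) = - (z *\<^sub>C a)"
  and cscale_add_left: "(z + w) *\<^sub>C a = z *\<^sub>C a + w *\<^sub>C a"
  and cscale_diff_left: "(z - w) *\<^sub>C a = z *\<^sub>C a - w *\<^sub>C a"
  and cscale_minus_left: "(- z) *\<^sub>C a = - (z *\<^sub>C a)"
  by (auto simp: cscale_def fun_eq_iff algebra_simps)

lemma sum_apply: "sum f I \<beta> = (\<Sum>i\<in>I. f i \<beta>)" for f :: "'i \<Rightarrow> coeffs"
  by (induction I rule: infinite_finite_induct) auto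

lemma cscale_sum_right: "z *\<^sub>C sum f I = (\<Sum>i\<in>I. z *\<^sub>C f i)"
  by (simp add: cscale_def fun_eq_iff sum_apply sum_distrib_left)

lemma delta_linear:
  "delta k (a + b) = delta k a + delta k b" "delta k (a - b) = delta k a - delta k b"
  "delta k (- a) = - delta k a" "delta k (z *\<^sub>C a) = z *\<^sub>C delta k a" "delta k 0 = 0"
  by (auto simp: delta_def cscale_def fun_eq_iff algebra_simps)

lemma delta_sum: "delta k (sum f I) = (\<Sum>i\<in>I. delta k (f i))"
  by (simp add: delta_def fun_eq_iff sum_apply sum_distrib_left)

lemma delta_unit [simp]: "delta k unit = 0"
  by (auto simp: delta_def monomial_def fun_eq_iff)

lemma trace_linear:
  "canonical_trace (a + b) = canonical_trace a + canonical_trace b"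
  "canonical_trace (a - b) = canonical_trace a - canonical_trace b"
  "canonical_trace (- a) = - canonical_trace a"
  "canonical_trace (z *\<^sub>C a) = z * canonical_trace a" "canonical_trace 0 = 0"
  by (auto simp: canonical_trace_def cscale_def)

lemma trace_sum: "canonical_trace (sum f I) = (\<Sum>i\<in>I. canonical_trace (f i))"
  by (simp add: canonical_trace_def sum_apply)

lemma cscale_apply: "(z *\<^sub>C a) \<beta> = z * a \<beta>"
  by (simp add: cscale_def)

lemma trace_numeral_mult: "canonical_trace (numeral w * a) = numeral w * canonical_trace a"
  by (simp add: canonical_trace_def)

context nc_torus
begin

lemma cocycle_add_left: "cocycle (\<alpha> + \<beta>) \<gamma> = cocycle \<alpha> \<gamma> * cocycle \<beta> \<gamma>"
  by (simp add: cocycle_def exp_add[symmetric] distrib_left distrib_right sum.distrib case_prod_unfold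
      algebra_simps)

lemma cocycle_add_right: "cocycle \<alpha> (\<beta> + \<gamma>) = cocycle \<alpha> \<beta> * cocycle \<alpha> \<gamma>"
  by (simp add: cocycle_def exp_add[symmetric] distrib_left distrib_right sum.distrib case_prod_unfold
      algebra_simps)

lemma cocycle_nonzero [simp]: "cocycle \<alpha> \<beta> \<noteq> 0"
  by (simp add: cocycle_def)

lemma cocycle_uminus_left: "cocycle (- \<alpha>) \<beta> = inverse (cocycle \<alpha> \<beta>)"
  using cocycle_add_left[of "- \<alpha>" \<alpha> \<beta>] by (simp add: field_simps)

lemma cocycle_uminus_right: "cocycle \<alpha> (- \<beta>) = inverse (cocycle \<alpha> \<beta>)"
  using cocycle_add_right[of \<alpha> "- \<beta>" \<beta>] by (simp add: field_simps)

lemma cocycle_diff_left: "cocycle (\<alpha> - \<beta>) \<gamma> = cocycle \<alpha> \<gamma> * inverse (cocycle \<beta> \<gamma>)"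
  using cocycle_add_left[of \<alpha> "- \<beta>" \<gamma>] by (simp add: cocycle_uminus_left)

lemma cocycle_diff_right: "cocycle \<alpha> (\<beta> - \<gamma>) = cocycle \<alpha> \<beta> * inverse (cocycle \<alpha> \<gamma>)"
  using cocycle_add_right[of \<alpha> \<beta> "- \<gamma>"] by (simp add: cocycle_uminus_right)

lemma cnj_cocycle: "cnj (cocycle \<alpha> \<beta>) = inverse (cocycle \<alpha> \<beta>)"
  using cocycle_mult_cnj[of \<alpha> \<beta>] by (simp add: field_simps)

lemma norm_terms_summable:
  assumes "a \<in> l1_space" "x \<in> bounded_space"
  shows "(\<lambda>\<gamma>. cmod (a \<gamma>) * cmod (x (\<beta> - \<gamma>))) summable_on UNIV"
proof -
  obtain C where C: "\<And>\<beta>. cmod (x \<beta>) \<le> C" using assms(2) by (auto simp: bounded_space_def)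
  show ?thesis
    by (rule summable_convolution[where C = C]) (use assms C in \<open>auto simp: l1_space_def\<close>)
qed

lemma terms_summable:
  assumes "a \<in> l1_space" "x \<in> bounded_space"
  shows "(\<lambda>\<gamma>. a \<gamma> * x (\<beta> - \<gamma>) * cocycle \<gamma> (\<beta> - \<gamma>)) summable_on UNIV"
  by (rule dominated_summable_on[OF norm_terms_summable[OF assms, of \<beta>]]) (simp add: norm_mult)

lemma cmod_mult_le:
  assumes "a \<in> l1_space" "x \<in> bounded_space"
  shows "cmod ((a \<star> x) \<beta>) \<le> (\<Sum>\<^sub>\<infinity>\<gamma>. cmod (a \<gamma>) * cmod (x (\<beta> - \<gamma>)))"
  unfolding mult_def
  by (rule order.trans[OF norm_infsum_bound])
    (use norm_terms_summable[OF assms] in \<open>simp_all add: norm_mult\<close>)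

lemma mult_add_right:
  "a \<in> l1_space \<Longrightarrow> x \<in> bounded_space \<Longrightarrow> y \<in> bounded_space \<Longrightarrow> a \<star> (x + y) = a \<star> x + a \<star> y"
  by (simp add: mult_def fun_eq_iff distrib_left distrib_right infsum_add terms_summable)

lemma mult_add_left:
  "a \<in> l1_space \<Longrightarrow> b \<in> l1_space \<Longrightarrow> x \<in> bounded_space \<Longrightarrow> (a + b) \<star> x = a \<star> x + b \<star> x"
  by (simp add: mult_def fun_eq_iff distrib_left distrib_right infsum_add terms_summable)

lemma mult_cscale_left: "(z *\<^sub>C a) \<star> b = z *\<^sub>C (a \<star> b)"
  by (simp add: mult_def cscale_def fun_eq_iff mult.assoc infsum_cmult_right')

lemma mult_cscale_right: "a \<star> (z *\<^sub>C b) = z *\<^sub>C (a \<star> b)"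
  by (simp add: mult_def cscale_def fun_eq_iff mult_ac flip: infsum_cmult_right')

lemma mult_minus_left: "(- a) \<star> b = - (a \<star> b)"
  by (simp add: uminus_eq_cscale[of a] uminus_eq_cscale[of "a \<star> b"] mult_cscale_left)

lemma mult_minus_right: "a \<star> (- b) = - (a \<star> b)"
  by (simp add: uminus_eq_cscale[of b] uminus_eq_cscale[of "a \<star> b"] mult_cscale_right)

lemma mult_zero [simp]: "0 \<star> a = 0" "a \<star> 0 = 0"
  by (simp_all add: mult_def fun_eq_iff)

lemma monomial_mult_apply: "(monomial \<alpha> \<star> x) \<beta> = x (\<beta> - \<alpha>) * cocycle \<alpha> (\<beta> - \<alpha>)"
proof -
  have "(monomial \<alpha> \<star> x) \<beta> = (\<Sum>\<^sub>\<infinity>\<gamma>\<in>{\<alpha>}. x (\<beta> - \<gamma>) * cocycle \<gamma> (\<beta> - \<gamma>))"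
    unfolding mult_def by (rule infsum_cong_neutral) (auto simp: monomial_def)
  then show ?thesis by simp
qed

lemma mult_monomial_apply: "(x \<star> monomial \<alpha>) \<beta> = x (\<beta> - \<alpha>) * cocycle (\<beta> - \<alpha>) \<alpha>"
proof -
  have "(x \<star> monomial \<alpha>) \<beta> = (\<Sum>\<^sub>\<infinity>\<gamma>\<in>{\<beta> - \<alpha>}. x \<gamma> * cocycle \<gamma> (\<beta> - \<gamma>))"
    unfolding mult_def by (rule infsum_cong_neutral) (auto simp: monomial_def)
  then show ?thesis by simp
qed

lemma unit_mult [simp]: "unit \<star> x = x" "x \<star> unit = x"
  by (simp_all add: fun_eq_iff monomial_mult_apply mult_monomial_apply)

lemma smooth_mult [simp]:
  assumes "a \<in> smooth_torus" "b \<in> smooth_torus" shows "a \<star> b \<in> smooth_torus"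
  unfolding smooth_torus_iff
proof
  fix k
  obtain C where C: "\<And>\<beta>. (1 + freq \<beta>) ^ k * cmod (b \<beta>) \<le> C"
    using assms unfolding smooth_torus_iff by meson
  define A where "A \<beta> = (1 + freq \<beta>) ^ k * cmod (a \<beta>)" for \<beta>
  define B where "B \<beta> = (1 + freq \<beta>) ^ k * cmod (b \<beta>)" for \<beta>
  have A: "A summable_on UNIV" "\<And>\<beta>. 0 \<le> A \<beta>"
    using smooth_weighted_summable[OF assms(1)] by (auto simp: A_def[abs_def])
  have B: "\<And>\<beta>. 0 \<le> B \<beta>" "\<And>\<beta>. B \<beta> \<le> C" using C by (auto simp: B_def)
  have "(1 + freq \<beta>) ^ k * cmod ((a \<star> b) \<beta>) \<le> infsum A UNIV * C" for \<beta>
  proof -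
    have "(1 + freq \<beta>) ^ k * cmod ((a \<star> b) \<beta>)
        \<le> (1 + freq \<beta>) ^ k * (\<Sum>\<^sub>\<infinity>\<gamma>. cmod (a \<gamma>) * cmod (b (\<beta> - \<gamma>)))"
      using assms by (intro mult_left_mono cmod_mult_le) auto
    also have "\<dots> = (\<Sum>\<^sub>\<infinity>\<gamma>. (1 + freq \<beta>) ^ k * (cmod (a \<gamma>) * cmod (b (\<beta> - \<gamma>))))"
      by (rule infsum_cmult_right'[symmetric])
    also have "\<dots> \<le> (\<Sum>\<^sub>\<infinity>\<gamma>. A \<gamma> * B (\<beta> - \<gamma>))"
    proof (rule infsum_mono)
      show "(\<lambda>\<gamma>. (1 + freq \<beta>) ^ k * (cmod (a \<gamma>) * cmod (b (\<beta> - \<gamma>)))) summable_on UNIV"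
        using assms by (intro summable_on_cmult_right norm_terms_summable) auto
      show "(\<lambda>\<gamma>. A \<gamma> * B (\<beta> - \<gamma>)) summable_on UNIV"
        by (rule summable_convolution[OF A B])
      fix \<gamma>
      have "(1 + freq \<beta>) ^ k \<le> (1 + freq \<gamma>) ^ k * (1 + freq (\<beta> - \<gamma>)) ^ k"
        using power_mono[OF weight_submult[of \<beta> \<gamma>], of k] by (simp add: power_mult_distrib)
      from mult_right_mono[OF this, of "cmod (a \<gamma>) * cmod (b (\<beta> - \<gamma>))"]
      show "(1 + freq \<beta>) ^ k * (cmod (a \<gamma>) * cmod (b (\<beta> - \<gamma>))) \<le> A \<gamma> * B (\<beta> - \<gamma>)"
        by (simp add: A_def B_def mult_ac)
    qed
    also have "\<dots> \<le> (\<Sum>\<^sub>\<infinity>\<gamma>. A \<gamma> * C)"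
      by (rule infsum_mono)
        (auto intro!: summable_convolution[OF A B] summable_on_cmult_left A mult_left_mono B)
    finally show ?thesis by (simp add: infsum_cmult_left')
  qed
  then show "\<exists>C. \<forall>\<beta>. (1 + freq \<beta>) ^ k * cmod ((a \<star> b) \<beta>) \<le> C" by blast
qed

lemma l1_mult [simp]:
  assumes "a \<in> l1_space" "b \<in> l1_space" shows "a \<star> b \<in> l1_space"
proof -
  have "(\<lambda>(\<beta>, \<gamma>). cmod (a \<gamma>) * cmod (b (\<beta> - \<gamma>))) summable_on (UNIV \<times> UNIV)"
    by (rule summable_convolution_product) (use assms in \<open>auto simp: l1_space_def\<close>)
  then have "(\<lambda>\<beta>. \<Sum>\<^sub>\<infinity>\<gamma>. cmod (a \<gamma>) * cmod (b (\<beta> - \<gamma>))) summable_on UNIV"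
    using summable_on_Sigma_banach by fastforce
  then have "(\<lambda>\<beta>. cmod ((a \<star> b) \<beta>)) summable_on UNIV"
    by (rule dominated_summable_on) (use assms in \<open>simp add: cmod_mult_le\<close>)
  then show ?thesis by (simp add: l1_space_def)
qed

lemma l1_mult_gns:
  assumes "a \<in> l1_space" "x \<in> gns_space"
  shows "a \<star> x \<in> gns_space" "gns_norm (a \<star> x) \<le> (\<Sum>\<^sub>\<infinity>\<gamma>. cmod (a \<gamma>)) * gns_norm x"
proof -
  let ?Y = "\<lambda>\<beta>. \<Sum>\<^sub>\<infinity>\<gamma>. cmod (a \<gamma>) * cmod (x (\<beta> - \<gamma>))"
  have le: "(cmod ((a \<star> x) \<beta>))\<^sup>2 \<le> (?Y \<beta>)\<^sup>2" for \<beta>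
    using assms by (intro power_mono cmod_mult_le) auto
  have y: "(\<lambda>\<beta>. (?Y \<beta>)\<^sup>2) summable_on UNIV"
    "(\<Sum>\<^sub>\<infinity>\<beta>. (?Y \<beta>)\<^sup>2) \<le> (\<Sum>\<^sub>\<infinity>\<gamma>. cmod (a \<gamma>))\<^sup>2 * (\<Sum>\<^sub>\<infinity>\<beta>. (cmod (x \<beta>))\<^sup>2)"
    by (rule young_l1_l2; use assms in \<open>simp add: l1_space_def gns_space_def\<close>)+
  have s: "(\<lambda>\<beta>. (cmod ((a \<star> x) \<beta>))\<^sup>2) summable_on UNIV"
    by (rule dominated_summable_on[OF y(1)]) (use le in simp)
  then show "a \<star> x \<in> gns_space" by (simp add: gns_space_def)
  have "(gns_norm (a \<star> x))\<^sup>2 \<le> (\<Sum>\<^sub>\<infinity>\<beta>. (?Y \<beta>)\<^sup>2)"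
    unfolding gns_norm_square by (rule infsum_mono[OF s y(1) le])
  also note y(2)
  also have "(\<Sum>\<^sub>\<infinity>\<gamma>. cmod (a \<gamma>))\<^sup>2 * (\<Sum>\<^sub>\<infinity>\<beta>. (cmod (x \<beta>))\<^sup>2) = ((\<Sum>\<^sub>\<infinity>\<gamma>. cmod (a \<gamma>)) * gns_norm x)\<^sup>2"
    by (simp add: gns_norm_square power_mult_distrib)
  finally show "gns_norm (a \<star> x) \<le> (\<Sum>\<^sub>\<infinity>\<gamma>. cmod (a \<gamma>)) * gns_norm x"
    by (rule power2_le_imp_le) (simp add: infsum_nonneg)
qed

text \<open>
  The two iterated sums may be exchanged, since \<open>|a|\<close>, \<open>|b|\<close> are summable and \<open>x\<close> is bounded; the
  phases agree because the cocycle is a bicharacter.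
\<close>

lemma mult_assoc:
  assumes a: "a \<in> l1_space" and b: "b \<in> l1_space" and x: "x \<in> bounded_space"
  shows "(a \<star> b) \<star> x = a \<star> (b \<star> x)"
proof
  fix \<beta>
  obtain C where C: "\<And>\<beta>. cmod (x \<beta>) \<le> C" using x by (auto simp: bounded_space_def)
  define K where "K = (\<lambda>(\<gamma>, \<eta>). a \<eta> * b (\<gamma> - \<eta>) * cocycle \<eta> (\<gamma> - \<eta>) * x (\<beta> - \<gamma>) * cocycle \<gamma> (\<beta> - \<gamma>))"
  have "(\<lambda>(\<gamma>, \<eta>). cmod (a \<eta>) * cmod (b (\<gamma> - \<eta>))) summable_on (UNIV \<times> UNIV)"
    by (rule summable_convolution_product) (use a b in \<open>auto simp: l1_space_def\<close>)
  from summable_on_cmult_left[OF this, of C] have K: "K summable_on (UNIV \<times> UNIV)"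
    by (rule dominated_summable_on)
      (use C in \<open>auto simp: K_def norm_mult intro!: mult_left_mono\<close>)
  have "((a \<star> b) \<star> x) \<beta> = (\<Sum>\<^sub>\<infinity>\<gamma>. \<Sum>\<^sub>\<infinity>\<eta>. K (\<gamma>, \<eta>))"
    by (simp add: mult_def K_def infsum_cmult_left')
  also have "\<dots> = (\<Sum>\<^sub>\<infinity>\<eta>. \<Sum>\<^sub>\<infinity>\<gamma>. K (\<gamma>, \<eta>))"
    by (rule infsum_swap_banach) (use K in simp)
  also have "\<dots> = (\<Sum>\<^sub>\<infinity>\<eta>. a \<eta> * (b \<star> x) (\<beta> - \<eta>) * cocycle \<eta> (\<beta> - \<eta>))"
  proof (rule infsum_cong)
    fix \<eta>
    have "(\<Sum>\<^sub>\<infinity>\<gamma>. K (\<gamma>, \<eta>)) = (\<Sum>\<^sub>\<infinity>\<zeta>. a \<eta> * (b \<zeta> * x (\<beta> - \<eta> - \<zeta>) * cocycle \<zeta> (\<beta> - \<eta> - \<zeta>)) * cocycle \<eta> (\<beta> - \<eta>))"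
    proof (rule infsum_reindex_bij_witness[of _ "\<lambda>\<zeta>. \<zeta> + \<eta>" "\<lambda>\<gamma>. \<gamma> - \<eta>"])
      fix \<gamma>
      have "cocycle \<eta> (\<gamma> - \<eta>) * cocycle \<gamma> (\<beta> - \<gamma>) = cocycle (\<gamma> - \<eta>) (\<beta> - \<gamma>) * cocycle \<eta> (\<beta> - \<eta>)"
        by (simp add: cocycle_diff_left cocycle_diff_right field_simps)
      then show "a \<eta> * (b (\<gamma> - \<eta>) * x (\<beta> - \<eta> - (\<gamma> - \<eta>)) * cocycle (\<gamma> - \<eta>) (\<beta> - \<eta> - (\<gamma> - \<eta>))) * cocycle \<eta> (\<beta> - \<eta>)
          = K (\<gamma>, \<eta>)"
        by (simp add: K_def mult_ac)
    qed auto
    also have "\<dots> = a \<eta> * (b \<star> x) (\<beta> - \<eta>) * cocycle \<eta> (\<beta> - \<eta>)"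
      by (simp add: mult_def infsum_cmult_left' infsum_cmult_right')
    finally show "(\<Sum>\<^sub>\<infinity>\<gamma>. K (\<gamma>, \<eta>)) = a \<eta> * (b \<star> x) (\<beta> - \<eta>) * cocycle \<eta> (\<beta> - \<eta>)" .
  qed
  finally show "((a \<star> b) \<star> x) \<beta> = (a \<star> (b \<star> x)) \<beta>" by (simp add: mult_def)
qed

lemma mult_diff_right:
  "a \<in> l1_space \<Longrightarrow> x \<in> bounded_space \<Longrightarrow> y \<in> bounded_space \<Longrightarrow> a \<star> (x - y) = a \<star> x - a \<star> y"
  using mult_add_right[of a x "- y"] by (simp add: mult_minus_right bounded_space_def)

lemma mult_diff_left:
  "a \<in> l1_space \<Longrightarrow> b \<in> l1_space \<Longrightarrow> x \<in> bounded_space \<Longrightarrow> (a - b) \<star> x = a \<star> x - b \<star> x"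
  using mult_add_left[of a "- b" x] by (simp add: mult_minus_left l1_space_def)

lemma smooth_assoc:
  "a \<in> smooth_torus \<Longrightarrow> b \<in> smooth_torus \<Longrightarrow> c \<in> smooth_torus \<Longrightarrow> (a \<star> b) \<star> c = a \<star> (b \<star> c)"
  by (simp add: mult_assoc)

lemma smooth_distrib:
  "a \<in> smooth_torus \<Longrightarrow> b \<in> smooth_torus \<Longrightarrow> c \<in> smooth_torus \<Longrightarrow> a \<star> (b + c) = a \<star> b + a \<star> c"
  "a \<in> smooth_torus \<Longrightarrow> b \<in> smooth_torus \<Longrightarrow> c \<in> smooth_torus \<Longrightarrow> a \<star> (b - c) = a \<star> b - a \<star> c"
  "a \<in> smooth_torus \<Longrightarrow> b \<in> smooth_torus \<Longrightarrow> c \<in> smooth_torus \<Longrightarrow> (a + b) \<star> c = a \<star> c + b \<star> c"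
  "a \<in> smooth_torus \<Longrightarrow> b \<in> smooth_torus \<Longrightarrow> c \<in> smooth_torus \<Longrightarrow> (a - b) \<star> c = a \<star> c - b \<star> c"
  by (simp_all add: mult_add_right mult_add_left mult_diff_right mult_diff_left)

lemmas torus_algebra = smooth_assoc smooth_distrib mult_minus_left mult_minus_right
  mult_cscale_left mult_cscale_right cscale_add_right cscale_diff_right cscale_minus_right

text \<open>
  The degree in each coordinate is additive under convolution.
\<close>

lemma delta_mult:
  assumes "a \<in> smooth_torus" "b \<in> smooth_torus"
  shows "delta k (a \<star> b) = delta k a \<star> b + a \<star> delta k b"
proof
  fix \<beta>
  have "delta k (a \<star> b) \<beta> = (\<Sum>\<^sub>\<infinity>\<gamma>. of_int (\<beta> $ k) * (a \<gamma> * b (\<beta> - \<gamma>) * cocycle \<gamma> (\<beta> - \<gamma>)))"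
    by (simp add: delta_def mult_def infsum_cmult_right')
  also have "\<dots> = (\<Sum>\<^sub>\<infinity>\<gamma>. delta k a \<gamma> * b (\<beta> - \<gamma>) * cocycle \<gamma> (\<beta> - \<gamma>)
      + a \<gamma> * delta k b (\<beta> - \<gamma>) * cocycle \<gamma> (\<beta> - \<gamma>))"
    by (simp add: delta_def algebra_simps)
  also have "\<dots> = (delta k a \<star> b + a \<star> delta k b) \<beta>"
    using assms by (simp add: infsum_add terms_summable mult_def)
  finally show "delta k (a \<star> b) \<beta> = (delta k a \<star> b + a \<star> delta k b) \<beta>" .
qed

lemma trace_mult_commute: "canonical_trace (a \<star> b) = canonical_trace (b \<star> a)"
  unfolding canonical_trace_def mult_def
proof (rule infsum_reindex_bij_witness[of _ uminus uminus])
  fix \<gamma>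
  show "b (- \<gamma>) * a (0 - - \<gamma>) * cocycle (- \<gamma>) (0 - - \<gamma>) = a \<gamma> * b (0 - \<gamma>) * cocycle \<gamma> (0 - \<gamma>)"
    by (simp add: cocycle_uminus_left cocycle_uminus_right)
qed auto

lemma adj_adj [simp]: "adj (adj a) = a"
  by (simp add: adj_def fun_eq_iff cocycle_uminus_left cocycle_uminus_right cnj_cocycle)

lemma adj_mult: "adj (a \<star> b) = adj b \<star> adj a"
proof
  fix \<beta>
  have "adj (a \<star> b) \<beta> = (\<Sum>\<^sub>\<infinity>\<gamma>. cnj (a \<gamma> * b (- \<beta> - \<gamma>) * cocycle \<gamma> (- \<beta> - \<gamma>) * cocycle (- \<beta>) \<beta>))"
    by (simp add: adj_def mult_def flip: infsum_cmult_left' infsum_cnj)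
  also have "\<dots> = (\<Sum>\<^sub>\<infinity>\<gamma>. adj b \<gamma> * adj a (\<beta> - \<gamma>) * cocycle \<gamma> (\<beta> - \<gamma>))"
  proof (rule infsum_reindex_bij_witness[of _ "\<lambda>\<gamma>. \<gamma> - \<beta>" "\<lambda>\<gamma>. \<gamma> + \<beta>"])
    fix \<gamma>
    show "adj b (\<gamma> + \<beta>) * adj a (\<beta> - (\<gamma> + \<beta>)) * cocycle (\<gamma> + \<beta>) (\<beta> - (\<gamma> + \<beta>))
        = cnj (a \<gamma> * b (- \<beta> - \<gamma>) * cocycle \<gamma> (- \<beta> - \<gamma>) * cocycle (- \<beta>) \<beta>)"
      by (simp add: adj_def cocycle_uminus_left cocycle_uminus_right cocycle_add_left cocycle_add_right
          cocycle_diff_left cocycle_diff_right cnj_cocycle field_simps)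
  qed auto
  finally show "adj (a \<star> b) \<beta> = (adj b \<star> adj a) \<beta>" by (simp add: mult_def)
qed

lemma adj_linear:
  "adj (a + b) = adj a + adj b" "adj (a - b) = adj a - adj b" "adj (- a) = - adj a"
  "adj (z *\<^sub>C a) = cnj z *\<^sub>C adj a"
  by (auto simp: adj_def cscale_def fun_eq_iff algebra_simps)

lemma adj_unit [simp]: "adj unit = unit"
  by (auto simp: adj_def monomial_def fun_eq_iff)

lemma adj_delta: "adj (delta k a) = - delta k (adj a)"
  by (auto simp: adj_def delta_def fun_eq_iff)

lemma smooth_adj [simp]:
  assumes "a \<in> smooth_torus" shows "adj a \<in> smooth_torus"
  unfolding smooth_torus_iff
proof
  fix k
  obtain C where C: "\<And>\<beta>. (1 + freq \<beta>) ^ k * cmod (a \<beta>) \<le> C"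
    using assms unfolding smooth_torus_iff by meson
  have "(1 + freq \<beta>) ^ k * cmod (adj a \<beta>) \<le> C" for \<beta>
    using C[of "- \<beta>"] by (simp add: adj_def norm_mult)
  then show "\<exists>C. \<forall>\<beta>. (1 + freq \<beta>) ^ k * cmod (adj a \<beta>) \<le> C" by blast
qed

end

section \<open>Smooth inverses and square roots\<close>

lemma abs_power_Suc_diff_le:
  fixes a b M :: real
  assumes "0 \<le> a" "a \<le> M" "0 \<le> b" "b \<le> M"
  shows "\<bar>a ^ Suc n - b ^ Suc n\<bar> \<le> (1 + real n) * \<bar>a - b\<bar> * M ^ n"
proof (induction n)
  case (Suc n)
  have "\<bar>a ^ Suc (Suc n) - b ^ Suc (Suc n)\<bar> = \<bar>a * (a ^ Suc n - b ^ Suc n) + (a - b) * b ^ Suc n\<bar>"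
    by (simp add: algebra_simps)
  also have "\<dots> \<le> \<bar>a\<bar> * \<bar>a ^ Suc n - b ^ Suc n\<bar> + \<bar>a - b\<bar> * b ^ Suc n"
    using assms by (intro order.trans[OF abs_triangle_ineq]) (simp add: abs_mult)
  also have "\<dots> \<le> M * ((1 + real n) * \<bar>a - b\<bar> * M ^ n) + \<bar>a - b\<bar> * M ^ Suc n"
    using assms Suc by (intro add_mono mult_mono mult_left_mono power_mono) auto
  also have "\<dots> = (1 + real (Suc n)) * \<bar>a - b\<bar> * M ^ Suc n"
    by (simp add: algebra_simps)
  finally show ?case .
qed simp

lemma gns_dominated:
  assumes "y \<in> gns_space" "\<And>\<beta>. cmod (x \<beta>) \<le> cmod (y \<beta>)"
  shows "x \<in> gns_space" "gns_norm x \<le> gns_norm y"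
proof -
  have y: "(\<lambda>\<beta>. (cmod (y \<beta>))\<^sup>2) summable_on UNIV" using assms by (simp add: gns_space_def)
  have x: "(\<lambda>\<beta>. (cmod (x \<beta>))\<^sup>2) summable_on UNIV"
    by (rule dominated_summable_on[OF y]) (use assms in \<open>simp add: power_mono\<close>)
  then show "x \<in> gns_space" by (simp add: gns_space_def)
  show "gns_norm x \<le> gns_norm y"
    unfolding gns_norm_def
    by (intro real_sqrt_le_mono infsum_mono x y power_mono assms) auto
qed

lemma smooth_weighted:
  assumes "a \<in> smooth_torus"
  shows "(\<lambda>\<beta>. complex_of_real ((1 + freq \<beta>) ^ m) * a \<beta>) \<in> smooth_torus"
  unfolding smooth_torus_iff
proof
  fix k
  obtain C where C: "\<And>\<beta>. (1 + freq \<beta>) ^ (k + m) * cmod (a \<beta>) \<le> C"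
    using assms unfolding smooth_torus_iff by meson
  have "(1 + freq \<beta>) ^ k * cmod (complex_of_real ((1 + freq \<beta>) ^ m) * a \<beta>) \<le> C" for \<beta>
    using C[of \<beta>] by (simp add: norm_mult norm_power power_add mult_ac
        del: of_real_add of_real_power)
  then show "\<exists>C. \<forall>\<beta>. (1 + freq \<beta>) ^ k * cmod (complex_of_real ((1 + freq \<beta>) ^ m) * a \<beta>) \<le> C"
    by blast
qed

context nc_torus
begin

text \<open>
  The induction step of the regularity argument for solutions of \<open>h \<star> x = y\<close>. The truncated weight
  \<open>v = min (1 + |\<beta>|, R)\<^bsup>n+1\<^esup>\<close> is bounded, so \<open>v x\<close> is in the GNS space and
  \<open>h \<star> (v x) = v y + [h, v] x\<close>. As \<open>v\<close> varies slowly, the commutator is dominated by a convolution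
  of a weighted \<open>h\<close> with \<open>(1 + |\<beta>|)\<^sup>n |x|\<close>, with constants that do not involve \<open>R\<close>. Applying the
  bounded left inverse bounds \<open>v x\<close> uniformly in \<open>R\<close>, and \<open>R\<close> may be sent to infinity.
\<close>

lemma weighted_square_summable_step:
  assumes h: "h \<in> smooth_torus" and B: "gns_bounded_operator B"
    and inv: "\<And>x. x \<in> gns_space \<Longrightarrow> B (h \<star> x) = x"
    and x: "x \<in> gns_space" and y: "h \<star> x \<in> smooth_torus"
    and sq: "(\<lambda>\<beta>. ((1 + freq \<beta>) ^ n * cmod (x \<beta>))\<^sup>2) summable_on UNIV"
  shows "(\<lambda>\<beta>. ((1 + freq \<beta>) ^ Suc n * cmod (x \<beta>))\<^sup>2) summable_on UNIV"
proof -
  obtain C where C: "\<And>z. z \<in> gns_space \<Longrightarrow> gns_norm (B z) \<le> C * gns_norm z"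
    using B unfolding gns_bounded_operator_def by blast
  define f where "f \<gamma> = (1 + real n) * ((1 + freq \<gamma>) ^ Suc n * cmod (h \<gamma>))" for \<gamma>
  define g where "g \<beta> = (1 + freq \<beta>) ^ n * cmod (x \<beta>)" for \<beta>
  define e where "e \<beta> = complex_of_real (\<Sum>\<^sub>\<infinity>\<gamma>. f \<gamma> * g (\<beta> - \<gamma>))" for \<beta>
  define yw where "yw \<beta> = complex_of_real ((1 + freq \<beta>) ^ Suc n) * (h \<star> x) \<beta>" for \<beta>
  have f: "f summable_on UNIV" "\<And>\<gamma>. 0 \<le> f \<gamma>"
    unfolding f_def[abs_def] by (intro summable_on_cmult_right smooth_weighted_summable h) simp
  have g: "(\<lambda>\<beta>. (g \<beta>)\<^sup>2) summable_on UNIV" "\<And>\<beta>. 0 \<le> g \<beta>"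
    using sq by (auto simp: g_def)
  have gb: "g \<beta> \<le> sqrt (\<Sum>\<^sub>\<infinity>\<beta>. (g \<beta>)\<^sup>2)" for \<beta>
    using finite_sum_le_infsum[OF g(1), of "{\<beta>}"] by (intro real_le_rsqrt) auto
  have e: "e \<in> gns_space"
    using young_l1_l2(1)[OF f g(1)] by (simp add: gns_space_def e_def)
  have yw: "yw \<in> gns_space"
    unfolding yw_def[abs_def] by (intro smooth_gns smooth_weighted y)
  define K where "K = C\<^sup>2 * (2 * (gns_norm yw)\<^sup>2 + 2 * (gns_norm e)\<^sup>2)"
  have bound: "(\<Sum>\<beta>\<in>F. ((1 + freq \<beta>) ^ Suc n * cmod (x \<beta>))\<^sup>2) \<le> K" if F: "finite F" for F
  proof -
    define R where "R = 1 + (\<Sum>\<beta>\<in>F. freq \<beta>)"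
    have R1: "1 \<le> R" by (simp add: R_def sum_nonneg)
    define u where "u \<beta> = min (1 + freq \<beta>) R" for \<beta>
    define V where "V \<beta> = complex_of_real (u \<beta> ^ Suc n) * x \<beta>" for \<beta>
    have u: "1 \<le> u \<beta>" "u \<beta> \<le> R" "u \<beta> \<le> 1 + freq \<beta>" for \<beta>
      using R1 by (auto simp: u_def)
    have u0: "0 \<le> u \<beta>" for \<beta> using u(1)[of \<beta>] by linarith
    have norm_V: "cmod (V \<beta>) = u \<beta> ^ Suc n * cmod (x \<beta>)" for \<beta>
      using u0[of \<beta>] by (simp add: V_def norm_mult norm_power)
    have V: "V \<in> gns_space"
    proof (rule gns_dominated(1))
      show "complex_of_real (R ^ Suc n) *\<^sub>C x \<in> gns_space" using x by simp
      show "cmod (V \<beta>) \<le> cmod ((complex_of_real (R ^ Suc n) *\<^sub>C x) \<beta>)" for \<beta>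
        using power_mono[OF u(2)[of \<beta>] u0[of \<beta>], of "Suc n"] R1
        by (simp only: norm_V cscale_def norm_mult norm_of_real) (auto intro!: mult_right_mono)
    qed
    define E where "E \<beta> = (h \<star> V) \<beta> - complex_of_real (u \<beta> ^ Suc n) * (h \<star> x) \<beta>" for \<beta>
    define vy where "vy \<beta> = complex_of_real (u \<beta> ^ Suc n) * (h \<star> x) \<beta>" for \<beta>
    have split: "h \<star> V = vy + E" by (simp add: E_def vy_def fun_eq_iff)
    have E_le: "cmod (E \<beta>) \<le> cmod (e \<beta>)" for \<beta>
    proof -
      define W where "W = V - complex_of_real (u \<beta> ^ Suc n) *\<^sub>C x"
      have W: "W \<in> gns_space" unfolding W_def
        using gns_add[OF V gns_cscale[OF x, of "- complex_of_real (u \<beta> ^ Suc n)"]]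
        by (simp add: cscale_minus_left)
      have "E \<beta> = (h \<star> W) \<beta>"
        unfolding E_def W_def using h V x
        by (simp add: mult_diff_right mult_cscale_right cscale_apply)
      also have "cmod \<dots> \<le> (\<Sum>\<^sub>\<infinity>\<gamma>. cmod (h \<gamma>) * cmod (W (\<beta> - \<gamma>)))"
        using h W by (intro cmod_mult_le) auto
      also have "\<dots> \<le> (\<Sum>\<^sub>\<infinity>\<gamma>. f \<gamma> * g (\<beta> - \<gamma>))"
      proof (rule infsum_mono)
        show "(\<lambda>\<gamma>. cmod (h \<gamma>) * cmod (W (\<beta> - \<gamma>))) summable_on UNIV"
          using h W by (intro norm_terms_summable) auto
        show "(\<lambda>\<gamma>. f \<gamma> * g (\<beta> - \<gamma>)) summable_on UNIV"
          by (rule summable_convolution[OF f g(2) gb])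
        fix \<gamma>
        define M where "M = (1 + freq \<gamma>) * (1 + freq (\<beta> - \<gamma>))"
        have M: "1 + freq \<beta> \<le> M" "1 + freq (\<beta> - \<gamma>) \<le> M"
          using weight_submult[of \<beta> \<gamma>] mult_right_mono[of 1 "1 + freq \<gamma>" "1 + freq (\<beta> - \<gamma>)"]
          by (auto simp: M_def)
        have "\<bar>u (\<beta> - \<gamma>) - u \<beta>\<bar> \<le> freq \<gamma>"
          using freq_add[of \<gamma> "\<beta> - \<gamma>"] freq_add[of "- \<gamma>" \<beta>] by (auto simp: u_def min_def)
        then have "(1 + real n) * \<bar>u (\<beta> - \<gamma>) - u \<beta>\<bar> * M ^ n \<le> (1 + real n) * (1 + freq \<gamma>) * M ^ n"
          by (intro mult_right_mono mult_left_mono) (auto simp: M_def)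
        moreover have "\<bar>u (\<beta> - \<gamma>) ^ Suc n - u \<beta> ^ Suc n\<bar> \<le> (1 + real n) * \<bar>u (\<beta> - \<gamma>) - u \<beta>\<bar> * M ^ n"
          using M u(3)[of \<beta>] u(3)[of "\<beta> - \<gamma>"] u0 by (intro abs_power_Suc_diff_le) auto
        ultimately have "\<bar>u (\<beta> - \<gamma>) ^ Suc n - u \<beta> ^ Suc n\<bar> \<le> (1 + real n) * (1 + freq \<gamma>) * M ^ n"
          by linarith
        then have d: "\<bar>u (\<beta> - \<gamma>) ^ Suc n - u \<beta> ^ Suc n\<bar>
            \<le> (1 + real n) * (1 + freq \<gamma>) ^ Suc n * (1 + freq (\<beta> - \<gamma>)) ^ n"
          by (simp add: M_def power_mult_distrib mult_ac)
        have "W (\<beta> - \<gamma>) = complex_of_real (u (\<beta> - \<gamma>) ^ Suc n - u \<beta> ^ Suc n) * x (\<beta> - \<gamma>)"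
          by (simp add: W_def V_def cscale_def algebra_simps)
        then have "cmod (W (\<beta> - \<gamma>)) = \<bar>u (\<beta> - \<gamma>) ^ Suc n - u \<beta> ^ Suc n\<bar> * cmod (x (\<beta> - \<gamma>))"
          by (simp only: norm_mult norm_of_real)
        also have "\<dots> \<le> (1 + real n) * (1 + freq \<gamma>) ^ Suc n * (1 + freq (\<beta> - \<gamma>)) ^ n * cmod (x (\<beta> - \<gamma>))"
          by (rule mult_right_mono[OF d]) simp
        finally have "cmod (h \<gamma>) * cmod (W (\<beta> - \<gamma>)) \<le> cmod (h \<gamma>) *
            ((1 + real n) * (1 + freq \<gamma>) ^ Suc n * (1 + freq (\<beta> - \<gamma>)) ^ n * cmod (x (\<beta> - \<gamma>)))"
          by (rule mult_left_mono) simp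
        then show "cmod (h \<gamma>) * cmod (W (\<beta> - \<gamma>)) \<le> f \<gamma> * g (\<beta> - \<gamma>)"
          by (simp add: f_def g_def mult_ac)
      qed
      also have "\<dots> \<le> cmod (e \<beta>)" by (simp add: e_def)
      finally show ?thesis .
    qed
    have vy_le: "cmod (vy \<beta>) \<le> cmod (yw \<beta>)" for \<beta>
      using power_mono[OF u(3)[of \<beta>] u0[of \<beta>], of "Suc n"] u0[of \<beta>]
      by (simp only: vy_def yw_def norm_mult norm_of_real) (auto intro!: mult_right_mono)
    have gE: "E \<in> gns_space" "gns_norm E \<le> gns_norm e"
      using gns_dominated[OF e E_le] by auto
    have gvy: "vy \<in> gns_space" "gns_norm vy \<le> gns_norm yw"
      using gns_dominated[OF yw vy_le] by auto
    have hV: "h \<star> V \<in> gns_space" using h V by (intro l1_mult_gns) auto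
    have "gns_norm V \<le> C * gns_norm (h \<star> V)"
      using C[OF hV] by (simp add: inv V)
    then have "(gns_norm V)\<^sup>2 \<le> (C * gns_norm (h \<star> V))\<^sup>2"
      by (rule power_mono) simp
    also have "\<dots> = C\<^sup>2 * (gns_norm (vy + E))\<^sup>2" by (simp add: power_mult_distrib split)
    also have "\<dots> \<le> C\<^sup>2 * (2 * (gns_norm vy)\<^sup>2 + 2 * (gns_norm E)\<^sup>2)"
      by (intro mult_left_mono gns_norm_square_add_le gvy gE) simp
    also have "\<dots> \<le> K"
      unfolding K_def
      by (intro mult_left_mono add_mono power_mono gvy gE) auto
    finally have VK: "(gns_norm V)\<^sup>2 \<le> K" .
    have "(\<Sum>\<beta>\<in>F. ((1 + freq \<beta>) ^ Suc n * cmod (x \<beta>))\<^sup>2) = (\<Sum>\<beta>\<in>F. (cmod (V \<beta>))\<^sup>2)"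
    proof (rule sum.cong[OF refl])
      fix \<beta> assume "\<beta> \<in> F"
      then have "freq \<beta> \<le> (\<Sum>\<beta>\<in>F. freq \<beta>)"
        using F by (intro member_le_sum) auto
      then have "u \<beta> = 1 + freq \<beta>" by (simp add: u_def R_def)
      then show "((1 + freq \<beta>) ^ Suc n * cmod (x \<beta>))\<^sup>2 = (cmod (V \<beta>))\<^sup>2"
        by (simp only: norm_V)
    qed
    also have "\<dots> \<le> (gns_norm V)\<^sup>2"
      unfolding gns_norm_square
      using V F by (intro finite_sum_le_infsum) (auto simp: gns_space_def)
    finally show ?thesis using VK by linarith
  qed
  show ?thesis
    by (rule nonneg_bdd_above_summable_on) (use bound in \<open>auto intro!: bdd_aboveI2[where M = K] simp del: power_Suc\<close>)
qed

text \<open>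
  Spectral invariance of the smooth algebra. The candidate is the image \<open>g\<close> of the unit vector under
  the inverse operator; the preceding lemma shows that all its weighted square sums are finite.
\<close>

theorem bounded_inverse_smooth:
  assumes h: "h \<in> smooth_torus" and "has_bounded_inverse h"
  shows "\<exists>g\<in>smooth_torus. h \<star> g = unit \<and> g \<star> h = unit"
proof -
  obtain B where B: "gns_bounded_operator B"
    and inv: "\<And>x. x \<in> gns_space \<Longrightarrow> B (h \<star> x) = x" "\<And>x. x \<in> gns_space \<Longrightarrow> h \<star> B x = x"
    using assms(2) by (auto simp: has_bounded_inverse_def)
  define g where "g = B unit"
  have g: "g \<in> gns_space" "h \<star> g = unit"
    using B by (auto simp: g_def gns_bounded_operator_def inv)
  have sq: "(\<lambda>\<beta>. ((1 + freq \<beta>) ^ n * cmod (g \<beta>))\<^sup>2) summable_on UNIV" for n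
  proof (induction n)
    case 0
    then show ?case using g by (simp add: gns_space_def)
  next
    case (Suc n)
    then show ?case
      using weighted_square_summable_step[OF h B inv(1) g(1) _ Suc] g(2) by simp
  qed
  have sm: "g \<in> smooth_torus"
    unfolding smooth_torus_iff
  proof
    fix k
    have "(1 + freq \<beta>) ^ k * cmod (g \<beta>) \<le> sqrt (\<Sum>\<^sub>\<infinity>\<beta>. ((1 + freq \<beta>) ^ k * cmod (g \<beta>))\<^sup>2)" for \<beta>
      using finite_sum_le_infsum[OF sq[of k], of "{\<beta>}"] by (intro real_le_rsqrt) auto
    then show "\<exists>C. \<forall>\<beta>. (1 + freq \<beta>) ^ k * cmod (g \<beta>) \<le> C" by blast
  qed
  have "h \<star> (g \<star> h) = h \<star> unit"
    using h sm g(2) by (simp flip: smooth_assoc)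
  then have "B (h \<star> (g \<star> h)) = B (h \<star> unit)" by simp
  then have "g \<star> h = unit"
    using h sm by (simp only: inv(1) smooth_gns smooth_mult smooth_monomial)
  then show ?thesis using sm g(2) by blast
qed

lemma inverse_el_eqI:
  assumes "a \<in> smooth_torus" "b \<in> smooth_torus" "a \<star> b = unit" "b \<star> a = unit"
  shows "inverse_el a = b"
  unfolding inverse_el_def
proof (rule the_equality)
  fix c assume c: "c \<in> smooth_torus \<and> a \<star> c = unit \<and> c \<star> a = unit"
  have "c = c \<star> (a \<star> b)" using assms by simp
  also have "\<dots> = (c \<star> a) \<star> b" using assms(1,2) c by (subst smooth_assoc) auto
  finally show "c = b" using c by simp
qed (use assms in auto)

lemma trace_adj: "canonical_trace (adj a) = cnj (canonical_trace a)"
  by (simp add: canonical_trace_def adj_def)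

lemma trace_square_eq_0:
  assumes "a \<in> smooth_torus" "canonical_trace (adj a \<star> a) = 0" shows "a = 0"
proof -
  have "gns_norm a = 0"
    using assms gns_inner_self[of a] by (simp add: gns_inner_eq_trace)
  then show ?thesis using assms by (intro gns_norm_eq_0) auto
qed

lemma positive_trace:
  assumes "positive_el h" "x \<in> smooth_torus"
  shows "canonical_trace (adj x \<star> (h \<star> x)) \<in> \<real>" "0 \<le> Re (canonical_trace (adj x \<star> (h \<star> x)))"
  using assms by (auto simp: positive_el_def simp flip: gns_inner_eq_trace)

text \<open>
  Real expectations make \<open>k = h - h\<^sup>*\<close> have expectation zero in every vector. The vector \<open>1 + \<i> k\<close>
  isolates the cross term \<open>2 \<i> t (k k) = - 2 \<i> t (k\<^sup>* k)\<close>, so \<open>k\<close> vanishes.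
\<close>

lemma positive_selfadjoint:
  assumes h: "h \<in> smooth_torus" and pos: "positive_el h" shows "adj h = h"
proof -
  define k where "k = h - adj h"
  have k: "k \<in> smooth_torus" "adj k = - k" using h by (auto simp: k_def adj_linear)
  have zero: "canonical_trace (adj x \<star> (k \<star> x)) = 0" if x: "x \<in> smooth_torus" for x
  proof -
    have "adj (adj x \<star> (h \<star> x)) = adj x \<star> (adj h \<star> x)"
      using h x by (simp add: adj_mult smooth_assoc)
    then have "canonical_trace (adj x \<star> (adj h \<star> x)) = canonical_trace (adj x \<star> (h \<star> x))"
      using positive_trace(1)[OF pos x] by (simp add: Reals_cnj_iff flip: trace_adj)
    then show ?thesis using h x by (simp add: k_def torus_algebra trace_linear)
  qed
  have "canonical_trace k = 0" using zero[of unit] by simp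
  moreover have "canonical_trace (k \<star> (k \<star> k)) = 0"
    using zero[of k] k by (simp add: torus_algebra trace_linear)
  moreover have "canonical_trace ((unit + \<i> *\<^sub>C k) \<star> (k \<star> (unit + \<i> *\<^sub>C k))) = 0"
    using zero[of "unit + \<i> *\<^sub>C k"] k by (simp add: adj_linear cscale_minus_left cscale_minus_right)
  ultimately have "canonical_trace (adj k \<star> k) = 0"
    using k by (simp add: torus_algebra trace_linear trace_numeral_mult)
  then have "k = 0" by (rule trace_square_eq_0[OF k(1)])
  then show ?thesis by (simp add: k_def)
qed

text \<open>
  The commutator \<open>c = h b - b h\<close> satisfies \<open>h c = - c h\<close>. Hence the nonnegative numbers \<open>t (c\<^sup>* h c)\<close>
  and \<open>t (c h c\<^sup>*)\<close> are opposite to each other by the trace property, and both are zero. A vector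
  in which a positive operator has expectation zero is in its kernel, so \<open>h c = 0\<close>, and \<open>c = 0\<close>
  because \<open>h\<close> is invertible.
\<close>

lemma commute_square_imp_commute:
  assumes h: "h \<in> conformal_factors" and b: "b \<in> smooth_torus"
    and comm: "(h \<star> h) \<star> b = b \<star> (h \<star> h)"
  shows "h \<star> b = b \<star> h"
proof -
  have hs: "h \<in> smooth_torus" and pos: "positive_el h" and "has_bounded_inverse h"
    using h by (auto simp: conformal_factors_def)
  then obtain g where g: "g \<in> smooth_torus" "g \<star> h = unit"
    using bounded_inverse_smooth by blast
  have sa: "adj h = h" by (rule positive_selfadjoint[OF hs pos])
  define c where "c = h \<star> b - b \<star> h"
  have c: "c \<in> smooth_torus" using hs b by (simp add: c_def)
  have anti: "c \<star> h = - (h \<star> c)"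
    using hs b comm by (simp add: c_def torus_algebra)
  define s where "s = canonical_trace (adj c \<star> (h \<star> c))"
  have s: "s \<in> \<real>" "0 \<le> Re s"
    using positive_trace[OF pos c] by (auto simp: s_def)
  have "canonical_trace (c \<star> (h \<star> adj c)) = canonical_trace ((h \<star> adj c) \<star> c)"
    by (rule trace_mult_commute)
  also have "\<dots> = canonical_trace (h \<star> (adj c \<star> c))" using hs c by (simp add: smooth_assoc)
  also have "\<dots> = canonical_trace ((adj c \<star> c) \<star> h)" by (rule trace_mult_commute)
  also have "\<dots> = - s" using hs c anti by (simp add: smooth_assoc mult_minus_right trace_linear s_def)
  finally have "0 \<le> Re (- s)"
    using positive_trace(2)[OF pos, of "adj c"] c by simp
  with s have s0: "s = 0" by (auto simp: complex_eq_iff complex_is_Real_iff)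
  define d where "d = h \<star> c"
  have d: "d \<in> smooth_torus" "adj d = adj c \<star> h" using hs c by (auto simp: d_def adj_mult sa)
  define N where "N = Re (canonical_trace (adj d \<star> d))"
  define M where "M = Re (canonical_trace (adj d \<star> (h \<star> d)))"
  have M: "0 \<le> M" using positive_trace(2)[OF pos d(1)] by (simp add: M_def)
  \<comment> \<open>Positivity of \<open>h\<close> in the vectors \<open>c + t h c\<close> forces \<open>h c = 0\<close>.\<close>
  have quad: "0 \<le> 2 * t * N + t\<^sup>2 * M" for t :: real
  proof -
    have 1: "adj c \<star> (h \<star> c) = adj c \<star> d" and 2: "adj c \<star> (h \<star> d) = adj d \<star> d"
      using hs c d by (simp_all add: d(2) smooth_assoc) (simp_all add: d_def)
    have "canonical_trace (adj (c + complex_of_real t *\<^sub>C d) \<star> (h \<star> (c + complex_of_real t *\<^sub>C d)))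
      = s + 2 * t * canonical_trace (adj d \<star> d) + t\<^sup>2 * canonical_trace (adj d \<star> (h \<star> d))"
      using hs c d(1)
      by (simp add: adj_linear torus_algebra trace_linear 2 s_def power2_eq_square algebra_simps
          trace_numeral_mult flip: d_def)
    then show ?thesis
      using positive_trace(2)[OF pos, of "c + complex_of_real t *\<^sub>C d"] c d
      by (simp add: s0 N_def M_def)
  qed
  have "N = 0"
  proof (rule ccontr)
    assume N: "N \<noteq> 0"
    define w where "w = N / (M + 1)"
    have N_w: "N = w * (M + 1)" using M by (simp add: w_def)
    have "0 < w\<^sup>2 * (M + 2)" using N M by (auto simp: N_w)
    moreover have "2 * (- w) * N + (- w)\<^sup>2 * M = - (w\<^sup>2 * (M + 2))"
      by (simp add: N_w algebra_simps power2_eq_square)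
    ultimately show False using quad[of "- w"] by linarith
  qed
  then have "canonical_trace (adj d \<star> d) = 0"
    using gns_inner_self[of d] d(1) by (simp add: N_def gns_inner_eq_trace complex_eq_iff)
  then have "d = 0" by (rule trace_square_eq_0[OF d(1)])
  then have "g \<star> (h \<star> c) = 0" by (simp add: d_def)
  then have "c = 0" using g hs c by (simp flip: smooth_assoc)
  then show ?thesis by (simp add: c_def)
qed

text \<open>
  The commutation lemma is used twice: if \<open>\<delta> (h\<^sup>2)\<close> commutes with \<open>h\<^sup>2\<close>, it commutes with \<open>h\<close>, and
  with \<open>\<delta> (h\<^sup>2) = h \<delta> h + \<delta> h h\<close> this says that \<open>\<delta> h\<close> commutes with \<open>h\<^sup>2\<close>, hence with \<open>h\<close>.
\<close>

lemma noncommuting_square: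
  assumes h: "h \<in> conformal_factors" and nc: "h \<star> delta a h \<noteq> delta a h \<star> h"
  shows "(h \<star> h) \<star> delta a (h \<star> h) \<noteq> delta a (h \<star> h) \<star> (h \<star> h)"
proof
  have hs: "h \<in> smooth_torus" using h by (simp add: conformal_factors_def)
  assume "(h \<star> h) \<star> delta a (h \<star> h) = delta a (h \<star> h) \<star> (h \<star> h)"
  then have "h \<star> delta a (h \<star> h) = delta a (h \<star> h) \<star> h"
    using hs by (intro commute_square_imp_commute[OF h]) auto
  then have "(h \<star> h) \<star> delta a h = delta a h \<star> (h \<star> h)"
    using hs by (simp add: delta_mult torus_algebra)
  then have "h \<star> delta a h = delta a h \<star> h"
    using hs by (intro commute_square_imp_commute[OF h]) auto
  with nc show False by simp
qed

end

section \<open>The symbol of a Laplace-type operator\<close>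

text \<open>
  Grouping the terms by their exponent gives the coefficients of a polynomial in \<open>t\<close> with infinitely
  many roots.
\<close>

lemma coeff_extraction:
  fixes f :: "'a \<Rightarrow> complex"
  assumes A: "finite A" and zero: "\<And>t::int. (\<Sum>\<beta>\<in>A. of_int t ^ e \<beta> * f \<beta>) = 0"
  shows "(\<Sum>\<beta>\<in>{\<beta>\<in>A. e \<beta> = n}. f \<beta>) = 0"
proof -
  define c where "c i = (\<Sum>\<beta>\<in>{\<beta>\<in>A. e \<beta> = i}. f \<beta>)" for i
  define N where "N = Max (insert n (e ` A))"
  have N: "n \<le> N" "e ` A \<subseteq> {..N}" using A by (auto simp: N_def)
  have "(\<Sum>i\<le>N. c i * of_int t ^ i) = 0" for t :: int
  proof -
    have "(\<Sum>i\<le>N. c i * of_int t ^ i) = (\<Sum>i\<le>N. \<Sum>\<beta>\<in>{\<beta>\<in>A. e \<beta> = i}. of_int t ^ e \<beta> * f \<beta>)"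
      unfolding c_def sum_distrib_right by (intro sum.cong refl) (auto simp: mult.commute)
    also have "\<dots> = (\<Sum>\<beta>\<in>A. of_int t ^ e \<beta> * f \<beta>)"
      by (rule sum.group) (use A N in auto)
    finally show ?thesis using zero by simp
  qed
  then have "range (of_int :: int \<Rightarrow> complex) \<subseteq> {z. (\<Sum>i\<le>N. c i * z ^ i) = 0}"
    by auto
  moreover have "infinite (range (of_int :: int \<Rightarrow> complex))"
    using infinite_UNIV_int by (subst finite_image_iff) (auto simp: inj_on_def)
  ultimately have "infinite {z. (\<Sum>i\<le>N. c i * z ^ i) = 0}"
    using finite_subset by blast
  then have "c n = 0" using N(1) by (auto simp: polyfun_finite_roots)
  then show ?thesis by (simp add: c_def)
qed

text \<open>
  The variables are separated one at a time: when those in \<open>J\<close> have been treated, only the monomials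
  whose exponents agree with \<open>\<beta>0\<close> on \<open>J\<close> are left.
\<close>

lemma polynomial_vanishing_on_integers:
  fixes f :: "nat^'n \<Rightarrow> complex"
  assumes F: "finite F" and zero: "\<And>\<gamma>::int^'n. (\<Sum>\<beta>\<in>F. (\<Prod>j\<in>UNIV. of_int (\<gamma> $ j) ^ (\<beta> $ j)) * f \<beta>) = 0"
    and "\<beta>0 \<in> F"
  shows "f \<beta>0 = 0"
proof -
  have partial: "(\<Sum>\<beta>\<in>{\<beta>\<in>F. \<forall>j\<in>J. \<beta> $ j = \<beta>0 $ j}. (\<Prod>j\<in>-J. of_int (\<gamma> $ j) ^ (\<beta> $ j)) * f \<beta>) = 0"
    for J and \<gamma> :: "int^'n"
    using finite[of J]
  proof (induction J arbitrary: \<gamma> rule: finite_induct)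
    case empty
    then show ?case using zero by simp
  next
    case (insert i J)
    let ?A = "{\<beta>\<in>F. \<forall>j\<in>J. \<beta> $ j = \<beta>0 $ j}"
    let ?g = "\<lambda>\<beta>. (\<Prod>j\<in>-insert i J. of_int (\<gamma> $ j) ^ (\<beta> $ j)) * f \<beta>"
    have "(\<Sum>\<beta>\<in>{\<beta>\<in>?A. \<beta> $ i = \<beta>0 $ i}. ?g \<beta>) = 0"
    proof (rule coeff_extraction)
      fix t :: int
      define \<gamma>' where "\<gamma>' = (\<chi> j. if j = i then t else \<gamma> $ j)"
      have split: "(\<Prod>j\<in>-J. of_int (\<gamma>' $ j) ^ (\<beta> $ j)) * f \<beta> = of_int t ^ (\<beta> $ i) * ?g \<beta>" for \<beta>
      proof -
        have "- J = insert i (- insert i J)" using insert.hyps by auto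
        then have "(\<Prod>j\<in>-J. of_int (\<gamma>' $ j) ^ (\<beta> $ j) :: complex)
            = of_int (\<gamma>' $ i) ^ (\<beta> $ i) * (\<Prod>j\<in>-insert i J. of_int (\<gamma>' $ j) ^ (\<beta> $ j))"
          by simp
        also have "(\<Prod>j\<in>-insert i J. of_int (\<gamma>' $ j) ^ (\<beta> $ j) :: complex)
            = (\<Prod>j\<in>-insert i J. of_int (\<gamma> $ j) ^ (\<beta> $ j))"
          by (rule prod.cong) (auto simp: \<gamma>'_def)
        finally show ?thesis by (simp add: \<gamma>'_def mult.assoc)
      qed
      show "(\<Sum>\<beta>\<in>?A. of_int t ^ (\<beta> $ i) * ?g \<beta>) = 0"
        using insert.IH[of \<gamma>'] by (simp only: split)
    qed (use F in auto)
    moreover have "{\<beta>\<in>?A. \<beta> $ i = \<beta>0 $ i} = {\<beta>\<in>F. \<forall>j\<in>insert i J. \<beta> $ j = \<beta>0 $ j}" by auto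
    ultimately show ?case by simp
  qed
  from partial[where J = UNIV] have "(\<Sum>\<beta>\<in>{\<beta>\<in>F. \<forall>j. \<beta> $ j = \<beta>0 $ j}. f \<beta>) = 0" by simp
  moreover have "{\<beta>\<in>F. \<forall>j. \<beta> $ j = \<beta>0 $ j} = {\<beta>0}" using \<open>\<beta>0 \<in> F\<close> by (auto simp: vec_eq_iff)
  ultimately show ?thesis by simp
qed

lemma delta_funpow_apply: "(delta k ^^ n) x \<gamma> = of_int (\<gamma> $ k) ^ n * x \<gamma>"
  by (induction n) (auto simp: delta_def)

lemma delta_pow_apply: "delta_pow \<beta> x \<gamma> = (\<Prod>j\<in>UNIV. of_int (\<gamma> $ j) ^ (\<beta> $ j)) * x \<gamma>"
proof -
  have "(4 :: 4) = 0" by simp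
  then have U: "(UNIV :: 4 set) = {0, 1, 2, 3}" unfolding UNIV_4 by (simp only:) blast
  have "(\<Prod>j\<in>UNIV. g j) = g 0 * (g 1 * (g 2 * g 3))" for g :: "4 \<Rightarrow> complex"
    unfolding U by simp
  then show ?thesis by (simp add: delta_pow_def delta_funpow_apply mult.assoc)
qed

lemma prod_power_axis:
  "(\<Prod>j\<in>UNIV. g j ^ (axis a n $ j)) = (g a ^ n :: 'c::comm_monoid_mult)"
proof -
  have "(\<Prod>j\<in>UNIV. g j ^ (axis a n $ j)) = (\<Prod>j\<in>UNIV. if j = a then g j ^ n else 1)"
    by (rule prod.cong) (auto simp: axis_def)
  then show ?thesis by simp
qed

lemma delta_pow_zero: "delta_pow 0 x = x"
  by (simp add: delta_pow_apply fun_eq_iff)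

lemma delta_pow_axis_1: "delta_pow (axis a 1) x = delta a x"
  by (simp add: delta_pow_apply fun_eq_iff prod_power_axis delta_def)

lemma delta_pow_axis_2: "delta_pow (axis a 2) x = delta a (delta a x)"
  by (simp add: delta_pow_apply fun_eq_iff prod_power_axis delta_def power2_eq_square mult.assoc)

lemma sum_axis: "(\<Sum>j\<in>UNIV. axis a n $ j) = (n :: nat)"
  by (simp add: axis_def)

lemma finite_degree: "finite {\<beta> :: nat^4. (\<Sum>j\<in>UNIV. \<beta> $ j) = n}"
proof (rule finite_imageD)
  have "($) ` {\<beta> :: nat^4. (\<Sum>j\<in>UNIV. \<beta> $ j) = n} \<subseteq> PiE UNIV (\<lambda>_. {..n})"
    by (auto intro!: member_le_sum)
  then show "finite (($) ` {\<beta> :: nat^4. (\<Sum>j\<in>UNIV. \<beta> $ j) = n})"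
    by (rule finite_subset) (auto intro!: finite_PiE)
  show "inj_on ($) {\<beta> :: nat^4. (\<Sum>j\<in>UNIV. \<beta> $ j) = n}"
    by (auto simp: inj_on_def vec_eq_iff)
qed

context nc_torus
begin

lemma mult_sum_left:
  "(\<And>i. i \<in> I \<Longrightarrow> f i \<in> smooth_torus) \<Longrightarrow> x \<in> smooth_torus \<Longrightarrow> sum f I \<star> x = (\<Sum>i\<in>I. f i \<star> x)"
  by (induction I rule: infinite_finite_induct) (auto simp: smooth_distrib)

lemma mult_sum_right:
  "(\<And>i. i \<in> I \<Longrightarrow> f i \<in> smooth_torus) \<Longrightarrow> x \<in> smooth_torus \<Longrightarrow> x \<star> sum f I = (\<Sum>i\<in>I. x \<star> f i)"
  by (induction I rule: infinite_finite_induct) (auto simp: smooth_distrib)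

text \<open>
  On \<open>U\<^sup>\<gamma>\<close> the operator acts as \<open>\<Sum>\<^sub>\<beta> \<gamma>\<^sup>\<beta> c\<^sub>\<beta>\<close>, a polynomial in \<open>\<gamma>\<close> for each coefficient; the phase
  introduced by the multiplication with \<open>U\<^sup>\<gamma>\<close> is common to all terms.
\<close>

lemma op_coeffs_eqI:
  assumes c: "\<And>\<beta>. c \<beta> \<in> smooth_torus" "finite {\<beta>. c \<beta> \<noteq> 0}"
    and P: "\<And>x. x \<in> smooth_torus \<Longrightarrow> P x = (\<Sum>\<beta>\<in>{\<beta>. c \<beta> \<noteq> 0}. c \<beta> \<star> delta_pow \<beta> x)"
  shows "op_coeffs P = c"
  unfolding op_coeffs_def
proof (rule the_equality)
  fix d
  assume d: "(\<forall>\<beta>. d \<beta> \<in> smooth_torus) \<and> finite {\<beta>. d \<beta> \<noteq> 0} \<and>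
     (\<forall>x\<in>smooth_torus. P x = (\<Sum>\<beta>\<in>{\<beta>. d \<beta> \<noteq> 0}. d \<beta> \<star> delta_pow \<beta> x))"
  define F where "F = {\<beta>. c \<beta> \<noteq> 0} \<union> {\<beta>. d \<beta> \<noteq> 0}"
  have F: "finite F" using c d by (simp add: F_def)
  have "d \<beta> \<alpha> - c \<beta> \<alpha> = 0" if "\<beta> \<in> F" for \<beta> \<alpha>
  proof (rule polynomial_vanishing_on_integers[OF F _ that])
    fix \<gamma> :: "int^4"
    let ?m = "\<lambda>\<beta>. (\<Prod>j\<in>UNIV. of_int (\<gamma> $ j) ^ (\<beta> $ j)) :: complex"
    have dm: "delta_pow \<beta> (monomial \<gamma>) = ?m \<beta> *\<^sub>C monomial \<gamma>" for \<beta>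
      by (auto simp: fun_eq_iff delta_pow_apply cscale_def monomial_def)
    have "P (monomial \<gamma>) = (\<Sum>\<beta>\<in>F. c \<beta> \<star> delta_pow \<beta> (monomial \<gamma>))"
      using F by (subst P) (auto simp: F_def intro!: sum.mono_neutral_left)
    moreover have "P (monomial \<gamma>) = (\<Sum>\<beta>\<in>{\<beta>. d \<beta> \<noteq> 0}. d \<beta> \<star> delta_pow \<beta> (monomial \<gamma>))"
      using d smooth_monomial[of \<gamma>] by blast
    moreover have "\<dots> = (\<Sum>\<beta>\<in>F. d \<beta> \<star> delta_pow \<beta> (monomial \<gamma>))"
      using F by (auto simp: F_def intro!: sum.mono_neutral_left)
    ultimately have "(\<Sum>\<beta>\<in>F. c \<beta> \<star> delta_pow \<beta> (monomial \<gamma>)) (\<alpha> + \<gamma>) = (\<Sum>\<beta>\<in>F. d \<beta> \<star> delta_pow \<beta> (monomial \<gamma>)) (\<alpha> + \<gamma>)"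
      by simp
    then have "cocycle \<alpha> \<gamma> * (\<Sum>\<beta>\<in>F. ?m \<beta> * c \<beta> \<alpha>) = cocycle \<alpha> \<gamma> * (\<Sum>\<beta>\<in>F. ?m \<beta> * d \<beta> \<alpha>)"
      by (simp add: sum_apply dm mult_cscale_right cscale_apply mult_monomial_apply sum_distrib_left mult_ac)
    then show "(\<Sum>\<beta>\<in>F. ?m \<beta> * (d \<beta> \<alpha> - c \<beta> \<alpha>)) = 0"
      by (simp add: right_diff_distrib sum_subtractf)
  qed
  moreover have "d \<beta> = c \<beta>" if "\<beta> \<notin> F" for \<beta> using that by (simp add: F_def)
  ultimately show "d = c" by (metis eq_iff_diff_eq_0 ext)
qed (use assms in auto)

end

text \<open>
  Taking the inverse square \<open>q\<close> of \<open>h\<close> as a parameter reduces the symbol calculus to algebra with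
  the two equations \<open>p q = 1\<close> and \<open>q p = 1\<close>.
\<close>

locale torus_laplacian = nc_torus \<theta> for \<theta> :: "real^4^4" +
  fixes h p q :: coeffs and T :: "4 \<Rightarrow> coeffs"
  assumes h_smooth [simp]: "h \<in> smooth_torus" and p_def: "p = h \<star> h"
    and q_smooth [simp]: "q \<in> smooth_torus" and pq [simp]: "p \<star> q = unit" and qp [simp]: "q \<star> p = unit"
    and T_smooth [simp]: "T a \<in> smooth_torus"
begin

lemma p_smooth [simp]: "p \<in> smooth_torus"
  by (simp add: p_def)

lemma inverse_square: "inverse_el p = q"
  by (rule inverse_el_eqI) auto

lemma cancel [simp]:
  "x \<in> smooth_torus \<Longrightarrow> p \<star> (q \<star> x) = x" "x \<in> smooth_torus \<Longrightarrow> q \<star> (p \<star> x) = x"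
  using smooth_assoc[of p q x] smooth_assoc[of q p x] by simp_all

lemma delta_inverse: "q \<star> delta a p = - (delta a q \<star> p)" "p \<star> delta a q = - (delta a p \<star> q)"
  using delta_mult[of q p a] delta_mult[of p q a] by (simp_all add: eq_neg_iff_add_eq_0 add.commute)

lemma delta_inverse_sandwich: "x \<in> smooth_torus \<Longrightarrow> q \<star> (delta a p \<star> (q \<star> x)) = - (delta a q \<star> x)"
proof -
  assume x: "x \<in> smooth_torus"
  have "q \<star> (delta a p \<star> (q \<star> x)) = (q \<star> delta a p) \<star> (q \<star> x)"
    using x by (simp add: smooth_assoc)
  also have "\<dots> = - (delta a q \<star> x)" using x by (simp add: delta_inverse mult_minus_left smooth_assoc)
  finally show ?thesis .
qed

definition first_order :: "4 \<Rightarrow> coeffs" where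
  "first_order a = T a + delta a q"

definition zeroth_order :: coeffs where
  "zeroth_order = (\<Sum>a\<in>UNIV. delta a (delta a q) + q \<star> (delta a p \<star> delta a q) + (1/2) *\<^sub>C delta a (T a))"

lemma first_order_smooth [simp]: "first_order a \<in> smooth_torus"
  by (simp add: first_order_def)

lemma zeroth_order_smooth [simp]: "zeroth_order \<in> smooth_torus"
  unfolding zeroth_order_def by (intro smooth_sum smooth_add) auto

text \<open>
  The Leibniz rule; the two first order terms \<open>2 \<delta>\<^sub>a q\<close> and \<open>q \<delta>\<^sub>a(p) q = - \<delta>\<^sub>a q\<close> combine to \<open>\<delta>\<^sub>a q\<close>.
\<close>

lemma laplace_type_expansion:
  assumes x: "x \<in> smooth_torus"
  shows "laplace_type h T x =
    zeroth_order \<star> x + (\<Sum>a\<in>UNIV. first_order a \<star> delta a x) + (\<Sum>a\<in>UNIV. q \<star> delta a (delta a x))"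
proof -
  have summand: "q \<star> delta a (p \<star> delta a (q \<star> x)) + (T a \<star> delta a x + (1/2) *\<^sub>C delta a (T a) \<star> x)
    = (delta a (delta a q) + q \<star> (delta a p \<star> delta a q) + (1/2) *\<^sub>C delta a (T a)) \<star> x
      + first_order a \<star> delta a x + q \<star> delta a (delta a x)" for a
    using x
    by (simp add: first_order_def delta_mult delta_linear torus_algebra delta_inverse_sandwich)
  show ?thesis
    unfolding laplace_type_def naive_laplacian_def Let_def inverse_square p_def[symmetric]
      zeroth_order_def
    using x by (simp add: mult_sum_left summand flip: sum.distrib)
qed

definition laplacian_coeffs :: "nat^4 \<Rightarrow> coeffs" where
  "laplacian_coeffs \<beta> = (if \<beta> = 0 then zeroth_order else 0)
     + (\<Sum>a\<in>UNIV. if \<beta> = axis a 1 then first_order a else 0)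
     + (\<Sum>a\<in>UNIV. if \<beta> = axis a 2 then q else 0)"

text \<open>
  Both the operator and its symbol are sums over multi-indices of an expression that is additive in
  the coefficient; only the multi-indices \<open>0\<close>, \<open>e\<^sub>a\<close> and \<open>2 e\<^sub>a\<close> contribute.
\<close>

lemma sum_laplacian_coeffs:
  assumes F: "finite F" and f: "\<And>\<beta>. f \<beta> 0 = 0"
    "\<And>\<beta> a b. a \<in> smooth_torus \<Longrightarrow> b \<in> smooth_torus \<Longrightarrow> f \<beta> (a + b) = f \<beta> a + f \<beta> b"
  shows "(\<Sum>\<beta>\<in>F. f \<beta> (laplacian_coeffs \<beta>)) = (if 0 \<in> F then f 0 zeroth_order else 0)
     + (\<Sum>a\<in>UNIV. if axis a 1 \<in> F then f (axis a 1) (first_order a) else 0)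
     + (\<Sum>a\<in>UNIV. if axis a 2 \<in> F then f (axis a 2) q else (0 :: coeffs))"
proof -
  have fs: "f \<beta> (\<Sum>a\<in>I. g a) = (\<Sum>a\<in>I. f \<beta> (g a))" if "\<And>a. g a \<in> smooth_torus" for \<beta> g and I :: "4 set"
    by (induction I rule: infinite_finite_induct) 
      (simp_all only: sum.infinite sum.empty sum.insert f smooth_sum that simp_thms)
  have ind: "f \<beta> (if P then a else 0) = (if P then f \<beta> a else 0)" for \<beta> P a by (simp add: f)
  have "(\<Sum>\<beta>\<in>F. f \<beta> (laplacian_coeffs \<beta>)) =
      (\<Sum>\<beta>\<in>F. (if \<beta> = 0 then f \<beta> zeroth_order else 0)
       + (\<Sum>a\<in>UNIV. if \<beta> = axis a 1 then f \<beta> (first_order a) else 0)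
       + (\<Sum>a\<in>UNIV. if \<beta> = axis a 2 then f \<beta> q else 0))"
    by (simp add: laplacian_coeffs_def f fs ind)
  also have "\<dots> = (\<Sum>\<beta>\<in>F. if \<beta> = 0 then f \<beta> zeroth_order else 0)
       + (\<Sum>a\<in>UNIV. \<Sum>\<beta>\<in>F. if \<beta> = axis a 1 then f \<beta> (first_order a) else 0)
       + (\<Sum>a\<in>UNIV. \<Sum>\<beta>\<in>F. if \<beta> = axis a 2 then f \<beta> q else 0)"
    by (simp only: sum.distrib sum.swap[of _ F UNIV])
  finally show ?thesis using F by (simp add: sum.delta cong: if_cong)
qed

lemma laplacian_coeffs_smooth [simp]: "laplacian_coeffs \<beta> \<in> smooth_torus"
  unfolding laplacian_coeffs_def by (intro smooth_add smooth_sum) auto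

lemma op_coeffs_laplacian: "op_coeffs (laplace_type h T) = laplacian_coeffs"
proof (rule op_coeffs_eqI)
  let ?F = "insert 0 (range (\<lambda>a. axis a 1) \<union> range (\<lambda>a. axis a 2)) :: (nat^4) set"
  have sub: "{\<beta>. laplacian_coeffs \<beta> \<noteq> 0} \<subseteq> ?F"
  proof (rule ccontr)
    assume "\<not> ?thesis"
    then obtain \<beta> where \<beta>: "laplacian_coeffs \<beta> \<noteq> 0" "\<beta> \<notin> ?F" by blast
    have "(\<Sum>a\<in>UNIV. if \<beta> = axis a 1 then first_order a else 0) = 0"
      "(\<Sum>a\<in>UNIV. if \<beta> = axis a 2 then q else 0) = 0"
      using \<beta>(2) by (intro sum.neutral; auto)+
    then have "laplacian_coeffs \<beta> = 0"
      using \<beta>(2) by (simp add: laplacian_coeffs_def)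
    with \<beta> show False by simp
  qed
  show fin: "finite {\<beta>. laplacian_coeffs \<beta> \<noteq> 0}" by (rule finite_subset[OF sub]) simp
  fix x assume x: "x \<in> smooth_torus"
  have dp: "delta_pow \<beta> x \<in> smooth_torus" for \<beta>
  proof -
    have "(delta k ^^ n) y \<in> smooth_torus" if "y \<in> smooth_torus" for k n y
      using that by (induction n) auto
    then show ?thesis using x by (simp add: delta_pow_def)
  qed
  have "(\<Sum>\<beta>\<in>{\<beta>. laplacian_coeffs \<beta> \<noteq> 0}. laplacian_coeffs \<beta> \<star> delta_pow \<beta> x)
      = (\<Sum>\<beta>\<in>?F. laplacian_coeffs \<beta> \<star> delta_pow \<beta> x)"
    using sub by (intro sum.mono_neutral_left) auto
  also have "\<dots> = laplace_type h T x"
    by (subst sum_laplacian_coeffs)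
      (use x dp in \<open>simp_all add: smooth_distrib laplace_type_expansion delta_pow_zero
        delta_pow_axis_1[unfolded One_nat_def] delta_pow_axis_2\<close>)
  finally show "laplace_type h T x
      = (\<Sum>\<beta>\<in>{\<beta>. laplacian_coeffs \<beta> \<noteq> 0}. laplacian_coeffs \<beta> \<star> delta_pow \<beta> x)" ..
qed simp

lemma symbol_part_laplacian:
  "symbol_part (laplace_type h T) 2 \<xi> = complex_of_real ((norm \<xi>)\<^sup>2) *\<^sub>C q"
  "symbol_part (laplace_type h T) 1 \<xi> = (\<Sum>a\<in>UNIV. complex_of_real (\<xi> $ a) *\<^sub>C first_order a)"
  "symbol_part (laplace_type h T) 0 \<xi> = zeroth_order"
proof -
  have eq: "symbol_part (laplace_type h T) n \<xi> =
     (if n = 0 then zeroth_order else 0)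
     + (\<Sum>a\<in>UNIV. if n = 1 then complex_of_real (\<xi> $ a) *\<^sub>C first_order a else 0)
     + (\<Sum>a\<in>UNIV. if n = 2 then complex_of_real ((\<xi> $ a)\<^sup>2) *\<^sub>C q else 0)" for n
    unfolding symbol_part_def op_coeffs_laplacian
    by (subst sum_laplacian_coeffs[OF finite_degree])
      (auto simp: cscale_add_right sum_axis prod_power_axis[where n = "Suc 0"]
        prod_power_axis[where n = 2] eq_commute[of _ n] simp del: of_real_prod
        intro!: arg_cong2[where f = "(+)"] sum.cong)
  have "(norm \<xi>)\<^sup>2 = (\<Sum>a\<in>UNIV. (\<xi> $ a)\<^sup>2)"
    unfolding power2_norm_eq_inner inner_vec_def by (simp add: power2_eq_square)
  then have "complex_of_real ((norm \<xi>)\<^sup>2) *\<^sub>C q = (\<Sum>a\<in>UNIV. complex_of_real ((\<xi> $ a)\<^sup>2) *\<^sub>C q)"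
    by (simp add: fun_eq_iff sum_apply cscale_def sum_distrib_right)
  then show "symbol_part (laplace_type h T) 2 \<xi> = complex_of_real ((norm \<xi>)\<^sup>2) *\<^sub>C q"
    by (simp add: eq)
  show "symbol_part (laplace_type h T) 1 \<xi> = (\<Sum>a\<in>UNIV. complex_of_real (\<xi> $ a) *\<^sub>C first_order a)"
    "symbol_part (laplace_type h T) 0 \<xi> = zeroth_order"
    by (simp_all add: eq)
qed

end

section \<open>Quadratic moments of the three-sphere\<close>

lemma lborel_distr_orthogonal:
  fixes g :: "(real, 'n::{finite,wellorder}) vec \<Rightarrow> (real, 'n) vec"
  assumes g: "orthogonal_transformation g"
  shows "distr lborel borel g = lborel"
proof (rule lborel_eqI[symmetric])
  have meas: "g \<in> borel_measurable borel"
    using g by (intro borel_measurable_continuous_onI linear_continuous_on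
        linear_conv_bounded_linear[THEN iffD1] orthogonal_transformation_linear)
  fix l u :: "(real, 'n) vec"
  assume le: "\<And>b. b \<in> Basis \<Longrightarrow> l \<bullet> b \<le> u \<bullet> b"
  have inv: "orthogonal_transformation (inv g)" by (rule orthogonal_transformation_inv[OF g])
  have pre: "g -` box l u = inv g ` box l u"
    using orthogonal_transformation_bij[OF g] by (simp add: bij_vimage_eq_inv_image)
  have borel: "g -` box l u \<in> sets borel"
    using measurable_sets[OF meas, of "box l u"] by simp
  have fm: "box l u \<in> lmeasurable" by simp
  have "emeasure (distr lborel borel g) (box l u) = emeasure lborel (g -` box l u)"
    using meas by (simp add: emeasure_distr)
  also have "\<dots> = emeasure lebesgue (g -` box l u)"
    using borel by simp
  also have "\<dots> = ennreal (measure lebesgue (inv g ` box l u))"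
    unfolding pre by (rule emeasure_eq_measure2[OF measurable_orthogonal_image[OF inv fm]])
  also have "\<dots> = ennreal (measure lebesgue (box l u))"
    by (simp only: measure_orthogonal_image[OF inv fm])
  also have "\<dots> = (\<Prod>b\<in>Basis. (u - l) \<bullet> b)"
    using le by (simp add: emeasure_lborel_box flip: emeasure_eq_measure2[OF fm])
  finally show "emeasure (distr lborel borel g) (box l u) = (\<Prod>b\<in>Basis. (u - l) \<bullet> b)" .
qed simp

lemma space_sphere_measure [simp]: "space sphere_measure = sphere 0 1"
  by (simp add: sphere_measure_def space_scale_measure space_restrict_space)

lemma sets_sphere_measure [measurable_cong, simp]:
  "sets sphere_measure = sets (restrict_space borel (sphere 0 1))"
  by (simp add: sphere_measure_def)

lemma emeasure_sphere_measure_cone: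
  fixes E :: "'a::euclidean_space set"
  assumes E: "E \<in> sets sphere_measure"
  shows "emeasure sphere_measure E
    = of_nat DIM('a) * emeasure lborel {x \<in> cball 0 1 - {0}. x /\<^sub>R norm x \<in> E}"
proof -
  let ?B = "cball 0 1 - {0} :: 'a set"
  let ?f = "\<lambda>x :: 'a. x /\<^sub>R norm x"
  have meas: "?f \<in> measurable (restrict_space lborel ?B) (restrict_space borel (sphere 0 1))"
  proof (rule measurable_restrict_space2)
    show "?f \<in> space (restrict_space lborel ?B) \<rightarrow> sphere 0 1" by (auto simp: space_restrict_space)
    show "?f \<in> borel_measurable (restrict_space lborel ?B)"
      by (intro measurable_restrict_space1) measurable
  qed
  have eq: "?f -` E \<inter> space (restrict_space lborel ?B) = {x \<in> ?B. ?f x \<in> E}"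
    by (auto simp: space_restrict_space)
  have B: "?B \<in> sets borel" by simp
  have E': "E \<in> sets (restrict_space borel (sphere 0 1))" using E by simp
  have "emeasure sphere_measure E = of_nat DIM('a) * emeasure (restrict_space lborel ?B) {x \<in> ?B. ?f x \<in> E}"
    unfolding sphere_measure_def emeasure_scale_measure emeasure_distr[OF meas E'] eq ..
  also have "emeasure (restrict_space lborel ?B) {x \<in> ?B. ?f x \<in> E} = emeasure lborel {x \<in> ?B. ?f x \<in> E}"
    by (rule emeasure_restrict_space) (use B in auto)
  finally show ?thesis .
qed

text \<open>
  An orthogonal map commutes with the radial projection onto the sphere, so it carries the cone over
  a preimage onto the cone over the set, and it preserves Lebesgue measure.
\<close>

lemma sphere_measure_orthogonal:
  fixes g :: "(real, 'n::{finite,wellorder}) vec \<Rightarrow> (real, 'n) vec"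
  assumes g: "orthogonal_transformation g"
  shows "g \<in> measurable sphere_measure sphere_measure"
    and "distr sphere_measure sphere_measure g = sphere_measure"
proof -
  have lin: "linear g" and nrm: "norm (g x) = norm x" for x
    using g by (auto simp: orthogonal_transformation_linear orthogonal_transformation_norm)
  have meas: "g \<in> borel_measurable borel"
    using lin by (intro borel_measurable_continuous_onI linear_continuous_on
        linear_conv_bounded_linear[THEN iffD1])
  show m: "g \<in> measurable sphere_measure sphere_measure"
    unfolding measurable_cong_sets[OF sets_sphere_measure sets_sphere_measure]
    by (rule measurable_restrict_space3[OF meas]) (auto simp: nrm)
  show "distr sphere_measure sphere_measure g = sphere_measure"
  proof (rule measure_eqI)
    fix E assume "E \<in> sets (distr sphere_measure sphere_measure g)"
    then have E: "E \<in> sets sphere_measure" by simp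
    let ?C = "\<lambda>E. {x :: (real, 'n) vec. x \<in> cball 0 1 - {0} \<and> x /\<^sub>R norm x \<in> E}"
    have Eb: "E \<in> sets borel" using E by (auto simp: sets_restrict_space)
    have E1: "E \<subseteq> sphere 0 1" using sets.sets_into_space[OF E] by simp
    have C: "?C E \<in> sets borel"
    proof -
      have "(\<lambda>x :: (real, 'n) vec. x /\<^sub>R norm x) \<in> borel_measurable borel" by measurable
      from measurable_sets[OF this Eb] have "(\<lambda>x. x /\<^sub>R norm x) -` E \<in> sets borel" by simp
      then have "(cball 0 1 - {0}) \<inter> (\<lambda>x. x /\<^sub>R norm x) -` E \<in> sets borel"
        by (intro sets.Int) auto
      moreover have "(cball 0 1 - {0}) \<inter> (\<lambda>x. x /\<^sub>R norm x) -` E = ?C E" by auto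
      ultimately show ?thesis by simp
    qed
    have "emeasure (distr sphere_measure sphere_measure g) E
        = emeasure sphere_measure (g -` E \<inter> sphere 0 1)"
      using m E by (simp add: emeasure_distr)
    also have "\<dots> = of_nat DIM((real, 'n) vec) * emeasure lborel (?C (g -` E \<inter> sphere 0 1))"
      using measurable_sets[OF m E] by (subst emeasure_sphere_measure_cone) auto
    also have "?C (g -` E \<inter> sphere 0 1) = g -` ?C E"
    proof -
      have "g x = 0 \<longleftrightarrow> x = 0" for x by (metis norm_eq_zero nrm)
      moreover have "g (x /\<^sub>R norm x) = g x /\<^sub>R norm (g x)" for x
        by (simp only: nrm linear_scale[OF lin])
      moreover have "x /\<^sub>R norm x \<in> sphere 0 1" if "x \<noteq> 0" for x :: "(real, 'n) vec"
        using that by simp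
      ultimately show ?thesis
        unfolding set_eq_iff vimage_def mem_Collect_eq Int_iff mem_cball_0 Diff_iff singleton_iff
        by (metis nrm)
    qed
    also have "emeasure lborel (g -` ?C E) = emeasure (distr lborel borel g) (?C E)"
      using meas C by (simp add: emeasure_distr)
    also have "\<dots> = emeasure lborel (?C E)"
      by (simp add: lborel_distr_orthogonal[OF g])
    also have "of_nat DIM((real, 'n) vec) * \<dots> = emeasure sphere_measure E"
      by (rule emeasure_sphere_measure_cone[OF E, symmetric])
    finally show "emeasure (distr sphere_measure sphere_measure g) E = emeasure sphere_measure E" .
  qed simp
qed

text \<open>
  The rotation by a right angle in the coordinate plane of \<open>j\<close> and \<open>k\<close>. It sends \<open>\<xi>\<^sub>j \<xi>\<^sub>k\<close> to its
  negative and exchanges \<open>\<xi>\<^sub>j\<^sup>2\<close> with \<open>\<xi>\<^sub>k\<^sup>2\<close>, which determines all quadratic moments up to the total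
  mass.
\<close>

definition quarter_turn :: "'n \<Rightarrow> 'n \<Rightarrow> real^'n \<Rightarrow> real^'n" where
  "quarter_turn j k x = (\<chi> i. if i = j then x $ k else if i = k then - (x $ j) else x $ i)"

lemma orthogonal_quarter_turn:
  assumes "j \<noteq> k" shows "orthogonal_transformation (quarter_turn j k)"
  unfolding orthogonal_transformation_def
proof
  show "linear (quarter_turn j k)"
    by (rule linearI) (auto simp: quarter_turn_def vec_eq_iff)
  show "\<forall>v w. quarter_turn j k v \<bullet> quarter_turn j k w = v \<bullet> w"
  proof (intro allI)
    fix v w :: "real^'a"
    have split: "(\<Sum>i\<in>UNIV. f i) = f j + (f k + (\<Sum>i\<in>UNIV - {j} - {k}. f i))" for f :: "'a \<Rightarrow> real"
      using assms by (subst sum.remove[of _ j], simp, simp, subst sum.remove[of _ k]) auto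
    have "(\<Sum>i\<in>UNIV - {j} - {k}. quarter_turn j k v $ i * quarter_turn j k w $ i)
        = (\<Sum>i\<in>UNIV - {j} - {k}. v $ i * w $ i)"
      by (rule sum.cong) (auto simp: quarter_turn_def)
    then show "quarter_turn j k v \<bullet> quarter_turn j k w = v \<bullet> w"
      using assms by (simp add: inner_vec_def split) (simp add: quarter_turn_def)
  qed
qed

lemma finite_sphere_measure: "finite_measure (sphere_measure :: (real^4) measure)"
  by (rule finite_measureI) (simp add: emeasure_sphere_measure)

lemma measure_sphere: "measure (sphere_measure :: (real^4) measure) (sphere 0 1) = 2 * pi\<^sup>2"
  by (simp add: measure_def emeasure_sphere_measure)

lemma component_sphere_measurable [measurable]:
  "(\<lambda>\<xi>::real^4. \<xi> $ j) \<in> borel_measurable sphere_measure"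
  unfolding measurable_cong_sets[OF sets_sphere_measure refl]
  by (intro measurable_restrict_space1 borel_measurable_continuous_onI continuous_intros)

lemma integrable_sphere_quadratic:
  "integrable sphere_measure (\<lambda>\<xi>::real^4. \<xi> $ j * \<xi> $ k)"
proof -
  interpret finite_measure "sphere_measure :: (real^4) measure" by (rule finite_sphere_measure)
  show ?thesis
  proof (rule integrable_const_bound[where B = 1])
    have "norm (\<xi> $ j * \<xi> $ k) \<le> 1" if "\<xi> \<in> sphere 0 1" for \<xi> :: "real^4"
      using component_le_norm_cart[of \<xi> j] component_le_norm_cart[of \<xi> k] that
      by (simp add: abs_mult mult_le_one)
    then show "AE \<xi>::real^4 in sphere_measure. norm (\<xi> $ j * \<xi> $ k) \<le> 1"
      by (intro AE_I2) simp
  qed measurable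
qed

lemma sphere_quadratic_moments:
  "(\<integral>\<xi>. \<xi> $ j * \<xi> $ k \<partial>(sphere_measure :: (real^4) measure)) = (if j = k then pi\<^sup>2 / 2 else 0)"
proof -
  define I where "I j k = (\<integral>\<xi>. \<xi> $ j * \<xi> $ k \<partial>(sphere_measure :: (real^4) measure))" for j k
  have turn: "I a b = (\<integral>\<xi>. quarter_turn j k \<xi> $ a * quarter_turn j k \<xi> $ b
      \<partial>(sphere_measure :: (real^4) measure))" if "j \<noteq> k" for a b j k
    unfolding I_def
    by (subst sphere_measure_orthogonal(2)[OF orthogonal_quarter_turn[OF that], symmetric],
        subst integral_distr[OF sphere_measure_orthogonal(1)[OF orthogonal_quarter_turn[OF that]]])
      simp_all
  have off: "I j k = 0" if "j \<noteq> k" for j k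
  proof -
    have "I j k = (\<integral>\<xi>. - (\<xi> $ j * \<xi> $ k) \<partial>(sphere_measure :: (real^4) measure))"
      using that by (subst turn[OF that]) (simp add: quarter_turn_def mult.commute)
    then show ?thesis by (simp add: I_def)
  qed
  have diag: "I j j = I k k" for j k
  proof (cases "j = k")
    case False
    then show ?thesis by (subst turn[OF False]) (simp add: quarter_turn_def I_def)
  qed simp
  have "4 * I j j = (\<Sum>k\<in>(UNIV :: 4 set). I j j)" by simp
  also have "\<dots> = (\<Sum>k\<in>UNIV. I k k)"
    by (rule sum.cong[OF refl]) (rule diag)
  also have "\<dots> = (\<integral>\<xi>. (\<Sum>k\<in>UNIV. \<xi> $ k * \<xi> $ k) \<partial>(sphere_measure :: (real^4) measure))"
    unfolding I_def by (rule Bochner_Integration.integral_sum[symmetric]) (rule integrable_sphere_quadratic)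
  also have "\<dots> = (\<integral>\<xi>. 1 \<partial>(sphere_measure :: (real^4) measure))"
  proof (rule Bochner_Integration.integral_cong)
    fix \<xi> :: "real^4" assume "\<xi> \<in> space sphere_measure"
    then have "\<xi> \<bullet> \<xi> = 1" by (simp flip: power2_norm_eq_inner)
    then show "(\<Sum>k\<in>UNIV. \<xi> $ k * \<xi> $ k) = 1" by (simp add: inner_vec_def)
  qed simp
  also have "\<dots> = 2 * pi\<^sup>2" by (simp add: measure_sphere)
  finally show ?thesis using off[of j k] by (auto simp: I_def)
qed

section \<open>Derivatives of the parametrix symbol\<close>

text \<open>
  Every homogeneous part of the parametrix symbol is a finite sum of scalar functions times fixed
  elements of the algebra. A formula away from the origin is enough, since the punctured space is
  open.
\<close>

lemma pderiv_xi_sum: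
  assumes \<xi>: "\<xi> \<noteq> 0" and f: "\<And>\<eta>. \<eta> \<noteq> 0 \<Longrightarrow> f \<eta> = (\<Sum>i\<in>I. complex_of_real (g i \<eta>) *\<^sub>C A i)"
    and g: "\<And>i. i \<in> I \<Longrightarrow> ((\<lambda>t. g i (\<xi> + t *\<^sub>R axis k 1)) has_real_derivative g' i) (at 0)"
  shows "pderiv_xi k f \<xi> = (\<Sum>i\<in>I. complex_of_real (g' i) *\<^sub>C A i)"
proof
  fix \<beta>
  let ?line = "\<lambda>t. \<xi> + t *\<^sub>R axis k 1"
  have op: "open {t. ?line t \<noteq> 0}"
    by (intro open_Collect_neq continuous_intros)
  have "((\<lambda>t. complex_of_real (g i (?line t))) has_vector_derivative complex_of_real (g' i)) (at 0)"
    if "i \<in> I" for i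
    using has_vector_derivative_of_real[OF g[OF that]] by simp
  then have "((\<lambda>t. \<Sum>i\<in>I. complex_of_real (g i (?line t)) * A i \<beta>) has_vector_derivative
      (\<Sum>i\<in>I. complex_of_real (g' i) * A i \<beta>)) (at 0)"
    by (intro has_vector_derivative_sum has_vector_derivative_mult_left)
  then have "((\<lambda>t. f (?line t) \<beta>) has_vector_derivative (\<Sum>i\<in>I. complex_of_real (g' i) * A i \<beta>)) (at 0)"
    by (rule has_vector_derivative_transform_within_open[OF _ op])
      (use \<xi> in \<open>auto simp: f sum_apply cscale_apply\<close>)
  then show "pderiv_xi k f \<xi> \<beta> = (\<Sum>i\<in>I. complex_of_real (g' i) *\<^sub>C A i) \<beta>"
    unfolding pderiv_xi_def by (simp add: vector_derivative_at sum_apply cscale_apply)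
qed

lemma pderiv_xi_cong:
  assumes "\<xi> \<noteq> 0" and "\<And>\<eta>. \<eta> \<noteq> 0 \<Longrightarrow> f \<eta> = g \<eta>"
  shows "pderiv_xi k f \<xi> = pderiv_xi k g \<xi>"
proof -
  have "\<forall>\<^sub>F t in nhds 0. \<xi> + t *\<^sub>R axis k 1 \<noteq> 0"
  proof (rule eventually_nhds_in_open[of "{t. \<xi> + t *\<^sub>R axis k 1 \<noteq> 0}" 0, simplified])
    show "open {t. \<xi> + t *\<^sub>R axis k 1 \<noteq> 0}" by (intro open_Collect_neq continuous_intros)
  qed (use assms in simp)
  then have "\<forall>\<^sub>F t in nhds 0. f (\<xi> + t *\<^sub>R axis k 1) \<beta> = g (\<xi> + t *\<^sub>R axis k 1) \<beta>" for \<beta>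
    by (rule eventually_mono) (simp add: assms)
  then show ?thesis
    unfolding pderiv_xi_def
    by (intro ext vector_derivative_cong_eq) (use assms in auto)
qed

lemma square_norm_derivative:
  "((\<lambda>t. (\<xi> + t *\<^sub>R axis k 1) \<bullet> (\<xi> + t *\<^sub>R axis k 1)) has_real_derivative 2 * \<xi> $ k) (at 0)"
  for \<xi> :: "real^'n"
proof -
  have "((\<lambda>t. \<xi> \<bullet> \<xi> + t * (2 * \<xi> $ k) + t * t) has_real_derivative 2 * \<xi> $ k) (at 0)"
    by (auto intro!: derivative_eq_intros)
  moreover have "(\<xi> + t *\<^sub>R axis k 1) \<bullet> (\<xi> + t *\<^sub>R axis k 1) = \<xi> \<bullet> \<xi> + t * (2 * \<xi> $ k) + t * t" for t
    by (simp add: inner_add_left inner_add_right inner_axis inner_axis' algebra_simps)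
  ultimately show ?thesis by simp
qed

lemma axis_other: "a \<noteq> k \<Longrightarrow> axis k x $ a = 0"
  by (simp add: axis_def)

lemma component_derivative:
  "((\<lambda>t. (\<xi> + t *\<^sub>R axis k 1) $ j) has_real_derivative (if j = k then 1 else 0)) (at 0)"
  for \<xi> :: "real^'n"
  by (auto simp: axis_def intro!: derivative_eq_intros)

context torus_laplacian
begin

text \<open>
  In \<open>b\<^sub>1\<close> the term with \<open>\<partial>\<^sub>\<xi> b\<^sub>0\<close> reverses the sign of \<open>\<delta>\<^sub>a q\<close> in the first order coefficient
  \<open>T\<^sub>a + \<delta>\<^sub>a q\<close>.
\<close>

definition reflected_first_order :: "4 \<Rightarrow> coeffs" where
  "reflected_first_order a = T a - delta a q"

text \<open>
  The coefficients \<open>Z\<^sub>a\<close> of \<open>- b\<^sub>1 = |\<xi>|\<^sup>-\<^sup>4 \<Sum>\<^sub>a \<xi>\<^sub>a Z\<^sub>a\<close>.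
\<close>

definition sandwich :: "4 \<Rightarrow> coeffs" where
  "sandwich a = p \<star> (reflected_first_order a \<star> p)"

definition isotropic_part :: coeffs where
  "isotropic_part = - (p \<star> (zeroth_order \<star> p)) + (\<Sum>k\<in>UNIV. sandwich k \<star> (delta k q \<star> p))
     + (\<Sum>k\<in>UNIV. p \<star> (delta k (delta k q) \<star> p))"

definition quadratic_part :: "4 \<Rightarrow> 4 \<Rightarrow> coeffs" where
  "quadratic_part j k = sandwich j \<star> (first_order k \<star> p) + 2 *\<^sub>C (p \<star> (delta j (first_order k) \<star> p))
     - 4 *\<^sub>C (sandwich j \<star> (delta k q \<star> p)) - 4 *\<^sub>C (p \<star> (delta k (delta j q) \<star> p))"

text \<open>
  The solution of the parametrix equations; the value \<open>1 / 0 = 0\<close> at the origin is arbitrary.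
\<close>

definition parametrix :: "nat \<Rightarrow> real^4 \<Rightarrow> coeffs" where
  "parametrix n \<xi> = (if n = 0 then complex_of_real (1 / (\<xi> \<bullet> \<xi>)) *\<^sub>C p
     else if n = 1 then \<Sum>a\<in>UNIV. complex_of_real (- (\<xi> $ a / (\<xi> \<bullet> \<xi>)\<^sup>2)) *\<^sub>C sandwich a
     else complex_of_real (1 / (\<xi> \<bullet> \<xi>)\<^sup>2) *\<^sub>C isotropic_part
       + (\<Sum>j\<in>UNIV. \<Sum>k\<in>UNIV. complex_of_real (\<xi> $ j * \<xi> $ k / (\<xi> \<bullet> \<xi>) ^ 3) *\<^sub>C quadratic_part j k))"

lemma smooth_parts [simp]:
  "reflected_first_order a \<in> smooth_torus" "sandwich a \<in> smooth_torus" "isotropic_part \<in> smooth_torus"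
  "quadratic_part j k \<in> smooth_torus"
  by (simp_all add: reflected_first_order_def sandwich_def isotropic_part_def quadratic_part_def)

lemma smooth_parametrix [simp]: "parametrix n \<xi> \<in> smooth_torus"
  by (simp add: parametrix_def)

lemma parametrix_homogeneous:
  assumes "0 < t"
  shows "n = 0 \<or> n = 1 \<or> n = 2 \<Longrightarrow>
    parametrix n (t *\<^sub>R \<xi>) = complex_of_real (t powi (- 2 - int n)) *\<^sub>C parametrix n \<xi>"
proof (elim disjE)
  assume n: "n = 0"
  have "t powi (- 2) = 1 / t\<^sup>2" using assms by (simp add: power_int_minus field_simps)
  then show ?thesis using assms by (simp add: parametrix_def n power2_eq_square mult.assoc)
next
  assume n: "n = 1"
  have "t powi (- 3) = 1 / t ^ 3" using assms by (simp add: power_int_minus field_simps)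
  moreover have "t * a / (t * (t * c))\<^sup>2 = (1 / t ^ 3) * (a / c\<^sup>2)" for a c
    using assms by (simp add: power2_eq_square power3_eq_cube)
  ultimately show ?thesis
    by (simp add: parametrix_def n cscale_sum_right del: of_real_divide of_real_mult of_real_power
        flip: of_real_mult)
next
  assume n: "n = 2"
  have "t powi (- 4) = 1 / t ^ 4" using assms by (simp add: power_int_minus field_simps)
  moreover have "1 / (t * (t * c))\<^sup>2 = (1 / t ^ 4) * (1 / c\<^sup>2)" for c
    using assms by (simp add: power2_eq_square power4_eq_xxxx)
  moreover have "t * a * (t * b) / (t * (t * c)) ^ 3 = (1 / t ^ 4) * (a * b / c ^ 3)" for a b c
    using assms by (simp add: power3_eq_cube power4_eq_xxxx)
  ultimately show ?thesis
    by (simp add: parametrix_def n cscale_sum_right cscale_add_right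
        del: of_real_divide of_real_mult of_real_power flip: of_real_mult)
qed

lemma pderiv_parametrix_0:
  assumes "\<xi> \<noteq> 0"
  shows "pderiv_xi k (parametrix 0) \<xi> = complex_of_real (- (2 * \<xi> $ k / (\<xi> \<bullet> \<xi>)\<^sup>2)) *\<^sub>C p"
proof -
  have "pderiv_xi k (parametrix 0) \<xi> = (\<Sum>i\<in>{()}. complex_of_real (- (2 * \<xi> $ k / (\<xi> \<bullet> \<xi>)\<^sup>2)) *\<^sub>C p)"
  proof (rule pderiv_xi_sum[OF assms])
    show "parametrix 0 \<eta> = (\<Sum>i\<in>{()}. complex_of_real (1 / (\<eta> \<bullet> \<eta>)) *\<^sub>C p)" for \<eta>
      by (simp add: parametrix_def)
    show "((\<lambda>t. 1 / ((\<xi> + t *\<^sub>R axis k 1) \<bullet> (\<xi> + t *\<^sub>R axis k 1)))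
        has_real_derivative - (2 * \<xi> $ k / (\<xi> \<bullet> \<xi>)\<^sup>2)) (at 0)"
      using assms
      by (auto intro!: derivative_eq_intros square_norm_derivative simp: power2_eq_square)
  qed
  then show ?thesis by simp
qed

lemma pderiv_pderiv_parametrix_0:
  assumes "\<xi> \<noteq> 0"
  shows "pderiv_xi k (pderiv_xi j (parametrix 0)) \<xi>
    = complex_of_real (8 * \<xi> $ j * \<xi> $ k / (\<xi> \<bullet> \<xi>) ^ 3 - (if j = k then 2 / (\<xi> \<bullet> \<xi>)\<^sup>2 else 0)) *\<^sub>C p"
    (is "_ = complex_of_real ?d *\<^sub>C p")
proof -
  have "pderiv_xi k (pderiv_xi j (parametrix 0)) \<xi> = (\<Sum>i\<in>{()}. complex_of_real ?d *\<^sub>C p)"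
  proof (rule pderiv_xi_sum[OF assms])
    show "pderiv_xi j (parametrix 0) \<eta> = (\<Sum>i\<in>{()}. complex_of_real (- (2 * \<eta> $ j / (\<eta> \<bullet> \<eta>)\<^sup>2)) *\<^sub>C p)"
      if "\<eta> \<noteq> 0" for \<eta>
      by (simp only: pderiv_parametrix_0[OF that]) simp
    show "((\<lambda>t. - (2 * (\<xi> + t *\<^sub>R axis k 1) $ j / ((\<xi> + t *\<^sub>R axis k 1) \<bullet> (\<xi> + t *\<^sub>R axis k 1))\<^sup>2))
        has_real_derivative ?d) (at 0)"
      using assms
      by (auto intro!: derivative_eq_intros square_norm_derivative component_derivative
          simp: field_simps power2_eq_square power3_eq_cube axis_other)
  qed
  then show ?thesis by simp
qed

lemma pderiv_parametrix_1:
  assumes "\<xi> \<noteq> 0"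
  shows "pderiv_xi k (parametrix 1) \<xi>
    = (\<Sum>a\<in>UNIV. complex_of_real (4 * \<xi> $ a * \<xi> $ k / (\<xi> \<bullet> \<xi>) ^ 3 - (if a = k then 1 / (\<xi> \<bullet> \<xi>)\<^sup>2 else 0)) *\<^sub>C sandwich a)"
proof (rule pderiv_xi_sum[OF assms])
  show "parametrix 1 \<eta> = (\<Sum>a\<in>UNIV. complex_of_real (- (\<eta> $ a / (\<eta> \<bullet> \<eta>)\<^sup>2)) *\<^sub>C sandwich a)" for \<eta>
    by (simp add: parametrix_def)
  show "((\<lambda>t. - ((\<xi> + t *\<^sub>R axis k 1) $ a / ((\<xi> + t *\<^sub>R axis k 1) \<bullet> (\<xi> + t *\<^sub>R axis k 1))\<^sup>2))
      has_real_derivative 4 * \<xi> $ a * \<xi> $ k / (\<xi> \<bullet> \<xi>) ^ 3 - (if a = k then 1 / (\<xi> \<bullet> \<xi>)\<^sup>2 else 0)) (at 0)" for a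
    using assms
    by (auto intro!: derivative_eq_intros square_norm_derivative component_derivative
        simp: field_simps power2_eq_square power3_eq_cube axis_other)
qed

lemma sandwich_q: "sandwich a \<star> q = p \<star> reflected_first_order a"
  by (simp add: sandwich_def smooth_assoc)

lemma isotropic_part_q:
  "isotropic_part \<star> q = - (p \<star> zeroth_order) + (\<Sum>k\<in>UNIV. sandwich k \<star> delta k q)
     + (\<Sum>k\<in>UNIV. p \<star> delta k (delta k q))"
  by (simp add: isotropic_part_def smooth_distrib mult_minus_left mult_sum_left smooth_assoc)

lemma quadratic_part_q:
  "quadratic_part j k \<star> q = sandwich j \<star> first_order k + 2 *\<^sub>C (p \<star> delta j (first_order k))
     - 4 *\<^sub>C (sandwich j \<star> delta k q) - 4 *\<^sub>C (p \<star> delta k (delta j q))"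
  by (simp add: quadratic_part_def smooth_distrib mult_cscale_left smooth_assoc)

end

section \<open>The residue as a quadratic function of the first order term\<close>

context nc_torus
begin

definition torus_commutator :: "coeffs \<Rightarrow> coeffs \<Rightarrow> coeffs" where
  "torus_commutator a b = a \<star> b - b \<star> a"

text \<open>
  The residue of \<open>\<Delta>\<^sub>h\<^sup>-\<^sup>1\<close>, as it comes out of the computation.
\<close>

definition residue_constant :: "coeffs \<Rightarrow> coeffs \<Rightarrow> complex" where
  "residue_constant p q = 2 * pi\<^sup>2 * (\<Sum>k\<in>UNIV.
     - canonical_trace (p \<star> ((delta k (delta k q) + q \<star> (delta k p \<star> delta k q)) \<star> p))
     + canonical_trace (p \<star> (delta k (delta k q) \<star> p)) / 2
     - canonical_trace (p \<star> (delta k q \<star> (p \<star> (delta k q \<star> p)))) / 4)"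

end

context torus_laplacian
begin

lemma is_parametrix_iff:
  "is_parametrix_symbol (laplace_type h T) b \<longleftrightarrow>
     (\<forall>n\<in>{0, 1, 2}. \<forall>\<xi>. \<xi> \<noteq> 0 \<longrightarrow> b n \<xi> \<in> smooth_torus \<and>
         (\<forall>t>0. b n (t *\<^sub>R \<xi>) = complex_of_real (t powi (- 2 - int n)) *\<^sub>C b n \<xi>)) \<and>
     (\<forall>\<xi>. \<xi> \<noteq> 0 \<longrightarrow>
         b 0 \<xi> \<star> (complex_of_real (\<xi> \<bullet> \<xi>) *\<^sub>C q) = unit \<and>
         b 1 \<xi> \<star> (complex_of_real (\<xi> \<bullet> \<xi>) *\<^sub>C q)
           + b 0 \<xi> \<star> (\<Sum>a\<in>UNIV. complex_of_real (\<xi> $ a) *\<^sub>C first_order a)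
           + (\<Sum>k\<in>UNIV. pderiv_xi k (b 0) \<xi> \<star> (complex_of_real (\<xi> \<bullet> \<xi>) *\<^sub>C delta k q)) = 0 \<and>
         b 2 \<xi> \<star> (complex_of_real (\<xi> \<bullet> \<xi>) *\<^sub>C q)
           + b 1 \<xi> \<star> (\<Sum>a\<in>UNIV. complex_of_real (\<xi> $ a) *\<^sub>C first_order a)
           + b 0 \<xi> \<star> zeroth_order
           + (\<Sum>k\<in>UNIV. pderiv_xi k (b 0) \<xi> \<star>
                (\<Sum>a\<in>UNIV. complex_of_real (\<xi> $ a) *\<^sub>C delta k (first_order a)))
           + (\<Sum>k\<in>UNIV. pderiv_xi k (b 1) \<xi> \<star> (complex_of_real (\<xi> \<bullet> \<xi>) *\<^sub>C delta k q))
           + (1/2) *\<^sub>C (\<Sum>j\<in>UNIV. \<Sum>k\<in>UNIV.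
               pderiv_xi k (pderiv_xi j (b 0)) \<xi> \<star> (complex_of_real (\<xi> \<bullet> \<xi>) *\<^sub>C delta k (delta j q))) = 0)"
  unfolding is_parametrix_symbol_def Let_def symbol_part_laplacian delta_linear delta_sum
    power2_norm_eq_inner ..

text \<open>
  With \<open>p \<star> q = 1\<close> absorbed in \<open>b\<^sub>2 \<star> a\<^sub>2\<close>, every term of the last equation is a combination of the five
  families \<open>p a\<^sub>0\<close>, \<open>Z\<^sub>j Y\<^sub>k\<close>, \<open>p \<delta>\<^sub>j Y\<^sub>k\<close>, \<open>Z\<^sub>j \<delta>\<^sub>k q\<close> and \<open>p \<delta>\<^sub>k \<delta>\<^sub>j q\<close>, where \<open>Z\<^sub>j\<close> are the coefficients
  of \<open>- b\<^sub>1\<close>. They occur either summed over the diagonal with factor \<open>1/|\<xi>|\<^sup>2\<close> or summed over all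
  \<open>j, k\<close> with factor \<open>\<xi>\<^sub>j \<xi>\<^sub>k/|\<xi>|\<^sup>4\<close>, and they cancel in each of these two groups.
\<close>

lemma parametrix_is_parametrix: "is_parametrix_symbol (laplace_type h T) parametrix"
  unfolding is_parametrix_iff
proof (intro conjI allI impI ballI)
  fix \<xi> :: "real^4" assume \<xi>: "\<xi> \<noteq> 0"
  define s where "s = complex_of_real (\<xi> \<bullet> \<xi>)"
  define x where "x j = complex_of_real (\<xi> $ j)" for j
  have s: "s \<noteq> 0" using \<xi> by (simp add: s_def)
  have b0: "parametrix 0 \<xi> = (1 / s) *\<^sub>C p"
    by (simp add: parametrix_def s_def)
  have b1: "parametrix 1 \<xi> = (\<Sum>a\<in>UNIV. (- (x a / s\<^sup>2)) *\<^sub>C sandwich a)"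
    by (simp add: parametrix_def s_def x_def)
  have b2: "parametrix 2 \<xi> = (1 / s\<^sup>2) *\<^sub>C isotropic_part
      + (\<Sum>j\<in>UNIV. \<Sum>k\<in>UNIV. (x j * x k / s ^ 3) *\<^sub>C quadratic_part j k)"
    by (simp add: parametrix_def s_def x_def)
  have d0: "pderiv_xi k (parametrix 0) \<xi> = (- (2 * x k / s\<^sup>2)) *\<^sub>C p" for k
    using pderiv_parametrix_0[OF \<xi>] by (simp add: s_def x_def)
  have d1: "pderiv_xi k (parametrix 1) \<xi>
      = (\<Sum>a\<in>UNIV. (4 * x a * x k / s ^ 3 - (if a = k then 1 / s\<^sup>2 else 0)) *\<^sub>C sandwich a)" for k
    unfolding pderiv_parametrix_1[OF \<xi>] by (intro sum.cong refl) (auto simp: s_def x_def)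
  have d00: "pderiv_xi k (pderiv_xi j (parametrix 0)) \<xi>
      = (8 * x j * x k / s ^ 3 - (if j = k then 2 / s\<^sup>2 else 0)) *\<^sub>C p" for j k
    unfolding pderiv_pderiv_parametrix_0[OF \<xi>] by (auto simp: s_def x_def)
  note s_def[symmetric, simp] x_def[symmetric, simp]
  show "parametrix 0 \<xi> \<star> (complex_of_real (\<xi> \<bullet> \<xi>) *\<^sub>C q) = unit"
    using s by (simp add: b0 mult_cscale_left mult_cscale_right)
  show "parametrix 1 \<xi> \<star> (complex_of_real (\<xi> \<bullet> \<xi>) *\<^sub>C q)
      + parametrix 0 \<xi> \<star> (\<Sum>a\<in>UNIV. complex_of_real (\<xi> $ a) *\<^sub>C first_order a)
      + (\<Sum>k\<in>UNIV. pderiv_xi k (parametrix 0) \<xi> \<star> (complex_of_real (\<xi> \<bullet> \<xi>) *\<^sub>C delta k q)) = 0"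
  proof -
    have "(- (x a / s)) *\<^sub>C (p \<star> reflected_first_order a) + (x a / s) *\<^sub>C (p \<star> first_order a)
        + (- (2 * x a / s)) *\<^sub>C (p \<star> delta a q) = 0" for a
      by (simp add: reflected_first_order_def first_order_def smooth_distrib) (simp add: fun_eq_iff cscale_apply algebra_simps add_divide_distrib diff_divide_distrib)
    then show ?thesis
      unfolding b0 b1 d0 using s
      by (simp add: mult_sum_left mult_sum_right mult_cscale_left mult_cscale_right sandwich_q
          power2_eq_square cscale_sum_right flip: sum.distrib)
  qed
  define S where "S f = (\<Sum>j\<in>UNIV. \<Sum>k\<in>UNIV. (x j * x k / s\<^sup>2) *\<^sub>C f j k)" for f :: "4 \<Rightarrow> 4 \<Rightarrow> coeffs"
  define u where "u j k = sandwich j \<star> first_order k" for j k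
  define v where "v j k = p \<star> delta j (first_order k)" for j k
  define w where "w j k = sandwich j \<star> delta k q" for j k
  define z where "z j k = p \<star> delta k (delta j q)" for j k
  have t1: "parametrix 2 \<xi> \<star> (s *\<^sub>C q) = (1 / s) *\<^sub>C (- (p \<star> zeroth_order) + (\<Sum>k\<in>UNIV. w k k)
      + (\<Sum>k\<in>UNIV. z k k)) + S u + 2 *\<^sub>C S v - 4 *\<^sub>C S w - 4 *\<^sub>C S z"
  proof -
    have "parametrix 2 \<xi> \<star> (s *\<^sub>C q) = (1 / s) *\<^sub>C (isotropic_part \<star> q) + S (\<lambda>j k. quadratic_part j k \<star> q)"
      using s by (simp add: b2 S_def smooth_distrib mult_sum_left mult_cscale_left mult_cscale_right
          cscale_add_right cscale_sum_right power2_eq_square power3_eq_cube)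
    moreover have "S (\<lambda>j k. quadratic_part j k \<star> q) = S u + 2 *\<^sub>C S v - 4 *\<^sub>C S w - 4 *\<^sub>C S z"
      unfolding quadratic_part_q u_def[symmetric] v_def[symmetric] w_def[symmetric] z_def[symmetric]
      by (simp add: S_def fun_eq_iff sum_apply cscale_apply sum_distrib_left algebra_simps
          sum.distrib sum_subtractf)
    ultimately show ?thesis
      by (simp add: isotropic_part_q w_def z_def add_diff_eq add.assoc)
  qed
  have t2: "parametrix 1 \<xi> \<star> (\<Sum>a\<in>UNIV. x a *\<^sub>C first_order a) = - S u"
  proof -
    have "parametrix 1 \<xi> \<star> (\<Sum>a\<in>UNIV. x a *\<^sub>C first_order a)
        = (\<Sum>j\<in>UNIV. \<Sum>k\<in>UNIV. ((- (x j / s\<^sup>2)) *\<^sub>C sandwich j) \<star> (x k *\<^sub>C first_order k))"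
      unfolding b1 by (subst mult_sum_left, simp, simp, subst mult_sum_right, simp_all)
    also have "\<dots> = - S u"
      by (simp add: S_def u_def mult_cscale_left mult_cscale_right cscale_minus_left cscale_minus_right
          mult_minus_left sum_negf mult.commute)
    finally show ?thesis .
  qed
  have t3: "parametrix 0 \<xi> \<star> zeroth_order = (1 / s) *\<^sub>C (p \<star> zeroth_order)"
    by (simp add: b0 mult_cscale_left)
  have t4: "(\<Sum>k\<in>UNIV. pderiv_xi k (parametrix 0) \<xi> \<star> (\<Sum>a\<in>UNIV. x a *\<^sub>C delta k (first_order a))) = - (2 *\<^sub>C S v)"
    by (simp add: d0 S_def v_def mult_sum_right mult_cscale_left mult_cscale_right
        cscale_minus_left cscale_minus_right mult_minus_left sum_negf cscale_sum_right mult_ac)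
  have t5: "(\<Sum>k\<in>UNIV. pderiv_xi k (parametrix 1) \<xi> \<star> (s *\<^sub>C delta k q)) = 4 *\<^sub>C S w - (1 / s) *\<^sub>C (\<Sum>k\<in>UNIV. w k k)"
  proof -
    have summand: "((4 * x j * x k / s ^ 3 - (if j = k then 1 / s\<^sup>2 else 0)) *\<^sub>C sandwich j) \<star> (s *\<^sub>C delta k q)
        = (4 * (x j * x k / s\<^sup>2)) *\<^sub>C w j k - (if j = k then (1 / s) *\<^sub>C w j k else 0)" for j k
      using s by (cases "j = k") (simp_all add: mult_cscale_left mult_cscale_right w_def fun_eq_iff
          cscale_apply power2_eq_square power3_eq_cube field_simps)
    have "(\<Sum>k\<in>UNIV. pderiv_xi k (parametrix 1) \<xi> \<star> (s *\<^sub>C delta k q))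
        = (\<Sum>k\<in>UNIV. \<Sum>j\<in>UNIV. (4 * (x j * x k / s\<^sup>2)) *\<^sub>C w j k - (if j = k then (1 / s) *\<^sub>C w j k else 0))"
      unfolding d1 by (simp only: mult_sum_left smooth_cscale smooth_parts smooth_delta q_smooth summand)
    also have "\<dots> = (\<Sum>k\<in>UNIV. \<Sum>j\<in>UNIV. (4 * (x j * x k / s\<^sup>2)) *\<^sub>C w j k) - (\<Sum>k\<in>UNIV. (1 / s) *\<^sub>C w k k)"
      by (simp add: sum_subtractf)
    also have "(\<Sum>k\<in>UNIV. \<Sum>j\<in>UNIV. (4 * (x j * x k / s\<^sup>2)) *\<^sub>C w j k) = 4 *\<^sub>C S w"
      unfolding S_def by (subst sum.swap) (simp add: cscale_sum_right)
    finally show ?thesis unfolding cscale_sum_right .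
  qed
  have t6: "(1/2) *\<^sub>C (\<Sum>j\<in>UNIV. \<Sum>k\<in>UNIV. pderiv_xi k (pderiv_xi j (parametrix 0)) \<xi> \<star> (s *\<^sub>C delta k (delta j q)))
      = 4 *\<^sub>C S z - (1 / s) *\<^sub>C (\<Sum>k\<in>UNIV. z k k)"
  proof -
    have "(1/2) *\<^sub>C (\<Sum>j\<in>UNIV. \<Sum>k\<in>UNIV. pderiv_xi k (pderiv_xi j (parametrix 0)) \<xi> \<star> (s *\<^sub>C delta k (delta j q)))
        = (\<Sum>j\<in>UNIV. \<Sum>k\<in>UNIV. (4 * (x j * x k / s\<^sup>2)) *\<^sub>C z j k - (if j = k then (1 / s) *\<^sub>C z j k else 0))"
      unfolding d00 cscale_sum_right using s
      by (auto simp: mult_cscale_left mult_cscale_right z_def fun_eq_iff sum_apply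
          cscale_apply power2_eq_square power3_eq_cube field_simps intro!: sum.cong)
    also have "\<dots> = (\<Sum>j\<in>UNIV. \<Sum>k\<in>UNIV. (4 * (x j * x k / s\<^sup>2)) *\<^sub>C z j k) - (\<Sum>k\<in>UNIV. (1 / s) *\<^sub>C z k k)"
      by (simp add: sum_subtractf)
    finally show ?thesis unfolding S_def cscale_sum_right cscale_simps(3) .
  qed
  show "parametrix 2 \<xi> \<star> (complex_of_real (\<xi> \<bullet> \<xi>) *\<^sub>C q)
      + parametrix 1 \<xi> \<star> (\<Sum>a\<in>UNIV. complex_of_real (\<xi> $ a) *\<^sub>C first_order a)
      + parametrix 0 \<xi> \<star> zeroth_order
      + (\<Sum>k\<in>UNIV. pderiv_xi k (parametrix 0) \<xi> \<star>
           (\<Sum>a\<in>UNIV. complex_of_real (\<xi> $ a) *\<^sub>C delta k (first_order a)))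
      + (\<Sum>k\<in>UNIV. pderiv_xi k (parametrix 1) \<xi> \<star> (complex_of_real (\<xi> \<bullet> \<xi>) *\<^sub>C delta k q))
      + (1/2) *\<^sub>C (\<Sum>j\<in>UNIV. \<Sum>k\<in>UNIV.
          pderiv_xi k (pderiv_xi j (parametrix 0)) \<xi> \<star> (complex_of_real (\<xi> \<bullet> \<xi>) *\<^sub>C delta k (delta j q))) = 0"
    unfolding s_def[symmetric] x_def[symmetric] t1 t2 t3 t4 t5 t6
    by (simp add: cscale_add_right cscale_diff_right cscale_minus_right)
qed (auto simp: parametrix_homogeneous)

text \<open>
  Each equation has the form \<open>b\<^sub>n \<star> a\<^sub>2 + R = 0\<close> with \<open>R\<close> determined by the earlier parts, and \<open>a\<^sub>2\<close> is
  right invertible.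
\<close>

lemma parametrix_unique:
  assumes b: "is_parametrix_symbol (laplace_type h T) b" and \<xi>: "\<xi> \<noteq> 0"
  shows "b 2 \<xi> = parametrix 2 \<xi>"
proof -
  note P = b[unfolded is_parametrix_iff] parametrix_is_parametrix[unfolded is_parametrix_iff]
  have sm: "b n \<eta> \<in> smooth_torus" if "\<eta> \<noteq> 0" "n \<in> {0, 1, 2}" for n \<eta>
    using P(1) that by blast
  have cancel_q: "a = c"
    if "a \<star> (complex_of_real (\<eta> \<bullet> \<eta>) *\<^sub>C q) = c \<star> (complex_of_real (\<eta> \<bullet> \<eta>) *\<^sub>C q)"
      "\<eta> \<noteq> 0" "a \<in> smooth_torus" "c \<in> smooth_torus" for a c and \<eta> :: "real^4"
  proof -
    let ?p = "complex_of_real (1 / (\<eta> \<bullet> \<eta>)) *\<^sub>C p"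
    have qp1: "(complex_of_real (\<eta> \<bullet> \<eta>) *\<^sub>C q) \<star> ?p = unit"
      using that by (simp add: mult_cscale_left mult_cscale_right)
    have "(a \<star> (complex_of_real (\<eta> \<bullet> \<eta>) *\<^sub>C q)) \<star> ?p = (c \<star> (complex_of_real (\<eta> \<bullet> \<eta>) *\<^sub>C q)) \<star> ?p"
      by (simp only: that(1))
    then show ?thesis using that(3,4) by (simp add: smooth_assoc qp1 del: of_real_divide)
  qed
  have eq0: "b 0 \<eta> = parametrix 0 \<eta>" if "\<eta> \<noteq> 0" for \<eta>
  proof (rule cancel_q[of _ \<eta>])
    show "b 0 \<eta> \<star> (complex_of_real (\<eta> \<bullet> \<eta>) *\<^sub>C q) = parametrix 0 \<eta> \<star> (complex_of_real (\<eta> \<bullet> \<eta>) *\<^sub>C q)"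
      by (rule trans[OF conjunct1[OF conjunct2[OF P(1), rule_format, OF that]]
            conjunct1[OF conjunct2[OF P(2), rule_format, OF that], symmetric]])
  qed (use that sm in auto)
  have d0: "pderiv_xi k (b 0) \<eta> = pderiv_xi k (parametrix 0) \<eta>" if "\<eta> \<noteq> 0" for k \<eta>
    by (rule pderiv_xi_cong[OF that eq0])
  have d00: "pderiv_xi k (pderiv_xi j (b 0)) \<eta> = pderiv_xi k (pderiv_xi j (parametrix 0)) \<eta>"
    if "\<eta> \<noteq> 0" for j k \<eta>
    by (rule pderiv_xi_cong[OF that d0])
  have eq1: "b 1 \<eta> = parametrix 1 \<eta>" if "\<eta> \<noteq> 0" for \<eta>
  proof (rule cancel_q[of _ \<eta>])
    let ?R = "parametrix 0 \<eta> \<star> (\<Sum>a\<in>UNIV. complex_of_real (\<eta> $ a) *\<^sub>C first_order a)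
           + (\<Sum>k\<in>UNIV. pderiv_xi k (parametrix 0) \<eta> \<star> (complex_of_real (\<eta> \<bullet> \<eta>) *\<^sub>C delta k q))"
    have e1: "b 1 \<eta> \<star> (complex_of_real (\<eta> \<bullet> \<eta>) *\<^sub>C q) + ?R = 0"
      by (rule conjunct1[OF conjunct2[OF conjunct2[OF P(1), rule_format, OF that],
            unfolded eq0[OF that] d0[OF that] add.assoc]])
    have e2: "parametrix 1 \<eta> \<star> (complex_of_real (\<eta> \<bullet> \<eta>) *\<^sub>C q) + ?R = 0"
      by (rule conjunct1[OF conjunct2[OF conjunct2[OF P(2), rule_format, OF that], unfolded add.assoc]])
    from trans[OF e1 e2[symmetric]] show "b 1 \<eta> \<star> (complex_of_real (\<eta> \<bullet> \<eta>) *\<^sub>C q)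
        = parametrix 1 \<eta> \<star> (complex_of_real (\<eta> \<bullet> \<eta>) *\<^sub>C q)"
      by (rule add_right_imp_eq)
  qed (use that sm in auto)
  have d1: "pderiv_xi k (b 1) \<eta> = pderiv_xi k (parametrix 1) \<eta>" if "\<eta> \<noteq> 0" for k \<eta>
    by (rule pderiv_xi_cong[OF that eq1])
  show ?thesis
  proof (rule cancel_q[of _ \<xi>])
    let ?R = "parametrix 1 \<xi> \<star> (\<Sum>a\<in>UNIV. complex_of_real (\<xi> $ a) *\<^sub>C first_order a)
           + (parametrix 0 \<xi> \<star> zeroth_order
           + ((\<Sum>k\<in>UNIV. pderiv_xi k (parametrix 0) \<xi> \<star>
                (\<Sum>a\<in>UNIV. complex_of_real (\<xi> $ a) *\<^sub>C delta k (first_order a)))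
           + ((\<Sum>k\<in>UNIV. pderiv_xi k (parametrix 1) \<xi> \<star> (complex_of_real (\<xi> \<bullet> \<xi>) *\<^sub>C delta k q))
           + (1/2) *\<^sub>C (\<Sum>j\<in>UNIV. \<Sum>k\<in>UNIV.
               pderiv_xi k (pderiv_xi j (parametrix 0)) \<xi> \<star> (complex_of_real (\<xi> \<bullet> \<xi>) *\<^sub>C delta k (delta j q))))))"
    have e1: "b 2 \<xi> \<star> (complex_of_real (\<xi> \<bullet> \<xi>) *\<^sub>C q) + ?R = 0"
      by (rule conjunct2[OF conjunct2[OF conjunct2[OF P(1), rule_format, OF \<xi>],
            unfolded eq0[OF \<xi>] eq1[OF \<xi>] d0[OF \<xi>] d00[OF \<xi>] d1[OF \<xi>] add.assoc]])
    have e2: "parametrix 2 \<xi> \<star> (complex_of_real (\<xi> \<bullet> \<xi>) *\<^sub>C q) + ?R = 0"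
      by (rule conjunct2[OF conjunct2[OF conjunct2[OF P(2), rule_format, OF \<xi>], unfolded add.assoc]])
    from trans[OF e1 e2[symmetric]] show "b 2 \<xi> \<star> (complex_of_real (\<xi> \<bullet> \<xi>) *\<^sub>C q)
        = parametrix 2 \<xi> \<star> (complex_of_real (\<xi> \<bullet> \<xi>) *\<^sub>C q)"
      by (rule add_right_imp_eq)
  qed (use \<xi> sm in auto)
qed

lemma wres_eq_moments:
  "wres_inverse (laplace_type h T) = 2 * pi\<^sup>2 * canonical_trace isotropic_part
     + pi\<^sup>2 / 2 * (\<Sum>k\<in>UNIV. canonical_trace (quadratic_part k k))"
proof -
  define b where "b = (SOME b. is_parametrix_symbol (laplace_type h T) b)"
  have b: "is_parametrix_symbol (laplace_type h T) b"
    unfolding b_def by (rule someI[where P = "is_parametrix_symbol (laplace_type h T)"])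
      (rule parametrix_is_parametrix)
  let ?\<sigma> = "sphere_measure :: (real^4) measure"
  let ?c = "\<lambda>j k. canonical_trace (quadratic_part j k)"
  interpret finite_measure ?\<sigma> by (rule finite_sphere_measure)
  have int: "integrable ?\<sigma> (\<lambda>\<xi>. complex_of_real (\<xi> $ j * \<xi> $ k) * ?c j k)" for j k
    by (intro integrable_mult_left integrable_of_real integrable_sphere_quadratic)
  have moment: "(\<integral>\<xi>. complex_of_real (\<xi> $ j * \<xi> $ k) * ?c j k \<partial>?\<sigma>)
      = (if j = k then pi\<^sup>2 / 2 * ?c j k else 0)" for j k
    by (simp only: Bochner_Integration.integral_mult_left_zero integral_complex_of_real
        sphere_quadratic_moments) auto
  have "wres_inverse (laplace_type h T) = (\<integral>\<xi>. canonical_trace (b 2 \<xi>) \<partial>?\<sigma>)"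
    by (simp add: wres_inverse_def b_def Let_def)
  also have "\<dots> = (\<integral>\<xi>. canonical_trace isotropic_part
      + (\<Sum>j\<in>UNIV. \<Sum>k\<in>UNIV. complex_of_real (\<xi> $ j * \<xi> $ k) * ?c j k) \<partial>?\<sigma>)"
  proof (rule Bochner_Integration.integral_cong)
    fix \<xi> :: "real^4" assume "\<xi> \<in> space ?\<sigma>"
    then have "\<xi> \<noteq> 0" "\<xi> \<bullet> \<xi> = 1" by (auto simp flip: power2_norm_eq_inner)
    then show "canonical_trace (b 2 \<xi>) = canonical_trace isotropic_part
        + (\<Sum>j\<in>UNIV. \<Sum>k\<in>UNIV. complex_of_real (\<xi> $ j * \<xi> $ k) * ?c j k)"
      by (simp add: parametrix_unique[OF b] parametrix_def trace_linear trace_sum)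
  qed simp
  also have "\<dots> = (\<integral>\<xi>. canonical_trace isotropic_part \<partial>?\<sigma>)
      + (\<Sum>j\<in>UNIV. \<Sum>k\<in>UNIV. (\<integral>\<xi>. complex_of_real (\<xi> $ j * \<xi> $ k) * ?c j k \<partial>?\<sigma>))"
    by (subst Bochner_Integration.integral_add)
      (auto simp del: of_real_mult simp: Bochner_Integration.integral_sum int
        intro!: Bochner_Integration.integrable_sum int)
  also have "(\<integral>\<xi>. canonical_trace isotropic_part \<partial>?\<sigma>) = 2 * pi\<^sup>2 * canonical_trace isotropic_part"
    by (simp add: measure_sphere scaleR_conv_of_real)
  finally show ?thesis unfolding moment by (simp add: sum_distrib_left)
qed

text \<open>
  Averaging over the sphere leaves, up to terms without \<open>T\<close>, a quarter of
  \<open>t (p (T\<^sub>k - \<delta>\<^sub>k q) p (T\<^sub>k + \<delta>\<^sub>k q) p)\<close>: the contributions of \<open>\<delta>\<^sub>k T\<^sub>k\<close> from \<open>a\<^sub>0\<close> and from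
  \<open>\<partial>\<^sub>\<xi> b\<^sub>0 \<delta> a\<^sub>1\<close> cancel, as do those of \<open>Z\<^sub>k \<delta>\<^sub>k q\<close>. The cross terms turn into the commutator by
  \<open>p \<delta>\<^sub>k q = - \<delta>\<^sub>k(p) q\<close> and the trace property.
\<close>

theorem wres_laplace_type:
  "wres_inverse (laplace_type h T) = residue_constant p q
     + pi\<^sup>2 / 2 * (\<Sum>k\<in>UNIV. canonical_trace (p \<star> (T k \<star> (p \<star> (T k \<star> p))))
         + canonical_trace (T k \<star> torus_commutator p (delta k p)))"
proof -
  let ?tr = canonical_trace
  have dq: "p \<star> (delta k q \<star> x) = - (delta k p \<star> (q \<star> x))" if "x \<in> smooth_torus" for x k
  proof -
    have "p \<star> (delta k q \<star> x) = (p \<star> delta k q) \<star> x" using that by (simp add: smooth_assoc)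
    also have "\<dots> = - (delta k p \<star> (q \<star> x))"
      using that by (simp add: delta_inverse mult_minus_left smooth_assoc)
    finally show ?thesis .
  qed
  have cross: "?tr (p \<star> (reflected_first_order k \<star> (p \<star> (first_order k \<star> p))))
      = ?tr (p \<star> (T k \<star> (p \<star> (T k \<star> p)))) + ?tr (T k \<star> torus_commutator p (delta k p))
        - ?tr (p \<star> (delta k q \<star> (p \<star> (delta k q \<star> p))))" for k
  proof -
    have a: "?tr (p \<star> (T k \<star> delta k p)) = ?tr (T k \<star> (delta k p \<star> p))"
      by (subst trace_mult_commute) (simp add: smooth_assoc)
    have b: "?tr (delta k p \<star> (T k \<star> p)) = ?tr (T k \<star> (p \<star> delta k p))"
      by (subst trace_mult_commute) (simp add: smooth_assoc)
    have c: "p \<star> (T k \<star> (p \<star> (delta k q \<star> p))) = - (p \<star> (T k \<star> delta k p))"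
      by (simp add: dq mult_minus_right)
    have d: "p \<star> (delta k q \<star> (p \<star> (T k \<star> p))) = - (delta k p \<star> (T k \<star> p))"
      by (simp add: dq)
    have e: "p \<star> (reflected_first_order k \<star> (p \<star> (first_order k \<star> p)))
        = p \<star> (T k \<star> (p \<star> (T k \<star> p))) + p \<star> (T k \<star> (p \<star> (delta k q \<star> p)))
          - p \<star> (delta k q \<star> (p \<star> (T k \<star> p))) - p \<star> (delta k q \<star> (p \<star> (delta k q \<star> p)))"
      by (simp add: reflected_first_order_def first_order_def smooth_distrib)
    have "?tr (p \<star> (reflected_first_order k \<star> (p \<star> (first_order k \<star> p))))
        = ?tr (p \<star> (T k \<star> (p \<star> (T k \<star> p)))) - ?tr (p \<star> (T k \<star> delta k p))
          + ?tr (delta k p \<star> (T k \<star> p)) - ?tr (p \<star> (delta k q \<star> (p \<star> (delta k q \<star> p))))"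
      unfolding e c d trace_linear by simp
    then show ?thesis
      unfolding a b torus_commutator_def by (simp add: smooth_distrib trace_linear)
  qed
  have iso: "?tr isotropic_part = (\<Sum>k\<in>UNIV.
      - ?tr (p \<star> ((delta k (delta k q) + q \<star> (delta k p \<star> delta k q)) \<star> p))
      - ?tr (p \<star> (delta k (T k) \<star> p)) / 2 + ?tr (sandwich k \<star> (delta k q \<star> p)) + ?tr (p \<star> (delta k (delta k q) \<star> p)))"
    by (simp add: isotropic_part_def zeroth_order_def trace_linear trace_sum mult_sum_left mult_sum_right
        smooth_distrib mult_cscale_left mult_cscale_right sum.distrib sum_subtractf sum_negf)
  have quad: "?tr (quadratic_part k k) = ?tr (p \<star> (reflected_first_order k \<star> (p \<star> (first_order k \<star> p))))
      + 2 * ?tr (p \<star> (delta k (T k) \<star> p)) - 2 * ?tr (p \<star> (delta k (delta k q) \<star> p))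
      - 4 * ?tr (sandwich k \<star> (delta k q \<star> p))" for k
    unfolding quadratic_part_def
    by (simp add: trace_linear first_order_def delta_linear smooth_distrib)
      (simp add: sandwich_def smooth_assoc smooth_distrib trace_linear)
  have "wres_inverse (laplace_type h T) = 2 * pi\<^sup>2 * (\<Sum>k\<in>UNIV.
      - ?tr (p \<star> ((delta k (delta k q) + q \<star> (delta k p \<star> delta k q)) \<star> p))
      - ?tr (p \<star> (delta k (T k) \<star> p)) / 2 + ?tr (sandwich k \<star> (delta k q \<star> p)) + ?tr (p \<star> (delta k (delta k q) \<star> p))
      + ?tr (quadratic_part k k) / 4)"
    unfolding wres_eq_moments iso
    by (simp add: sum.distrib sum_subtractf sum_negf sum_divide_distrib[symmetric] algebra_simps)
  also have "\<dots> = 2 * pi\<^sup>2 * (\<Sum>k\<in>UNIV.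
      (- ?tr (p \<star> ((delta k (delta k q) + q \<star> (delta k p \<star> delta k q)) \<star> p))
       + ?tr (p \<star> (delta k (delta k q) \<star> p)) / 2
       - ?tr (p \<star> (delta k q \<star> (p \<star> (delta k q \<star> p)))) / 4)
      + (?tr (p \<star> (T k \<star> (p \<star> (T k \<star> p)))) + ?tr (T k \<star> torus_commutator p (delta k p))) / 4)"
    unfolding quad cross by (intro arg_cong2[where f = "(*)"] sum.cong refl) (simp add: field_simps)
  also have "\<dots> = residue_constant p q
     + pi\<^sup>2 / 2 * (\<Sum>k\<in>UNIV. ?tr (p \<star> (T k \<star> (p \<star> (T k \<star> p))))
         + ?tr (T k \<star> torus_commutator p (delta k p)))"
    unfolding residue_constant_def sum.distrib[of "\<lambda>k. _ k - _ k"] 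
    by (simp add: sum_divide_distrib[symmetric] distrib_left)
  finally show ?thesis .
qed

end

section \<open>Neumann series and a conformal factor that does not commute with its derivative\<close>

definition l1_norm :: "coeffs \<Rightarrow> real" where
  "l1_norm a = (\<Sum>\<^sub>\<infinity>\<beta>. cmod (a \<beta>))"

lemma l1_norm_nonneg [simp]: "0 \<le> l1_norm a"
  by (simp add: l1_norm_def infsum_nonneg)

lemma cmod_le_l1_norm: "a \<in> l1_space \<Longrightarrow> cmod (a \<beta>) \<le> l1_norm a"
  unfolding l1_space_def l1_norm_def
  using finite_sum_le_infsum[of "\<lambda>\<beta>. cmod (a \<beta>)" UNIV "{\<beta>}"] by simp

lemma sum_le_l1_norm: "a \<in> l1_space \<Longrightarrow> finite F \<Longrightarrow> (\<Sum>\<beta>\<in>F. cmod (a \<beta>)) \<le> l1_norm a"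
  unfolding l1_space_def l1_norm_def by (intro finite_sum_le_infsum) auto

lemma l1_norm_cscale: "l1_norm (z *\<^sub>C a) = cmod z * l1_norm a"
  by (simp add: l1_norm_def cscale_apply norm_mult infsum_cmult_right')

lemma l1_norm_monomial [simp]: "l1_norm (monomial \<alpha>) = 1"
proof -
  have "l1_norm (monomial \<alpha>) = (\<Sum>\<^sub>\<infinity>\<beta>\<in>{\<alpha>}. 1)"
    unfolding l1_norm_def by (rule infsum_cong_neutral) (auto simp: monomial_def)
  then show ?thesis by simp
qed

lemma l1_norm_add:
  assumes "a \<in> smooth_torus" "b \<in> smooth_torus" shows "l1_norm (a + b) \<le> l1_norm a + l1_norm b"
proof -
  have "l1_norm (a + b) \<le> (\<Sum>\<^sub>\<infinity>\<beta>. cmod (a \<beta>) + cmod (b \<beta>))"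
    unfolding l1_norm_def
    using smooth_summable[OF assms(1)] smooth_summable[OF assms(2)] smooth_summable[OF smooth_add[OF assms]]
    by (intro infsum_mono summable_on_add) (auto simp: norm_triangle_ineq)
  also have "\<dots> = l1_norm a + l1_norm b"
    unfolding l1_norm_def using assms by (intro infsum_add smooth_summable)
  finally show ?thesis .
qed

text \<open>
  The arithmetic-geometric mean inequality \<open>|\<langle>x, y\<rangle>| \<le> (\<parallel>x\<parallel>\<^sup>2 + \<parallel>y\<parallel>\<^sup>2)/2\<close> serves in place of the
  Cauchy-Schwarz inequality: it already yields \<open>|\<langle>x, r x\<rangle>| \<le> \<parallel>x\<parallel>\<^sup>2\<close> for a contraction \<open>r\<close>.
\<close>

lemma gns_inner_summable:
  assumes "x \<in> gns_space" "y \<in> gns_space"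
  shows "(\<lambda>\<beta>. cnj (x \<beta>) * y \<beta>) summable_on UNIV"
    and "cmod (gns_inner x y) \<le> ((gns_norm x)\<^sup>2 + (gns_norm y)\<^sup>2) / 2"
proof -
  have s: "(\<lambda>\<beta>. (cmod (x \<beta>))\<^sup>2) summable_on UNIV" "(\<lambda>\<beta>. (cmod (y \<beta>))\<^sup>2) summable_on UNIV"
    using assms by (auto simp: gns_space_def)
  have hs: "((\<lambda>\<beta>. (1/2) * ((cmod (x \<beta>))\<^sup>2 + (cmod (y \<beta>))\<^sup>2)) has_sum
      (1/2) * ((gns_norm x)\<^sup>2 + (gns_norm y)\<^sup>2)) UNIV"
    unfolding gns_norm_square by (intro has_sum_cmult_right has_sum_add has_sum_infsum s)
  have le: "norm (cnj (x \<beta>) * y \<beta>) \<le> (1/2) * ((cmod (x \<beta>))\<^sup>2 + (cmod (y \<beta>))\<^sup>2)" for \<beta>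
    using zero_le_power2[of "cmod (x \<beta>) - cmod (y \<beta>)"] by (simp add: norm_mult power2_diff)
  show 1: "(\<lambda>\<beta>. cnj (x \<beta>) * y \<beta>) summable_on UNIV"
    by (rule dominated_summable_on[OF has_sum_imp_summable[OF hs] le])
  have "cmod (gns_inner x y) \<le> (1/2) * ((gns_norm x)\<^sup>2 + (gns_norm y)\<^sup>2)"
    unfolding gns_inner_def
    by (rule norm_infsum_le[OF has_sum_infsum[OF 1] hs]) (use le in simp)
  then show "cmod (gns_inner x y) \<le> ((gns_norm x)\<^sup>2 + (gns_norm y)\<^sup>2) / 2" by simp
qed

lemma gns_inner_linear:
  assumes "x \<in> gns_space" "y \<in> gns_space" "z \<in> gns_space"
  shows "gns_inner x (y + z) = gns_inner x y + gns_inner x z"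
    and "gns_inner x (y - z) = gns_inner x y - gns_inner x z"
    and "gns_inner x (c *\<^sub>C y) = c * gns_inner x y"
proof -
  show scale: "gns_inner x (c *\<^sub>C y) = c * gns_inner x y" for c y
    by (simp add: gns_inner_def cscale_apply mult.left_commute infsum_cmult_right')
  have add: "gns_inner x (y + z) = gns_inner x y + gns_inner x z"
    if "y \<in> gns_space" "z \<in> gns_space" for y z
    unfolding gns_inner_def using assms(1) that
    by (simp add: distrib_left infsum_add gns_inner_summable)
  have "- z \<in> gns_space"
    using gns_cscale[OF assms(3), of "- 1"] by (simp add: cscale_minus_left)
  moreover have "gns_inner x (- z) = - gns_inner x z"
    by (subst uminus_eq_cscale) (simp add: scale)
  ultimately show "gns_inner x (y - z) = gns_inner x y - gns_inner x z"
    using add[OF assms(2), of "- z"] by simp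
  show "gns_inner x (y + z) = gns_inner x y + gns_inner x z"
    by (rule add[OF assms(2,3)])
qed

context nc_torus
begin

lemma l1_norm_mult:
  assumes "a \<in> l1_space" "b \<in> l1_space" shows "l1_norm (a \<star> b) \<le> l1_norm a * l1_norm b"
proof -
  let ?K = "\<lambda>(\<beta>, \<gamma>). cmod (a \<gamma>) * cmod (b (\<beta> - \<gamma>))"
  have K: "?K summable_on (UNIV \<times> UNIV)"
    by (rule summable_convolution_product) (use assms in \<open>auto simp: l1_space_def\<close>)
  have Ks: "(\<lambda>\<beta>. \<Sum>\<^sub>\<infinity>\<gamma>. cmod (a \<gamma>) * cmod (b (\<beta> - \<gamma>))) summable_on UNIV"
    using summable_on_Sigma_banach[OF K] by simp
  have "l1_norm (a \<star> b) \<le> (\<Sum>\<^sub>\<infinity>\<beta>. \<Sum>\<^sub>\<infinity>\<gamma>. cmod (a \<gamma>) * cmod (b (\<beta> - \<gamma>)))"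
    unfolding l1_norm_def using l1_mult[OF assms] assms Ks
    by (intro infsum_mono cmod_mult_le) (auto simp: l1_space_def)
  also have "\<dots> = (\<Sum>\<^sub>\<infinity>\<gamma>. \<Sum>\<^sub>\<infinity>\<beta>. cmod (a \<gamma>) * cmod (b (\<beta> - \<gamma>)))"
    by (rule infsum_swap_banach) (use K in simp)
  also have "\<dots> = (\<Sum>\<^sub>\<infinity>\<gamma>. cmod (a \<gamma>) * l1_norm b)"
  proof (rule infsum_cong)
    fix \<gamma>
    have "(\<Sum>\<^sub>\<infinity>\<beta>. cmod (b (\<beta> - \<gamma>))) = l1_norm b"
      unfolding l1_norm_def
      by (rule infsum_reindex_bij_witness[of _ "\<lambda>x. x + \<gamma>" "\<lambda>x. x - \<gamma>"]) auto
    then show "(\<Sum>\<^sub>\<infinity>\<beta>. cmod (a \<gamma>) * cmod (b (\<beta> - \<gamma>))) = cmod (a \<gamma>) * l1_norm b"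
      by (simp add: infsum_cmult_right')
  qed
  also have "\<dots> = l1_norm a * l1_norm b" by (simp add: l1_norm_def infsum_cmult_left')
  finally show ?thesis .
qed

primrec neumann_power :: "coeffs \<Rightarrow> nat \<Rightarrow> coeffs" where
  "neumann_power r 0 = unit"
| "neumann_power r (Suc n) = r \<star> neumann_power r n"

definition neumann_series :: "coeffs \<Rightarrow> coeffs" where
  "neumann_series r = (\<lambda>\<beta>. \<Sum>n. neumann_power r n \<beta>)"

lemma neumann_power_l1:
  assumes "r \<in> l1_space"
  shows "neumann_power r n \<in> l1_space" "l1_norm (neumann_power r n) \<le> l1_norm r ^ n"
proof (induction n)
  case (Suc n)
  { case 1 then show ?case using Suc assms by simp }
  { case 2
    have "l1_norm (r \<star> neumann_power r n) \<le> l1_norm r * l1_norm (neumann_power r n)"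
      using Suc assms by (intro l1_norm_mult) auto
    also have "\<dots> \<le> l1_norm r * l1_norm r ^ n" by (intro mult_left_mono Suc) simp
    finally show ?case by simp }
qed simp_all

lemma neumann_series_sums:
  assumes "r \<in> l1_space" "l1_norm r < 1"
  shows "(\<lambda>n. neumann_power r n \<beta>) sums neumann_series r \<beta>"
  unfolding neumann_series_def
proof (rule summable_sums, rule summable_comparison_test')
  show "summable (\<lambda>n. l1_norm r ^ n)" using assms by (intro summable_geometric) simp
  show "norm (neumann_power r n \<beta>) \<le> l1_norm r ^ n" for n
    using cmod_le_l1_norm[OF neumann_power_l1(1)[OF assms(1)]] neumann_power_l1(2)[OF assms(1)]
    by (rule order.trans)
qed

lemma neumann_series_l1:
  assumes "r \<in> l1_space" "l1_norm r < 1" shows "neumann_series r \<in> l1_space"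
proof -
  have g: "summable (\<lambda>n. l1_norm r ^ n)" using assms by (intro summable_geometric) simp
  have s: "summable (\<lambda>n. cmod (neumann_power r n \<beta>))" for \<beta>
  proof (rule summable_comparison_test'[OF g])
    show "norm (cmod (neumann_power r n \<beta>)) \<le> l1_norm r ^ n" for n
      using order.trans[OF cmod_le_l1_norm[OF neumann_power_l1(1)] neumann_power_l1(2)] assms by simp
  qed
  have "(\<Sum>\<beta>\<in>F. cmod (neumann_series r \<beta>)) \<le> (\<Sum>n. l1_norm r ^ n)" if F: "finite F" for F
  proof -
    have "(\<Sum>\<beta>\<in>F. cmod (neumann_series r \<beta>)) \<le> (\<Sum>\<beta>\<in>F. \<Sum>n. cmod (neumann_power r n \<beta>))"
      unfolding neumann_series_def by (intro sum_mono summable_norm s)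
    also have "\<dots> = (\<Sum>n. \<Sum>\<beta>\<in>F. cmod (neumann_power r n \<beta>))"
      by (rule suminf_sum[symmetric]) (rule s)
    also have "\<dots> \<le> (\<Sum>n. l1_norm r ^ n)"
    proof (rule suminf_le[OF _ summable_sum[OF s] g])
      show "(\<Sum>\<beta>\<in>F. cmod (neumann_power r n \<beta>)) \<le> l1_norm r ^ n" for n
        using order.trans[OF sum_le_l1_norm[OF neumann_power_l1(1) F] neumann_power_l1(2)] assms by simp
    qed
    finally show ?thesis .
  qed
  then have "(\<lambda>\<beta>. cmod (neumann_series r \<beta>)) summable_on UNIV"
    by (intro nonneg_bdd_above_summable_on bdd_aboveI2) auto
  then show ?thesis by (simp add: l1_space_def)
qed

text \<open>
  Multiplication by \<open>r\<close> may be applied to the series term by term by Fubini's theorem, and it shifts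
  the series by one place.
\<close>

lemma neumann_series_right_inverse:
  assumes r: "r \<in> l1_space" "l1_norm r < 1"
  shows "(unit - r) \<star> neumann_series r = unit"
proof
  fix \<beta>
  let ?b = "neumann_series r"
  have b: "?b \<in> l1_space" by (rule neumann_series_l1[OF r])
  have split: "(r \<star> x) \<beta> = (\<Sum>\<^sub>\<infinity>\<gamma>. r \<gamma> * x (\<beta> - \<gamma>) * cocycle \<gamma> (\<beta> - \<gamma>))" for x
    by (simp add: mult_def)
  have "(\<lambda>n. neumann_power r (Suc n) \<beta>) sums (r \<star> ?b) \<beta>"
  proof -
    let ?K = "\<lambda>(\<gamma>, n). r \<gamma> * neumann_power r n (\<beta> - \<gamma>) * cocycle \<gamma> (\<beta> - \<gamma>)"
    have gs: "(\<lambda>n. l1_norm r ^ n) summable_on UNIV"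
      using r by (intro norm_summable_imp_summable_on) (simp add: summable_geometric)
    have "(\<lambda>(\<gamma>, n). cmod (r \<gamma>) * l1_norm r ^ n) summable_on (UNIV \<times> UNIV)"
    proof (rule summable_on_SigmaI)
      show "((\<lambda>n. case (\<gamma>, n) of (\<gamma>, n) \<Rightarrow> cmod (r \<gamma>) * l1_norm r ^ n) has_sum
          cmod (r \<gamma>) * (\<Sum>\<^sub>\<infinity>n. l1_norm r ^ n)) UNIV" for \<gamma>
        using has_sum_cmult_right[OF has_sum_infsum[OF gs]] by simp
      show "(\<lambda>\<gamma>. cmod (r \<gamma>) * (\<Sum>\<^sub>\<infinity>n. l1_norm r ^ n)) summable_on UNIV"
        using r by (intro summable_on_cmult_left) (simp add: l1_space_def)
    qed simp
    then have K: "?K summable_on (UNIV \<times> UNIV)"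
    proof (rule dominated_summable_on)
      fix z :: "(int^4) \<times> nat"
      have "cmod (neumann_power r (snd z) (\<beta> - fst z)) \<le> l1_norm r ^ snd z"
        using order.trans[OF cmod_le_l1_norm[OF neumann_power_l1(1)] neumann_power_l1(2)] r by simp
      then show "norm (?K z) \<le> (case z of (\<gamma>, n) \<Rightarrow> cmod (r \<gamma>) * l1_norm r ^ n)"
        by (simp add: case_prod_unfold norm_mult mult_left_mono)
    qed
    have Kn: "(\<lambda>n. ?K (\<gamma>, n)) summable_on UNIV" for \<gamma>
      using summable_on_SigmaD1[OF K, of \<gamma>] by simp
    have inner: "(\<Sum>\<^sub>\<infinity>n. ?K (\<gamma>, n)) = r \<gamma> * ?b (\<beta> - \<gamma>) * cocycle \<gamma> (\<beta> - \<gamma>)" for \<gamma>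
    proof -
      have "(\<lambda>n. ?K (\<gamma>, n)) sums (\<Sum>\<^sub>\<infinity>n. ?K (\<gamma>, n))"
        by (rule has_sum_imp_sums) (rule has_sum_infsum[OF Kn])
      moreover have "(\<lambda>n. ?K (\<gamma>, n)) sums (r \<gamma> * ?b (\<beta> - \<gamma>) * cocycle \<gamma> (\<beta> - \<gamma>))"
        using sums_mult2[OF sums_mult[OF neumann_series_sums[OF r, of "\<beta> - \<gamma>"], of "r \<gamma>"],
            of "cocycle \<gamma> (\<beta> - \<gamma>)"] by simp
      ultimately show ?thesis by (rule sums_unique2)
    qed
    have K': "(\<lambda>(n, \<gamma>). ?K (\<gamma>, n)) summable_on (UNIV \<times> UNIV)"
      using K by (subst summable_on_swap) (simp add: case_prod_unfold)
    have "(\<lambda>n. \<Sum>\<^sub>\<infinity>\<gamma>. ?K (\<gamma>, n)) summable_on UNIV"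
      using summable_on_Sigma_banach[OF K'] by simp
    then have "(\<lambda>n. \<Sum>\<^sub>\<infinity>\<gamma>. ?K (\<gamma>, n)) sums (\<Sum>\<^sub>\<infinity>n. \<Sum>\<^sub>\<infinity>\<gamma>. ?K (\<gamma>, n))"
      by (intro has_sum_imp_sums has_sum_infsum)
    also have "(\<Sum>\<^sub>\<infinity>n. \<Sum>\<^sub>\<infinity>\<gamma>. ?K (\<gamma>, n)) = (\<Sum>\<^sub>\<infinity>\<gamma>. \<Sum>\<^sub>\<infinity>n. ?K (\<gamma>, n))"
      by (rule infsum_swap_banach) (use K' in simp)
    also have "\<dots> = (r \<star> ?b) \<beta>"
      by (simp only: inner split)
    finally show ?thesis by (simp add: split)
  qed
  moreover have "(\<lambda>n. neumann_power r (Suc n) \<beta>) sums (?b \<beta> - unit \<beta>)"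
    using neumann_series_sums[OF r, of \<beta>] by (subst sums_Suc_iff) simp
  ultimately have "(r \<star> ?b) \<beta> = ?b \<beta> - unit \<beta>" by (rule sums_unique2)
  then show "((unit - r) \<star> ?b) \<beta> = unit \<beta>"
    using r b by (simp add: mult_diff_left)
qed

text \<open>
  The Neumann series is a right inverse, its adjoint is a left inverse because \<open>r\<close> is selfadjoint,
  and a left and a right inverse coincide.
\<close>

lemma has_bounded_inverse_unit_minus:
  assumes r: "r \<in> smooth_torus" "l1_norm r < 1" and sa: "adj r = r"
  shows "has_bounded_inverse (unit - r)"
proof -
  let ?b = "neumann_series r"
  have b: "?b \<in> l1_space" using r by (intro neumann_series_l1) auto
  have h: "unit - r \<in> l1_space" using r by simp
  have hb: "(unit - r) \<star> ?b = unit" using r by (intro neumann_series_right_inverse) auto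
  have ab: "adj ?b \<in> l1_space"
  proof -
    have "(\<lambda>\<beta>. cmod (?b \<beta>)) summable_on UNIV" using b by (simp add: l1_space_def)
    also have "?this \<longleftrightarrow> (\<lambda>\<beta>. cmod (?b (- \<beta>))) summable_on UNIV"
      by (rule summable_on_reindex_bij_witness[of _ uminus uminus]) auto
    finally show ?thesis by (simp add: l1_space_def adj_def norm_mult)
  qed
  have abh: "adj ?b \<star> (unit - r) = unit"
    using arg_cong[OF hb, of adj] by (simp add: adj_mult adj_linear sa)
  have "adj ?b = adj ?b \<star> ((unit - r) \<star> ?b)" by (simp add: hb)
  also have "\<dots> = (adj ?b \<star> (unit - r)) \<star> ?b" by (rule mult_assoc[symmetric]) (use ab h b in auto)
  finally have bh: "?b \<star> (unit - r) = unit" using abh by simp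
  have "gns_bounded_operator (\<lambda>x. ?b \<star> x)"
    unfolding gns_bounded_operator_def
    using l1_mult_gns[OF b] b by (auto simp: mult_add_right mult_cscale_right)
  moreover have "?b \<star> ((unit - r) \<star> x) = x \<and> (unit - r) \<star> (?b \<star> x) = x" if "x \<in> gns_space" for x
    using that mult_assoc[OF b h, of x] mult_assoc[OF h b, of x] by (simp add: hb bh)
  ultimately show ?thesis unfolding has_bounded_inverse_def by blast
qed

lemma gns_inner_adj_monomial:
  "gns_inner x (adj (monomial \<alpha>) \<star> x) = cnj (gns_inner x (monomial \<alpha> \<star> x))"
proof -
  have "cnj (gns_inner x (monomial \<alpha> \<star> x)) = (\<Sum>\<^sub>\<infinity>\<beta>. cnj (cnj (x \<beta>) * (monomial \<alpha> \<star> x) \<beta>))"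
    by (simp add: gns_inner_def flip: infsum_cnj)
  also have "\<dots> = (\<Sum>\<^sub>\<infinity>\<beta>. cnj (x \<beta>) * (adj (monomial \<alpha>) \<star> x) \<beta>)"
  proof (rule infsum_reindex_bij_witness[of _ "\<lambda>\<beta>. \<beta> + \<alpha>" "\<lambda>\<beta>. \<beta> - \<alpha>"])
    fix \<beta>
    show "cnj (x (\<beta> - \<alpha>)) * (adj (monomial \<alpha>) \<star> x) (\<beta> - \<alpha>) = cnj (cnj (x \<beta>) * (monomial \<alpha> \<star> x) \<beta>)"
      by (simp add: adj_monomial mult_cscale_left cscale_apply monomial_mult_apply cocycle_uminus_left
          cocycle_uminus_right cocycle_diff_right cnj_cocycle field_simps)
  qed auto
  finally show ?thesis by (simp add: gns_inner_def)
qed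

lemma positive_unit_minus:
  assumes r: "r \<in> smooth_torus" "l1_norm r \<le> 1"
    and real: "\<And>x. x \<in> gns_space \<Longrightarrow> gns_inner x (r \<star> x) \<in> \<real>"
  shows "positive_el (unit - r)"
  unfolding positive_el_def
proof
  fix x assume x: "x \<in> gns_space"
  have rx: "r \<star> x \<in> gns_space" "gns_norm (r \<star> x) \<le> l1_norm r * gns_norm x"
    using l1_mult_gns[of r x] r x by (auto simp: l1_norm_def)
  have "gns_norm (r \<star> x) \<le> gns_norm x"
    using rx(2) mult_right_mono[OF r(2), of "gns_norm x"] by simp
  then have "(gns_norm (r \<star> x))\<^sup>2 \<le> (gns_norm x)\<^sup>2" by (rule power_mono) simp
  from order.trans[OF gns_inner_summable(2)[OF x rx(1)] divide_right_mono[OF add_left_mono[OF this]]]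
  have le: "cmod (gns_inner x (r \<star> x)) \<le> (gns_norm x)\<^sup>2" by simp
  have eq: "gns_inner x ((unit - r) \<star> x) = complex_of_real ((gns_norm x)\<^sup>2) - gns_inner x (r \<star> x)"
    using r x rx by (simp add: mult_diff_left gns_inner_linear gns_inner_self)
  show "gns_inner x ((unit - r) \<star> x) \<in> \<real> \<and> 0 \<le> Re (gns_inner x ((unit - r) \<star> x))"
    unfolding eq using real[OF x] le complex_Re_le_cmod[of "gns_inner x (r \<star> x)"]
    by (auto simp del: of_real_power)
qed

lemma adj_gen: "adj (gen j) = monomial (- axis j 1)"
proof -
  have "- axis j 1 = axis j (- 1 :: int)" by (simp add: axis_def vec_eq_iff)
  then show ?thesis by (simp add: adj_monomial cocycle_axis)
qed

text \<open>
  The factor \<open>1/8\<close> makes the norm of the perturbation at most \<open>1/2\<close>. In the commutator of \<open>h\<close> with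
  \<open>\<delta>\<^sub>0 h\<close>, only \<open>U\<^sub>1 U\<^sub>0\<close> and \<open>U\<^sub>0 U\<^sub>1\<close> contribute at the frequency \<open>e\<^sub>0 + e\<^sub>1\<close>.
\<close>

lemma exists_noncommuting_conformal_factor:
  "\<exists>h\<in>conformal_factors. \<exists>a. h \<star> delta a h \<noteq> delta a h \<star> h"
proof -
  define g where "g j = gen j + adj (gen j)" for j
  define r where "r = (1/8) *\<^sub>C (g 0 + g 1)"
  have g: "g j \<in> smooth_torus" for j by (simp add: g_def)
  have r: "r \<in> smooth_torus" by (simp add: r_def g)
  have g_norm: "l1_norm (g j) \<le> 2" for j
    using l1_norm_add[of "gen j" "adj (gen j)"] by (simp add: g_def adj_gen)
  have r_norm: "l1_norm r \<le> 1 / 2"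
    using l1_norm_add[OF g[of 0] g[of 1]] g_norm[of 0] g_norm[of 1] by (simp add: r_def l1_norm_cscale)
  have sa: "adj r = r" by (simp add: r_def g_def adj_linear add.commute)
  have real: "gns_inner x (r \<star> x) \<in> \<real>" if x: "x \<in> gns_space" for x
  proof -
    have gr: "gns_inner x (g j \<star> x) \<in> \<real>" "g j \<star> x \<in> gns_space" for j
    proof -
      have m: "monomial \<alpha> \<star> x \<in> gns_space" for \<alpha> using x by (intro l1_mult_gns) auto
      have "g j \<star> x = gen j \<star> x + adj (gen j) \<star> x"
        using x by (simp add: g_def mult_add_left)
      then have "gns_inner x (g j \<star> x) = gns_inner x (gen j \<star> x) + cnj (gns_inner x (gen j \<star> x))"
        using gns_inner_linear(1)[OF x m[of "axis j 1"] m[of "- axis j 1"]]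
        by (simp add: adj_gen[symmetric] gns_inner_adj_monomial)
      then show "gns_inner x (g j \<star> x) \<in> \<real>" by (simp add: complex_add_cnj)
      show "g j \<star> x \<in> gns_space" using x g by (intro l1_mult_gns) auto
    qed
    have eq: "gns_inner x (r \<star> x) = (1/8) * (gns_inner x (g 0 \<star> x) + gns_inner x (g 1 \<star> x))"
      unfolding r_def mult_cscale_left
      using x gr(2) g by (simp add: gns_inner_linear mult_add_left)
    show ?thesis unfolding eq by (intro Reals_mult Reals_add gr) simp
  qed
  define h where "h = unit - r"
  have h: "h \<in> conformal_factors"
    using r r_norm sa real
    by (auto simp: conformal_factors_def h_def intro!: positive_unit_minus has_bounded_inverse_unit_minus)
  have neq: "(0::4) \<noteq> 1" by simp
  have less: "(0::4) < 1" by (simp add: less_bit0_def bit0.Rep_1 bit0.Rep_0)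
  define e0 where "e0 = (axis 0 1 :: int^4)"
  define e1 where "e1 = (axis 1 1 :: int^4)"
  have comp: "e0 $ 0 = 1" "e0 $ 1 = 0" "e1 $ 0 = 0" "e1 $ 1 = 1" "\<not> e0 $ 0 = 0"
    using neq by (auto simp: e0_def e1_def axis_def)
  have separate: "u \<noteq> v" if "u $ i \<noteq> v $ i" for u v :: "int^4" and i
    using that by auto
  have distinct: "e0 \<noteq> 0" "e0 \<noteq> e1" "e0 \<noteq> - e1" "2 * e0 \<noteq> 0"
    by (rule separate[where i = 0];
        simp only: mult_2 vector_add_component vector_uminus_component zero_index comp; simp)+
  have distinct': "e1 \<noteq> 0" "e0 + e1 \<noteq> 0" "2 * e1 \<noteq> 0" "2 * e1 + 2 * e0 \<noteq> 0"
    by (rule separate[where i = 1]; simp only: mult_2 vector_add_component zero_index comp; simp)+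
  have r_eq: "r = (1/8) *\<^sub>C ((monomial e0 + monomial (- e0)) + (monomial e1 + monomial (- e1)))"
    by (simp add: r_def g_def adj_gen e0_def e1_def)
  have d_eq: "delta 0 h = (-1/8) *\<^sub>C (monomial e0 - monomial (- e0))"
    using distinct distinct'
    by (auto simp: h_def r_eq delta_def cscale_apply monomial_def fun_eq_iff comp)
  define A where "A = (monomial e0 + monomial (- e0)) + (monomial e1 + monomial (- e1))"
  define D where "D = monomial e0 - monomial (- e0)"
  have AD: "A \<in> smooth_torus" "D \<in> smooth_torus" by (simp_all add: A_def D_def)
  have h_eq: "h = unit - (1/8) *\<^sub>C A" by (simp add: h_def r_eq A_def)
  have "h \<star> delta 0 h - delta 0 h \<star> h = (1/64) *\<^sub>C (A \<star> D - D \<star> A)"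
    unfolding d_eq D_def[symmetric] unfolding h_eq using AD
    by (simp add: smooth_distrib mult_cscale_left mult_cscale_right)
      (simp add: fun_eq_iff cscale_apply algebra_simps)
  then have "(h \<star> delta 0 h - delta 0 h \<star> h) (e0 + e1) = (1/64) * (A \<star> D - D \<star> A) (e0 + e1)"
    by (simp only: cscale_apply)
  also have "(A \<star> D - D \<star> A) (e0 + e1) = cocycle e1 e0 - cocycle e0 e1"
    by (simp add: A_def D_def smooth_distrib monomial_mult cscale_apply)
      (use distinct distinct' in \<open>auto simp: monomial_def\<close>)
  finally have "(h \<star> delta 0 h - delta 0 h \<star> h) (e0 + e1) = (1/64) * (cocycle e1 e0 - cocycle e0 e1)" .
  moreover have "cocycle e1 e0 \<noteq> cocycle e0 e1"
  proof
    assume "cocycle e1 e0 = cocycle e0 e1"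
    then have "exp (2 * pi * \<i> * \<theta> $ 1 $ 0) = 1"
      using less unfolding e0_def e1_def by (simp add: cocycle_axis)
    then obtain n :: int where "\<theta> $ 1 $ 0 = n"
      by (auto simp: exp_eq_1)
    moreover have "- 1 < \<theta> $ 1 $ 0" "\<theta> $ 1 $ 0 < 0"
      using theta_antisym[of 1 0] theta_pos[OF less] theta_less_one[OF less] by auto
    ultimately show False by simp
  qed
  ultimately have "h \<star> delta 0 h \<noteq> delta 0 h \<star> h" by auto
  then show ?thesis using h by blast
qed

end

section \<open>Minimality\<close>

context nc_torus
begin

lemma naive_laplacian_eq: "naive_laplacian h = laplace_type h (\<lambda>_. 0)"
  by (simp add: laplace_type_def fun_eq_iff mult_def cscale_def delta_def)

text \<open>
  Along \<open>T = t G\<close> the residue is \<open>C + \<pi>\<^sup>2/2 (t\<^sup>2 M + t N)\<close> with \<open>N = \<Sum>\<^sub>k t (G\<^sub>k\<^sup>* G\<^sub>k) > 0\<close>, so its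
  derivative at \<open>t = 0\<close> is nonzero.
\<close>

theorem naive_laplacian_not_minimal:
  assumes h: "h \<in> conformal_factors" and nc: "h \<star> delta a h \<noteq> delta a h \<star> h"
  shows "naive_laplacian h \<notin> minimal_operators h"
proof
  assume min: "naive_laplacian h \<in> minimal_operators h"
  have hs: "h \<in> smooth_torus" and pos: "positive_el h" and "has_bounded_inverse h"
    using h by (auto simp: conformal_factors_def)
  then obtain g where g: "g \<in> smooth_torus" "h \<star> g = unit" "g \<star> h = unit"
    using bounded_inverse_smooth by blast
  have sa: "adj h = h" by (rule positive_selfadjoint[OF hs pos])
  define p where "p = h \<star> h"
  define q where "q = g \<star> g"
  have p: "p \<in> smooth_torus" "adj p = p" using hs by (auto simp: p_def adj_mult sa)
  have "h \<star> (g \<star> g) = g" "g \<star> (h \<star> h) = h"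
    using smooth_assoc[of h g g] smooth_assoc[of g h h] hs g by simp_all
  then have pq: "p \<star> q = unit" "q \<star> p = unit"
    using hs g by (simp_all add: p_def q_def smooth_assoc)
  have lap: "torus_laplacian \<theta> h p q T" if "\<And>k. T k \<in> smooth_torus" for T
    by unfold_locales (use that hs g pq in \<open>auto simp: p_def q_def\<close>)
  define G where "G k = torus_commutator p (delta k p)" for k
  have G: "G k \<in> smooth_torus" "adj (G k) = G k" for k
    using p by (auto simp: G_def torus_commutator_def adj_linear adj_mult adj_delta mult_minus_left mult_minus_right)
  define W where "W T = Re (wres_inverse (laplace_type h T))" for T
  define N where "N = (\<Sum>k\<in>UNIV. (gns_norm (G k))\<^sup>2)"
  define M where "M = (\<Sum>k\<in>UNIV. Re (canonical_trace (p \<star> (G k \<star> (p \<star> (G k \<star> p))))))"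
  have trG: "canonical_trace (G k \<star> G k) = complex_of_real ((gns_norm (G k))\<^sup>2)" for k
    using gns_inner_self[of "G k"] G by (simp add: gns_inner_eq_trace)
  have W: "W (\<lambda>k. complex_of_real t *\<^sub>C G k) = Re (residue_constant p q) + pi\<^sup>2 / 2 * (t\<^sup>2 * M + t * N)" for t
  proof -
    have "wres_inverse (laplace_type h (\<lambda>k. complex_of_real t *\<^sub>C G k))
      = residue_constant p q + complex_of_real (pi\<^sup>2 / 2) *
        (\<Sum>k\<in>UNIV. complex_of_real (t\<^sup>2) * canonical_trace (p \<star> (G k \<star> (p \<star> (G k \<star> p))))
            + complex_of_real (t * (gns_norm (G k))\<^sup>2))"
      by (subst torus_laplacian.wres_laplace_type[OF lap])
        (use G in \<open>simp_all add: mult_cscale_left mult_cscale_right trace_linear trG power2_eq_square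
          flip: G_def\<close>)
    then show ?thesis
      unfolding W_def M_def N_def
      by (simp add: sum.distrib sum_distrib_left algebra_simps del: of_real_power of_real_mult)
  qed
  have "N > 0"
  proof -
    have "G a \<noteq> 0"
      using noncommuting_square[OF h nc] by (simp add: G_def torus_commutator_def p_def)
    then have "0 < (gns_norm (G a))\<^sup>2"
      using gns_norm_eq_0[of "G a"] G by auto
    also have "\<dots> \<le> N" unfolding N_def by (rule member_le_sum) auto
    finally show ?thesis .
  qed
  \<comment> \<open>Any \<open>t < 0\<close> with \<open>\<bar>t M\<bar> < N\<close> would do.\<close>
  define t where "t = - (N / (1 + \<bar>M\<bar>))"
  have "t\<^sup>2 * M + t * N < 0"
  proof -
    define c where "c = N / (1 + \<bar>M\<bar>)"
    have c: "0 < c" "N = c * (1 + \<bar>M\<bar>)" using \<open>N > 0\<close> by (auto simp: c_def)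
    have "t\<^sup>2 * M + t * N = (- c)\<^sup>2 * M + (- c) * (c * (1 + \<bar>M\<bar>))"
      unfolding t_def c_def[symmetric] c(2)[symmetric] ..
    also have "\<dots> = c\<^sup>2 * (M - \<bar>M\<bar> - 1)" by (simp add: power2_eq_square algebra_simps)
    also have "\<dots> < 0" using c(1) by (intro mult_pos_neg) auto
    finally show ?thesis .
  qed
  then have less: "W (\<lambda>k. complex_of_real t *\<^sub>C G k) < W (\<lambda>_. 0)"
    using W[of 0] by (simp add: W zero_fun_def mult_pos_neg)
  have "laplace_type h (\<lambda>k. complex_of_real t *\<^sub>C G k) \<in> laplace_family h"
    unfolding laplace_family_def using G by (auto simp: adj_linear)
  then have "W (\<lambda>_. 0) \<le> W (\<lambda>k. complex_of_real t *\<^sub>C G k)"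
    using min by (simp add: minimal_operators_def naive_laplacian_eq W_def)
  with less show False by simp
qed

end

theorem corollary4p4:
  fixes \<theta> :: "real^4^4"
  assumes "nc_torus \<theta>"
  shows "(\<forall>h \<in> nc_torus.conformal_factors \<theta>.
            (\<exists>a. nc_torus.mult \<theta> h (delta a h) \<noteq> nc_torus.mult \<theta> (delta a h) h) \<longrightarrow>
            nc_torus.naive_laplacian \<theta> h \<notin> nc_torus.minimal_operators \<theta> h) \<and>
         (\<exists>h \<in> nc_torus.conformal_factors \<theta>.
            \<exists>a. nc_torus.mult \<theta> h (delta a h) \<noteq> nc_torus.mult \<theta> (delta a h) h)"
  using nc_torus.naive_laplacian_not_minimal[OF assms]
    nc_torus.exists_noncommuting_conformal_factor[OF assms] by blast

end
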